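(* Let $M$ be a geodesically complete connected oriented non-compact Riemannian $C^\infty$-manifold, and let $\mu$ be a non-atomic Radon measure on $(M,\mathcal{B}(M))$ with $\mu(O)>0$ for every non-empty open $O\subset M$ and $\mu(M)=\infty$. Let $0<\alpha<1$. For $\Lambda\in\mathcal{B}_c(M)$ put $$\pi_{\mu,\Lambda}^\alpha:=\sum_{n=0}^\infty\frac{E_\alpha^{(n)}(-\mu(\Lambda))}{n!}\,\mu_\Lambda^{(n)}.$$ Then each $\pi_{\mu,\Lambda}^\alpha$ is a probability measure on $(\Gamma_\Lambda,\mathcal{B}(\Gamma_\Lambda))$, the family is consistent, i.e. $\pi_{\mu,\Lambda_1}^\alpha=\pi_{\mu,\Lambda_2}^\alpha\circ p_{\Lambda_2,\Lambda_1}^{-1}$ for all $\Lambda_1\subset\Lambda_2$ in $\mathcal{B}_c(M)$, and there is a unique measure $\pi_\mu^\alpha$ on $(\Gamma,\mathcal{B}(\Gamma))$ such that $\pi_{\mu,\Lambda}^\alpha=\pi_\mu^\alpha\circ p_\Lambda^{-1}$ for all $\Lambda\in\mathcal{B}_c(M)$. Moreover, for every $\varphi\in\mathcal{D}(M)$, $$\int_\Gamma e^{i\langle\gamma,\varphi\rangle}\,d\pi_\mu^\alpha(\gamma)=E_\alpha\left(\int_M(e^{i\varphi(x)}-1)\,d\mu(x)\right).$$ Consequently, the probability measure on $(\mathcal{D}'(M),\mathcal{C}_\sigma(\mathcal{D}'(M)))$ whose characteristic functional is $\varphi\mapsto E_\alpha\left(\int_M(e^{i\varphi(x)}-1)\,d\mu(x)\right)$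 is supported on the generalized functions of the form $\sum_{x\in\gamma}\delta_x$, $\gamma\in\Gamma$, in the sense that it is the image of $\pi_\mu^\alpha$ under the embedding $\Gamma\ni\gamma\mapsto\sum_{x\in\gamma}\delta_x\in\mathcal{D}'(M)$.
   Context: $E_\alpha(z)=\sum_{n=0}^\infty \frac{z^n}{\Gamma(\alpha n+1)}$ ($z\in\mathbb{C}$, $\Gamma(\cdot)$ the Euler Gamma function) is the Mittag-Leffler function, and $E_\alpha^{(n)}$ is its $n$-th derivative. $\mathcal{D}(M)$ is the space of real-valued compactly supported $C^\infty$-functions on $M$, $\mathcal{D}'(M)$ is its topological dual, and $\mathcal{C}_\sigma(\mathcal{D}'(M))$ is the $\sigma$-algebra generated by the cylinder sets. $\mathcal{B}(M)$ is the Borel $\sigma$-algebra of $M$, and $\mathcal{B}_c(M)$ is the family of Borel sets with compact closure. The configuration space is $\Gamma:=\{\gamma\subset M: |\gamma\cap K|<\infty\text{ for every compact }K\subset M\}$, where $|A|$ denotes the cardinality of $A$. Each $\gamma\in\Gamma$ is identified with the Radon measure $\sum_{x\in\gamma}\delta_x$, and $\langle\gamma,f\rangle:=\sum_{x\in\gamma}f(x)$. $\Gamma$ carries the relative vague topology (the weakest topology making $\gamma\mapsto\langle\gamma,f\rangle$ continuous for all real-valued continuous compactly supported $f$ on $M$), and $\mathcal{B}(\Gamma)$ is its Borel $\sigma$-algebra. For $\Lambda\in\mathcal{B}_c(M)$: $\Gamma_\Lambda:=\{\gamma\in\Gamma:\gamma\subset\Lambda\}$; $\Gamma_\Lambda^{(n)}:=\{\gamma\in\Gamma_\Lambda:|\gamma|=n\}$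 for $n\in\mathbb{N}$, and $\Gamma_\Lambda^{(0)}:=\{\emptyset\}$. Let $\widetilde{\Lambda^n}:=\{(x_1,\dots,x_n)\in\Lambda^n: x_i\ne x_j\text{ if }i\ne j\}$ and $\mathrm{sym}_\Lambda^n:\widetilde{\Lambda^n}\to\Gamma_\Lambda^{(n)}$, $(x_1,\dots,x_n)\mapsto\{x_1,\dots,x_n\}$. This map identifies $\Gamma_\Lambda^{(n)}$ with the quotient $\widetilde{\Lambda^n}/S_n$ by the permutation group and induces a topology and Borel $\sigma$-algebra $\mathcal{B}(\Gamma_\Lambda^{(n)})$. One has $\Gamma_\Lambda=\bigsqcup_{n\ge0}\Gamma_\Lambda^{(n)}$, and $\mathcal{B}(\Gamma_\Lambda)$ is the disjoint union of the $\sigma$-algebras $\mathcal{B}(\Gamma_\Lambda^{(n)})$. The measure $\mu_\Lambda^{(n)}:=\mu^{\otimes n}\circ(\mathrm{sym}_\Lambda^n)^{-1}$ is the image on $\Gamma_\Lambda^{(n)}$ of the restriction of $\mu^{\otimes n}$ to $\widetilde{\Lambda^n}$, and $\mu_\Lambda^{(0)}$ is the unit mass at $\emptyset$. The projections are $p_\Lambda:\Gamma\to\Gamma_\Lambda$, $\gamma\mapsto\gamma\cap\Lambda$, and, for $\Lambda_1\subset\Lambda_2$, $p_{\Lambda_2,\Lambda_1}:\Gamma_{\Lambda_2}\to\Gamma_{\Lambda_1}$, $\gamma\mapsto\gamma\cap\Lambda_1$. *)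

theory Defs
  imports "HOL-Probability.Probability"
begin

definition mittag_leffler :: "real \<Rightarrow> complex \<Rightarrow> complex" where
  "mittag_leffler \<alpha> z = (\<Sum>n. z ^ n / Gamma (of_real (\<alpha> * real n + 1)))"

text \<open>Only used for open \<open>S\<close>; there, this says that all iterated directional derivatives
  of \<open>f\<close> exist and are continuous, i.e. \<open>f\<close> is of class \<open>C\<^sup>k\<close>.\<close>

primrec Ck_on :: "nat \<Rightarrow> 'e::real_normed_vector set \<Rightarrow> ('e \<Rightarrow> 'f::real_normed_vector) \<Rightarrow> bool" where
  "Ck_on 0 S f \<longleftrightarrow> continuous_on S f"
| "Ck_on (Suc k) S f \<longleftrightarrow>
     (\<forall>x\<in>S. f differentiable (at x)) \<and> (\<forall>v. Ck_on k S (\<lambda>x. frechet_derivative f (at x) v))"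

definition smooth_on :: "'e::real_normed_vector set \<Rightarrow> ('e \<Rightarrow> 'f::real_normed_vector) \<Rightarrow> bool" where
  "smooth_on S f \<longleftrightarrow> (\<forall>k. Ck_on k S f)"

text \<open>A chart is a pair \<open>(U, \<phi>)\<close> of a domain and a coordinate map; values of \<open>\<phi>\<close> outside \<open>U\<close>
  are irrelevant. The manifold is the whole type \<open>'a\<close>, its dimension is \<open>CARD('n)\<close>.\<close>

type_synonym ('a, 'n) chart = "'a set \<times> ('a \<Rightarrow> real ^ 'n)"

definition chart_inv :: "('a, 'n) chart \<Rightarrow> real ^ 'n \<Rightarrow> 'a" where
  "chart_inv c = inv_into (fst c) (snd c)"

definition is_chart :: "('a::topological_space, 'n::finite) chart \<Rightarrow> bool" where
  "is_chart c \<longleftrightarrow> open (fst c) \<and> open (snd c ` fst c) \<and>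
     homeomorphism (fst c) (snd c ` fst c) (snd c) (chart_inv c)"

definition transition :: "('a, 'n) chart \<Rightarrow> ('a, 'n) chart \<Rightarrow> real ^ 'n \<Rightarrow> real ^ 'n" where
  "transition c d = snd d \<circ> chart_inv c"

definition jacobian :: "('a, 'n::finite) chart \<Rightarrow> ('a, 'n) chart \<Rightarrow> 'a \<Rightarrow> real ^ 'n ^ 'n" where
  "jacobian c d p = matrix (frechet_derivative (transition c d) (at (snd c p)))"

definition smooth_atlas :: "('a::topological_space, 'n::finite) chart set \<Rightarrow> bool" where
  "smooth_atlas A \<longleftrightarrow> (\<forall>c\<in>A. is_chart c) \<and> (\<Union>c\<in>A. fst c) = UNIV \<and>
     (\<forall>c\<in>A. \<forall>d\<in>A. smooth_on (snd c ` (fst c \<inter> fst d)) (transition c d))"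

text \<open>The orientation is the one for which all charts of the atlas are positively oriented.\<close>

definition oriented_atlas :: "('a::topological_space, 'n::finite) chart set \<Rightarrow> bool" where
  "oriented_atlas A \<longleftrightarrow> smooth_atlas A \<and>
     (\<forall>c\<in>A. \<forall>d\<in>A. \<forall>p\<in>fst c \<inter> fst d. det (jacobian c d p) > 0)"

text \<open>A Riemannian metric is given by its Gram matrices: \<open>g c p\<close> is the matrix of the inner
  product on the tangent space at \<open>p\<close> in the coordinate basis of the chart \<open>c\<close>. The last
  conjunct is the transformation law of a covariant 2-tensor field.\<close>

definition riemannian_metric ::
  "('a::topological_space, 'n::finite) chart set \<Rightarrow> (('a, 'n) chart \<Rightarrow> 'a \<Rightarrow> real ^ 'n ^ 'n) \<Rightarrow> bool" where
  "riemannian_metric A g \<longleftrightarrow>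
     (\<forall>c\<in>A. smooth_on (snd c ` fst c) (g c \<circ> chart_inv c)) \<and>
     (\<forall>c\<in>A. \<forall>p\<in>fst c. transpose (g c p) = g c p \<and> (\<forall>v. v \<noteq> 0 \<longrightarrow> v \<bullet> (g c p *v v) > 0)) \<and>
     (\<forall>c\<in>A. \<forall>d\<in>A. \<forall>p\<in>fst c \<inter> fst d.
        g c p = transpose (jacobian c d p) ** g d p ** jacobian c d p)"

definition metric_partial ::
  "(('a, 'n::finite) chart \<Rightarrow> 'a \<Rightarrow> real ^ 'n ^ 'n) \<Rightarrow> ('a, 'n) chart \<Rightarrow> 'a \<Rightarrow> 'n \<Rightarrow> real ^ 'n ^ 'n" where
  "metric_partial g c p k = frechet_derivative (g c \<circ> chart_inv c) (at (snd c p)) (axis k 1)"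

definition christoffel ::
  "(('a, 'n::finite) chart \<Rightarrow> 'a \<Rightarrow> real ^ 'n ^ 'n) \<Rightarrow> ('a, 'n) chart \<Rightarrow> 'a \<Rightarrow> 'n \<Rightarrow> 'n \<Rightarrow> 'n \<Rightarrow> real" where
  "christoffel g c p k i j =
     (1 / 2) * (\<Sum>l\<in>UNIV. matrix_inv (g c p) $ k $ l *
        (metric_partial g c p i $ j $ l + metric_partial g c p j $ i $ l - metric_partial g c p l $ i $ j))"

definition geodesic_on ::
  "('a::topological_space, 'n::finite) chart set \<Rightarrow> (('a, 'n) chart \<Rightarrow> 'a \<Rightarrow> real ^ 'n ^ 'n) \<Rightarrow>
     real set \<Rightarrow> (real \<Rightarrow> 'a) \<Rightarrow> bool" where
  "geodesic_on A g I \<gamma> \<longleftrightarrow> continuous_on I \<gamma> \<and>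
     (\<forall>c\<in>A. \<exists>v :: real \<Rightarrow> real ^ 'n. \<forall>t\<in>I. \<gamma> t \<in> fst c \<longrightarrow>
        ((\<lambda>s. snd c (\<gamma> s)) has_vector_derivative v t) (at t) \<and>
        (v has_vector_derivative
           (\<chi> k. - (\<Sum>i\<in>UNIV. \<Sum>j\<in>UNIV. christoffel g c (\<gamma> t) k i j * v t $ i * v t $ j))) (at t))"

definition geodesically_complete ::
  "('a::topological_space, 'n::finite) chart set \<Rightarrow> (('a, 'n) chart \<Rightarrow> 'a \<Rightarrow> real ^ 'n ^ 'n) \<Rightarrow> bool" where
  "geodesically_complete A g \<longleftrightarrow>
     (\<forall>I \<gamma>. open I \<and> is_interval I \<and> I \<noteq> {} \<and> geodesic_on A g I \<gamma> \<longrightarrow>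
        (\<exists>\<gamma>'. geodesic_on A g UNIV \<gamma>' \<and> (\<forall>t\<in>I. \<gamma>' t = \<gamma> t)))"

definition test_functions :: "('a::topological_space, 'n::finite) chart set \<Rightarrow> ('a \<Rightarrow> real) set" where
  "test_functions A = {\<phi>. (\<forall>c\<in>A. smooth_on (snd c ` fst c) (\<phi> \<circ> chart_inv c)) \<and>
     compact (closure {x. \<phi> x \<noteq> 0})}"

definition test_functions_in ::
  "('a::topological_space, 'n::finite) chart set \<Rightarrow> 'a set \<Rightarrow> ('a \<Rightarrow> real) set" where
  "test_functions_in A K = {\<phi> \<in> test_functions A. closure {x. \<phi> x \<noteq> 0} \<subseteq> K}"

definition is_seminorm :: "('a \<Rightarrow> real) set \<Rightarrow> (('a \<Rightarrow> real) \<Rightarrow> real) \<Rightarrow> bool" where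
  "is_seminorm V p \<longleftrightarrow>
     (\<forall>\<phi>\<in>V. \<forall>\<psi>\<in>V. p (\<lambda>x. \<phi> x + \<psi> x) \<le> p \<phi> + p \<psi>) \<and>
     (\<forall>a. \<forall>\<phi>\<in>V. p (\<lambda>x. a * \<phi> x) = \<bar>a\<bar> * p \<phi>)"

definition seminorm_topology ::
  "('a \<Rightarrow> real) set \<Rightarrow> (('a \<Rightarrow> real) \<Rightarrow> real) set \<Rightarrow> ('a \<Rightarrow> real) topology" where
  "seminorm_topology V P =
     topology_generated_by {{\<psi> \<in> V. p (\<lambda>x. \<psi> x - \<phi> x) < e} | p \<phi> e. p \<in> P \<and> \<phi> \<in> V \<and> e > 0}"

primrec iterated_derivative ::
  "'e::real_normed_vector list \<Rightarrow> ('e \<Rightarrow> real) \<Rightarrow> 'e \<Rightarrow> real" where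
  "iterated_derivative [] f = f"
| "iterated_derivative (v # vs) f = (\<lambda>x. frechet_derivative (iterated_derivative vs f) (at x) v)"

definition derivative_seminorm ::
  "('a, 'n::finite) chart \<Rightarrow> (real ^ 'n) set \<Rightarrow> (real ^ 'n) list \<Rightarrow> ('a \<Rightarrow> real) \<Rightarrow> real" where
  "derivative_seminorm c L vs \<phi> = (SUP x\<in>L. \<bar>iterated_derivative vs (\<phi> \<circ> chart_inv c) x\<bar>)"

text \<open>The Frechet topology of uniform convergence of all derivatives.\<close>

definition test_topology_in ::
  "('a::topological_space, 'n::finite) chart set \<Rightarrow> 'a set \<Rightarrow> ('a \<Rightarrow> real) topology" where
  "test_topology_in A K = seminorm_topology (test_functions_in A K)
     {derivative_seminorm c L vs | c L vs. c \<in> A \<and> compact L \<and> L \<noteq> {} \<and> L \<subseteq> snd c ` fst c}"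

text \<open>The inductive limit topology: the finest locally convex topology for which the inclusions
  of all \<open>test_functions_in A K\<close>, \<open>K\<close> compact, are continuous.\<close>

definition test_topology ::
  "('a::topological_space, 'n::finite) chart set \<Rightarrow> ('a \<Rightarrow> real) topology" where
  "test_topology A = seminorm_topology (test_functions A)
     {p. is_seminorm (test_functions A) p \<and>
         (\<forall>K. compact K \<longrightarrow> continuous_map (test_topology_in A K) euclideanreal p)}"

text \<open>Functionals are made extensional so that equality is equality on test functions.\<close>

definition generalized_functions ::
  "('a::topological_space, 'n::finite) chart set \<Rightarrow> (('a \<Rightarrow> real) \<Rightarrow> real) set" where
  "generalized_functions A = {u \<in> extensional (test_functions A).
     (\<forall>\<phi>\<in>test_functions A. \<forall>\<psi>\<in>test_functions A. u (\<lambda>x. \<phi> x + \<psi> x) = u \<phi> + u \<psi>) \<and>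
     (\<forall>a. \<forall>\<phi>\<in>test_functions A. u (\<lambda>x. a * \<phi> x) = a * u \<phi>) \<and>
     continuous_map (test_topology A) euclideanreal u}"

definition cylinder_sets ::
  "('a::topological_space, 'n::finite) chart set \<Rightarrow> (('a \<Rightarrow> real) \<Rightarrow> real) set set" where
  "cylinder_sets A =
     {{u \<in> generalized_functions A. (\<lambda>i\<in>{..<k}. u (\<phi> i)) \<in> B} | (k::nat) \<phi> B.
        (\<forall>i<k. \<phi> i \<in> test_functions A) \<and> B \<in> sets (\<Pi>\<^sub>M i\<in>{..<k}. (borel :: real measure))}"

definition cylinder_algebra ::
  "('a::topological_space, 'n::finite) chart set \<Rightarrow> (('a \<Rightarrow> real) \<Rightarrow> real) measure" where
  "cylinder_algebra A = sigma (generalized_functions A) (cylinder_sets A)"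

definition has_characteristic_functional ::
  "('a::topological_space, 'n::finite) chart set \<Rightarrow> (('a \<Rightarrow> real) \<Rightarrow> real) measure \<Rightarrow>
     (('a \<Rightarrow> real) \<Rightarrow> complex) \<Rightarrow> bool" where
  "has_characteristic_functional A P C \<longleftrightarrow>
     prob_space P \<and> sets P = sets (cylinder_algebra A) \<and>
     (\<forall>\<phi>\<in>test_functions A. (\<integral>u. exp (\<i> * of_real (u \<phi>)) \<partial>P) = C \<phi>)"

definition radon_measure :: "'a::topological_space measure \<Rightarrow> bool" where
  "radon_measure \<mu> \<longleftrightarrow> sets \<mu> = sets borel \<and>
     (\<forall>K. compact K \<longrightarrow> emeasure \<mu> K < \<infinity>) \<and>
     (\<forall>B\<in>sets borel. emeasure \<mu> B = (SUP K\<in>{K. compact K \<and> K \<subseteq> B}. emeasure \<mu> K))"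

definition non_atomic :: "'a measure \<Rightarrow> bool" where
  "non_atomic \<mu> \<longleftrightarrow> (\<forall>A\<in>sets \<mu>. emeasure \<mu> A > 0 \<longrightarrow>
     (\<exists>B\<in>sets \<mu>. B \<subseteq> A \<and> 0 < emeasure \<mu> B \<and> emeasure \<mu> B < emeasure \<mu> A))"

definition relatively_compact_borel :: "'a::topological_space set set" where
  "relatively_compact_borel = {\<Lambda> \<in> sets borel. compact (closure \<Lambda>)}"

definition configurations :: "'a::topological_space set set" where
  "configurations = {\<gamma>. \<forall>K. compact K \<longrightarrow> finite (\<gamma> \<inter> K)}"

text \<open>For compactly supported \<open>f\<close> only finitely many summands are non-zero.\<close>

definition pairing :: "'a set \<Rightarrow> ('a \<Rightarrow> real) \<Rightarrow> real" where
  "pairing \<gamma> f = (\<Sum>\<^sub>\<infinity>x\<in>\<gamma>. f x)"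

definition vague_topology :: "'a::topological_space set topology" where
  "vague_topology = topology_generated_by
     {{\<gamma> \<in> configurations. pairing \<gamma> f \<in> V} | f V.
        continuous_on UNIV f \<and> compact (closure {x. f x \<noteq> 0}) \<and> open V}"

definition borel_configurations :: "'a::topological_space set measure" where
  "borel_configurations = sigma configurations {U. openin vague_topology U}"

definition configurations_in :: "'a::topological_space set \<Rightarrow> 'a set set" where
  "configurations_in \<Lambda> = {\<gamma> \<in> configurations. \<gamma> \<subseteq> \<Lambda>}"

definition n_configurations_in :: "'a::topological_space set \<Rightarrow> nat \<Rightarrow> 'a set set" where
  "n_configurations_in \<Lambda> n = {\<gamma> \<in> configurations_in \<Lambda>. finite \<gamma> \<and> card \<gamma> = n}"

definition distinct_tuples :: "'a set \<Rightarrow> nat \<Rightarrow> (nat \<Rightarrow> 'a) set" where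
  "distinct_tuples \<Lambda> n = {x \<in> {..<n} \<rightarrow>\<^sub>E \<Lambda>. inj_on x {..<n}}"

definition sym_map :: "nat \<Rightarrow> (nat \<Rightarrow> 'a) \<Rightarrow> 'a set" where
  "sym_map n x = x ` {..<n}"

text \<open>The quotient topology with respect to \<open>sym_map n\<close>.\<close>

definition n_configuration_topology :: "'a::topological_space set \<Rightarrow> nat \<Rightarrow> 'a set topology" where
  "n_configuration_topology \<Lambda> n = topology (\<lambda>U. U \<subseteq> n_configurations_in \<Lambda> n \<and>
     openin (subtopology (product_topology (\<lambda>_. euclidean) {..<n}) (distinct_tuples \<Lambda> n))
       {x \<in> distinct_tuples \<Lambda> n. sym_map n x \<in> U})"

lemma openin_n_configuration_topology:
  "openin (n_configuration_topology \<Lambda> n) U \<longleftrightarrow> U \<subseteq> n_configurations_in \<Lambda> n \<and>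
     openin (subtopology (product_topology (\<lambda>_. euclidean) {..<n}) (distinct_tuples \<Lambda> n))
       {x \<in> distinct_tuples \<Lambda> n. sym_map n x \<in> U}"
proof -
  let ?T = "subtopology (product_topology (\<lambda>_. euclidean) {..<n}) (distinct_tuples \<Lambda> n)"
  have "istopology (\<lambda>U. U \<subseteq> n_configurations_in \<Lambda> n \<and>
    openin ?T {x \<in> distinct_tuples \<Lambda> n. sym_map n x \<in> U})"
    unfolding istopology_def
  proof (intro conjI allI impI; (elim conjE)?)
    fix S U
    assume "openin ?T {x \<in> distinct_tuples \<Lambda> n. sym_map n x \<in> S}"
      and "openin ?T {x \<in> distinct_tuples \<Lambda> n. sym_map n x \<in> U}"
    then have "openin ?T ({x \<in> distinct_tuples \<Lambda> n. sym_map n x \<in> S} \<inter>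
      {x \<in> distinct_tuples \<Lambda> n. sym_map n x \<in> U})"
      by (rule openin_Int)
    also have "{x \<in> distinct_tuples \<Lambda> n. sym_map n x \<in> S} \<inter>
        {x \<in> distinct_tuples \<Lambda> n. sym_map n x \<in> U} =
      {x \<in> distinct_tuples \<Lambda> n. sym_map n x \<in> S \<inter> U}" by auto
    finally show "openin ?T {x \<in> distinct_tuples \<Lambda> n. sym_map n x \<in> S \<inter> U}" .
  next
    fix \<K>
    assume *: "\<forall>S\<in>\<K>. S \<subseteq> n_configurations_in \<Lambda> n \<and>
      openin ?T {x \<in> distinct_tuples \<Lambda> n. sym_map n x \<in> S}"
    then have "openin ?T (\<Union>S\<in>\<K>. {x \<in> distinct_tuples \<Lambda> n. sym_map n x \<in> S})" by auto
    also have "(\<Union>S\<in>\<K>. {x \<in> distinct_tuples \<Lambda> n. sym_map n x \<in> S}) =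
      {x \<in> distinct_tuples \<Lambda> n. sym_map n x \<in> \<Union>\<K>}" by auto
    finally show "openin ?T {x \<in> distinct_tuples \<Lambda> n. sym_map n x \<in> \<Union>\<K>}" .
  qed auto
  then show ?thesis
    unfolding n_configuration_topology_def by (simp add: topology_inverse')
qed

definition borel_n_configurations_in :: "'a::topological_space set \<Rightarrow> nat \<Rightarrow> 'a set measure" where
  "borel_n_configurations_in \<Lambda> n =
     sigma (n_configurations_in \<Lambda> n) {U. openin (n_configuration_topology \<Lambda> n) U}"

definition borel_configurations_in :: "'a::topological_space set \<Rightarrow> 'a set measure" where
  "borel_configurations_in \<Lambda> = sigma (configurations_in \<Lambda>)
     {B. B \<subseteq> configurations_in \<Lambda> \<and>
         (\<forall>n. B \<inter> n_configurations_in \<Lambda> n \<in> sets (borel_n_configurations_in \<Lambda> n))}"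

text \<open>For \<open>n = 0\<close> the product measure is the unit mass at the empty tuple, so that its image is the
  unit mass at the empty configuration, as it should be.\<close>

definition n_configuration_measure ::
  "'a::topological_space measure \<Rightarrow> 'a set \<Rightarrow> nat \<Rightarrow> 'a set measure" where
  "n_configuration_measure \<mu> \<Lambda> n =
     distr (restrict_space (\<Pi>\<^sub>M i\<in>{..<n}. \<mu>) (distinct_tuples \<Lambda> n))
       (borel_n_configurations_in \<Lambda> n) (sym_map n)"

text \<open>The coefficients are real; \<open>ennreal\<close> would map negative ones to 0, so their
  non-negativity has to be asserted separately.\<close>

definition fractional_poisson_weight :: "real \<Rightarrow> real \<Rightarrow> nat \<Rightarrow> complex" where
  "fractional_poisson_weight \<alpha> m n = (deriv ^^ n) (mittag_leffler \<alpha>) (- of_real m) / fact n"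

definition fractional_poisson_in ::
  "real \<Rightarrow> 'a::topological_space measure \<Rightarrow> 'a set \<Rightarrow> 'a set measure" where
  "fractional_poisson_in \<alpha> \<mu> \<Lambda> =
     measure_of (configurations_in \<Lambda>) (sets (borel_configurations_in \<Lambda>))
       (\<lambda>B. \<Sum>n. ennreal (Re (fractional_poisson_weight \<alpha> (measure \<mu> \<Lambda>) n)) *
         emeasure (n_configuration_measure \<mu> \<Lambda> n) (B \<inter> n_configurations_in \<Lambda> n))"

definition restrict_configuration :: "'a set \<Rightarrow> 'a set \<Rightarrow> 'a set" where
  "restrict_configuration \<Lambda> \<gamma> = \<gamma> \<inter> \<Lambda>"

definition has_projections ::
  "('a::topological_space set \<Rightarrow> 'a set measure) \<Rightarrow> 'a set measure \<Rightarrow> bool" where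
  "has_projections \<pi>\<^sub>f \<pi> \<longleftrightarrow> sets \<pi> = sets borel_configurations \<and>
     (\<forall>\<Lambda>\<in>relatively_compact_borel.
        restrict_configuration \<Lambda> \<in> borel_configurations \<rightarrow>\<^sub>M borel_configurations_in \<Lambda> \<and>
        \<pi>\<^sub>f \<Lambda> = distr \<pi> (borel_configurations_in \<Lambda>) (restrict_configuration \<Lambda>))"

definition delta_embedding ::
  "('a::topological_space, 'n::finite) chart set \<Rightarrow> 'a set \<Rightarrow> ('a \<Rightarrow> real) \<Rightarrow> real" where
  "delta_embedding A \<gamma> = (\<lambda>\<phi>\<in>test_functions A. pairing \<gamma> \<phi>)"

definition fractional_poisson_functional ::
  "real \<Rightarrow> 'a measure \<Rightarrow> ('a \<Rightarrow> real) \<Rightarrow> complex" where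
  "fractional_poisson_functional \<alpha> \<mu> \<phi> =
     mittag_leffler \<alpha> (\<integral>x. (exp (\<i> * of_real (\<phi> x)) - 1) \<partial>\<mu>)"

end

theory Submission
  imports Defs "HOL-Real_Asymp.Real_Asymp" "HOL-Complex_Analysis.Complex_Analysis"
begin

text \<open>The fractional Poisson measure is a mixture of Poisson measures: there is a probability
  measure \<open>\<nu>\<close> on the half-line (the Mittag-Leffler law) whose \<open>j\<close>-th moment is \<open>j! / \<Gamma>(\<alpha> j + 1)\<close>.
  Hence \<open>E\<^sub>\<alpha>(z) = \<integral> e\<^sup>\<tau>\<^sup>z d\<nu>(\<tau>)\<close>, so that the weights \<open>E\<^sub>\<alpha>\<^sup>(\<^sup>n\<^sup>)(-m) / n!\<close> are the mixed Poisson weights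
  \<open>\<integral> e\<^sup>-\<^sup>\<tau>\<^sup>m \<tau>\<^sup>n / n! d\<nu>(\<tau>)\<close>, and in particular non-negative. The law \<open>\<nu>\<close> is obtained from Helly's theorem
  as a limit of rescaled renewal counts, whose moments are explicit.

  Partition \<open>M\<close> into countably many relatively compact pieces. Superposing independent Poisson
  configurations of intensity \<open>\<tau>\<mu>\<close> on the pieces and mixing over \<open>\<tau>\<close> gives a measure on \<open>\<Gamma>\<close> with
  characteristic functional \<open>E\<^sub>\<alpha>(\<integral>(e\<^sup>i\<^sup>f - 1) d\<mu>)\<close> for all Borel \<open>f\<close> vanishing outside a relatively compact
  set. All identities between measures (projections, consistency, uniqueness on \<open>\<Gamma>\<close> and on the dual of
  the test functions) then follow since a probability measure is determined by the characteristic
  functional on a vector space of random variables generating the sigma-algebra; on \<open>\<Gamma>\<close> and \<open>\<Gamma>\<^sub>\<Lambda>\<close> the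
  Borel sigma-algebras are generated by the counts \<open>\<gamma> \<mapsto> |\<gamma> \<inter> B|\<close>.\<close>

section \<open>Uniqueness by characteristic functionals\<close>

text \<open>The first obstacle is positivity: the series of E_alpha does not show the sign of its
  derivatives on the negative axis; the mixing law supplies it. The renewal process is read off from
  the moments wanted. The coefficients of (1 - X)^(-(alpha j + 1)) grow like n^(alpha j) /
  Gamma(alpha j + 1), and steps with generating function 1 - (1 - X)^alpha make them exactly the
  expectations of (k + 1)...(k + j) / j! for the renewal count k. Replacing k by a Gamma variable of
  shape k + 1 turns these rising factorial moments into ordinary ones, so that the only limit to
  compute is Euler's limit for the Gamma function.

  The second obstacle is dependence: under the fractional measure the counts in disjoint sets are
  not independent, so it is not a product over the pieces. For a fixed \<tau> they are, which is why
  the product is taken first and the mixture afterwards. The measure on all configurations thus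
  exists before consistency is known, and consistency follows by composing restrictions.\<close>

inductive trig_poly :: "(real \<Rightarrow> complex) \<Rightarrow> bool" where
  exp: "trig_poly (\<lambda>y. iexp (t * y))"
| scale: "trig_poly q \<Longrightarrow> trig_poly (\<lambda>y. c * q y)"
| add: "trig_poly q \<Longrightarrow> trig_poly r \<Longrightarrow> trig_poly (\<lambda>y. q y + r y)"

lemma trig_poly_borel: "trig_poly q \<Longrightarrow> q \<in> borel_measurable borel"
  by (induction rule: trig_poly.induct) auto

lemma trig_poly_bounded: "trig_poly q \<Longrightarrow> \<exists>B. \<forall>y. norm (q y) \<le> B"
proof (induction rule: trig_poly.induct)
  case (exp t)
  show ?case by (intro exI[of _ 1]) (simp del: of_real_mult)
next
  case (scale q c)
  then obtain B where B: "norm (q y) \<le> B" for y by blast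
  show ?case
    by (intro exI[of _ "norm c * B"]) (auto simp: norm_mult intro!: mult_left_mono B)
next
  case (add q r)
  then obtain B B' where B: "norm (q y) \<le> B" "norm (r y) \<le> B'" for y by blast
  show ?case
    by (intro exI[of _ "B + B'"]) (auto intro!: order_trans[OF norm_triangle_ineq] add_mono B)
qed

text \<open>Frequencies are arbitrary reals and add under multiplication, so the span of the
  characters is an algebra.\<close>

lemma trig_poly_mult: "trig_poly q \<Longrightarrow> trig_poly r \<Longrightarrow> trig_poly (\<lambda>y. q y * r y)"
proof (induction arbitrary: r rule: trig_poly.induct)
  case (exp t)
  then show ?case
  proof (induction rule: trig_poly.induct)
    case (exp s)
    have "(\<lambda>y. iexp (t * y) * iexp (s * y)) =
      (\<lambda>y. iexp ((t + s) * y))"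
      by (simp add: exp_add[symmetric] algebra_simps)
    then show ?case using trig_poly.exp by metis
  next
    case (scale q c)
    from trig_poly.scale[OF this(2), of c] show ?case by (simp add: algebra_simps)
  next
    case (add q r)
    from trig_poly.add[OF add.IH] show ?case by (simp add: algebra_simps)
  qed
next
  case (scale q c)
  from trig_poly.scale[OF scale.IH[OF scale.prems], of c] show ?case by (simp add: algebra_simps)
next
  case (add q1 q2)
  from trig_poly.add[OF add.IH(1)[OF add.prems] add.IH(2)[OF add.prems]] show ?case
    by (simp add: algebra_simps)
qed

lemma trig_poly_const: "trig_poly (\<lambda>y. c)"
  using trig_poly.scale[OF trig_poly.exp[of 0], of c] by simp

text \<open>By Euler's formulas a linear form on the unit circle is a combination of two characters,
  and constants, sums and products stay in the algebra. This carries Stone-Weierstrass on the circle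
  over to the line.\<close>

lemma trig_poly_real_polynomial_cis:
  "real_polynomial_function p \<Longrightarrow> trig_poly (\<lambda>y. of_real (p (cis (s * y + b))))"
proof (induction rule: real_polynomial_function.induct)
  case (linear p)
  then interpret bounded_linear p .
  have p: "p (cis x) = p 1 * cos x + p \<i> * sin x" for x
  proof -
    have "cis x = cos x *\<^sub>R 1 + sin x *\<^sub>R \<i>" by (simp add: complex_eq_iff)
    then show ?thesis by (simp only: add scaleR) simp
  qed
  let ?e = "\<lambda>t y. iexp (t * y)"
  have *: "complex_of_real (p (cis (s * y + b))) =
     (of_real (p 1) + of_real (p \<i>) / \<i>) / 2 * exp (\<i> * b) * ?e s y +
     (of_real (p 1) - of_real (p \<i>) / \<i>) / 2 * exp (- \<i> * b) * ?e (- s) y" for y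
  proof -
    have c: "complex_of_real (cos (s * y + b)) = (exp (\<i> * b) * ?e s y + exp (- \<i> * b) * ?e (-s) y) / 2"
      by (simp add: cos_of_real[symmetric] cos_exp_eq exp_add[symmetric] algebra_simps del: cos_of_real)
    have s: "complex_of_real (sin (s * y + b)) = (exp (\<i> * b) * ?e s y - exp (- \<i> * b) * ?e (-s) y) / (2 * \<i>)"
      by (simp add: sin_of_real[symmetric] sin_exp_eq exp_add[symmetric] algebra_simps del: sin_of_real)
    have alg: "c * ((E * P + F * Q) / 2) + d * ((E * P - F * Q) / (2 * \<i>)) =
      (c + d / \<i>) / 2 * E * P + (c - d / \<i>) / 2 * F * Q" for c d E F P Q :: complex
      by (simp add: field_simps)
    show ?thesis unfolding p of_real_add of_real_mult[of "p _"] c s by (rule alg)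
  qed
  show ?case unfolding * by (intro trig_poly.intros)
next
  case (const c)
  show ?case by (rule trig_poly_const)
next
  case (add f g)
  then show ?case using trig_poly.add by simp
next
  case (mult f g)
  then show ?case using trig_poly_mult by simp
qed

text \<open>Bounded pointwise convergence is what dominated convergence will need. The m-th
  approximant has period 2m and comes from a steep sine clipped to [0, 1]: the sine is nonpositive
  on [a - m, a] and positive on (a, a + m), and every y eventually lies within distance m of a. The
  bound 2 is 1 for the clipped sine plus an approximation error of at most 1.\<close>

lemma half_line_trig_approx:
  fixes a :: real
  obtains q where "\<And>m::nat. trig_poly (q m)" "\<And>m y. norm (q m y) \<le> 2"
    "\<And>y. (\<lambda>m. q m y) \<longlonglongrightarrow> indicator {a<..} y"
proof -
  \<comment> \<open>The angle is of order 1/m, so the factor m^2 drives the sine to infinity at each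
    fixed y > a, and the clipped value is eventually exactly 1.\<close>
  define G where "G m w = max 0 (min 1 ((real m)\<^sup>2 * Im w))" for m :: nat and w
  have "\<exists>p. real_polynomial_function p \<and> (\<forall>w\<in>sphere 0 1. \<bar>G m w - p w\<bar> < 1 / Suc m)" for m
    by (rule Stone_Weierstrass_real_polynomial_function[of "sphere 0 1" "G m" "1 / Suc m"])
       (auto simp: G_def intro!: continuous_intros)
  then obtain p where p: "\<And>m. real_polynomial_function (p m)"
      "\<And>m w. w \<in> sphere 0 1 \<Longrightarrow> \<bar>G m w - p m w\<bar> < 1 / Suc m" by metis
  define \<theta> where "\<theta> m y = pi / real m * y + - (pi / real m * a)" for m :: nat and y
  define q where "q m y = complex_of_real (p m (cis (\<theta> m y)))" for m y
  have app: "\<bar>G m (cis (\<theta> m y)) - p m (cis (\<theta> m y))\<bar> < 1 / Suc m" for m y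
    by (rule p) simp
  show thesis
  proof
    show "trig_poly (q m)" for m
      unfolding q_def \<theta>_def by (intro trig_poly_real_polynomial_cis p)
    show "norm (q m y) \<le> 2" for m y
    proof -
      have "\<bar>G m (cis (\<theta> m y))\<bar> \<le> 1" by (simp add: G_def)
      moreover have "1 / Suc m \<le> (1::real)" by simp
      ultimately show ?thesis using app[of m y] unfolding q_def norm_of_real by linarith
    qed
    show "(\<lambda>m. q m y) \<longlonglongrightarrow> indicator {a<..} y" for y
    proof -
      have \<theta>: "\<theta> m y = pi * (y - a) / real m" for m by (simp add: \<theta>_def algebra_simps diff_divide_distrib)
      have "(\<lambda>m. p m (cis (\<theta> m y)) - G m (cis (\<theta> m y))) \<longlonglongrightarrow> 0"
      proof (rule Lim_null_comparison)
        show "\<forall>\<^sub>F m in sequentially. norm (p m (cis (\<theta> m y)) - G m (cis (\<theta> m y))) \<le> 1 / Suc m"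
          using app[of _ y] by (intro always_eventually) (auto simp: abs_minus_commute intro: less_imp_le)
        show "(\<lambda>m. 1 / real (Suc m)) \<longlonglongrightarrow> 0" by (rule LIMSEQ_Suc[OF lim_1_over_n])
      qed
      moreover have "(\<lambda>m. G m (cis (\<theta> m y))) \<longlonglongrightarrow> indicator {a<..} y"
      proof (cases "y > a")
        case True
        have "filterlim (\<lambda>m. (real m)\<^sup>2 * sin (pi * (y - a) / real m)) at_top sequentially"
          using True by real_asymp
        then have "\<forall>\<^sub>F m in sequentially. (real m)\<^sup>2 * sin (pi * (y - a) / real m) \<ge> 1"
          by (simp add: filterlim_at_top)
        then have "\<forall>\<^sub>F m in sequentially. indicator {a<..} y = G m (cis (\<theta> m y))"
          by eventually_elim (use True in \<open>auto simp: G_def \<theta>\<close>)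
        then show ?thesis by (rule Lim_transform_eventually[OF tendsto_const])
      next
        case False
        have "\<forall>\<^sub>F m in sequentially. real m > a - y" by real_asymp
        then have "\<forall>\<^sub>F m in sequentially. indicator {a<..} y = G m (cis (\<theta> m y))"
        proof eventually_elim
          case (elim m)
          have "sin (pi * (y - a) / real m) = - sin (pi * ((a - y) / real m))"
            by (simp flip: sin_minus add: algebra_simps diff_divide_distrib)
          moreover have "0 \<le> sin (pi * ((a - y) / real m))"
            using elim False by (intro sin_ge_zero mult_nonneg_nonneg mult_left_le) (auto simp: divide_simps)
          ultimately have "sin (pi * (y - a) / real m) \<le> 0" by simp
          then have "(real m)\<^sup>2 * sin (pi * (y - a) / real m) \<le> 0" by (simp add: mult_nonneg_nonpos)
          then show ?case using False by (simp add: G_def \<theta>)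
        qed
        then show ?thesis by (rule Lim_transform_eventually[OF tendsto_const])
      qed
      ultimately have "(\<lambda>m. p m (cis (\<theta> m y)) - G m (cis (\<theta> m y)) + G m (cis (\<theta> m y))) \<longlonglongrightarrow> 0 + indicator {a<..} y"
        by (rule tendsto_add)
      then have "(\<lambda>m. of_real (p m (cis (\<theta> m y)))) \<longlonglongrightarrow> complex_of_real (indicator {a<..} y)"
        by (intro tendsto_of_real) simp
      then show ?thesis unfolding q_def by (simp add: indicator_def of_bool_def split: if_splits)
    qed
  qed
qed

text \<open>The indicator of each event Z v > a is a bounded limit of trigonometric polynomials in Z
  v. Inserting such indicators one at a time gives agreement on all finite intersections of
  half-spaces, an intersection-stable generator. Closure of the index set is asked only up to
  equality on the space, so that indices may be pairs as well as functions.\<close>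

lemma measure_eqI_charfun:
  fixes M N :: "'w measure" and Z :: "'i \<Rightarrow> 'w \<Rightarrow> real"
  assumes M: "prob_space M" and N: "prob_space N" and sets: "sets M = sets N"
    and gen: "sets M \<subseteq> sigma_sets (space M) {{x \<in> space M. Z i x \<in> B} | i B. i \<in> I \<and> B \<in> sets borel}"
    and meas: "\<And>i. i \<in> I \<Longrightarrow> Z i \<in> borel_measurable M"
    and I_ne: "I \<noteq> {}"
    and I_add: "\<And>i j. i \<in> I \<Longrightarrow> j \<in> I \<Longrightarrow> \<exists>k\<in>I. \<forall>x\<in>space M. Z k x = Z i x + Z j x"
    and I_scale: "\<And>c i. i \<in> I \<Longrightarrow> \<exists>k\<in>I. \<forall>x\<in>space M. Z k x = c * Z i x"
    and eq: "\<And>i. i \<in> I \<Longrightarrow> (\<integral>x. iexp (Z i x) \<partial>M) = (\<integral>x. iexp (Z i x) \<partial>N)"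
  shows "M = N"
proof -
  interpret M: prob_space M by fact
  interpret N: prob_space N by fact
  have space: "space N = space M" by (rule sets_eq_imp_space_eq[OF sets, symmetric])
  define D :: "('i \<times> real) list \<Rightarrow> 'w \<Rightarrow> complex" where
    "D vs x = (if \<forall>(v, a)\<in>set vs. Z v x > a then 1 else 0)" for vs x
  have measN: "Z v \<in> borel_measurable N" if "v \<in> I" for v
    using meas[OF that] measurable_cong_sets[OF sets refl] by auto
  have D_Nil: "D [] x = 1" for x by (simp add: D_def)
  have D_Cons: "D ((v, a) # vs) x = indicator {a<..} (Z v x) * D vs x" for v a vs x
    by (auto simp: D_def indicator_def)
  have D_meas: "set vs \<subseteq> I \<times> UNIV \<Longrightarrow> D vs \<in> borel_measurable M" for vs
  proof (induction vs)
    case Nil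
    then show ?case by (simp add: D_Nil cong: measurable_cong)
  next
    case (Cons va vs)
    obtain v a where va: "va = (v, a)" by (cases va)
    then have "v \<in> I" "set vs \<subseteq> I \<times> UNIV" using Cons.prems by auto
    then have [measurable]: "Z v \<in> borel_measurable M" "D vs \<in> borel_measurable M"
      using Cons.IH meas by auto
    show ?case unfolding va D_Cons[abs_def] by measurable
  qed
  have D_measN: "set vs \<subseteq> I \<times> UNIV \<Longrightarrow> D vs \<in> borel_measurable N" for vs
    using D_meas measurable_cong_sets[OF sets refl] by auto
  have D_le: "norm (D vs x) \<le> 1" for vs x by (simp add: D_def)
  have bound: "norm (exp (\<i> * complex_of_real r) * q * D vs x) \<le> B" if "norm q \<le> B" for r q vs x B
    using mult_mono[OF that D_le[of vs x]] order_trans[OF norm_ge_zero that] by (simp add: norm_mult)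
  \<comment> \<open>The free character of \<open>Z v0\<close> makes the induction work: a character
    of \<open>Z v\<close> arising from the approximation merges with it into a single character,
    whose index is again in \<open>I\<close>.\<close>
  have main: "set vs \<subseteq> I \<times> UNIV \<Longrightarrow> v0 \<in> I \<Longrightarrow>
    (\<integral>x. iexp (Z v0 x) * D vs x \<partial>M) = (\<integral>x. iexp (Z v0 x) * D vs x \<partial>N)" for vs v0
  proof (induction vs arbitrary: v0)
    case Nil
    then show ?case by (simp add: D_Nil eq)
  next
    case (Cons va vs)
    obtain v a where va: "va = (v, a)" by (cases va)
    then have v: "v \<in> I" and vs: "set vs \<subseteq> I \<times> UNIV" using Cons.prems by auto
    note [measurable] = meas[OF v] measN[OF v] D_meas[OF vs] D_measN[OF vs]
    have int: "integrable M (\<lambda>x. iexp (Z u x) * q (Z v x) * D vs x)"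
       "integrable N (\<lambda>x. iexp (Z u x) * q (Z v x) * D vs x)" if q: "trig_poly q" and u: "u \<in> I" for u q
    proof -
      note [measurable] = meas[OF u] measN[OF u] trig_poly_borel[OF q]
      obtain B where B: "norm (q y) \<le> B" for y using trig_poly_bounded[OF q] by blast
      show "integrable M (\<lambda>x. iexp (Z u x) * q (Z v x) * D vs x)"
        by (rule M.integrable_const_bound[of _ B]) (auto intro!: bound B)
      show "integrable N (\<lambda>x. iexp (Z u x) * q (Z v x) * D vs x)"
        by (rule N.integrable_const_bound[of _ B]) (auto intro!: bound B)
    qed
    have trig: "(\<integral>x. iexp (Z u x) * q (Z v x) * D vs x \<partial>M) =
          (\<integral>x. iexp (Z u x) * q (Z v x) * D vs x \<partial>N)" if "trig_poly q" "u \<in> I" for u q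
      using that
    proof (induction rule: trig_poly.induct)
      case (exp t)
      obtain k where k: "k \<in> I" "\<And>x. x \<in> space M \<Longrightarrow> Z k x = Z u x + t * Z v x"
        using I_scale[OF v, of t] I_add[OF exp] by force
      have *: "(\<integral>x. iexp (Z u x) * iexp (t * Z v x) * D vs x \<partial>K) = (\<integral>x. iexp (Z k x) * D vs x \<partial>K)"
        if "space K = space M" for K
        by (rule Bochner_Integration.integral_cong[OF refl])
          (use that k(2) in \<open>simp add: exp_add algebra_simps\<close>)
      show ?case unfolding *[OF refl] *[OF space] by (rule Cons.IH[OF vs k(1)])
    next
      case (scale q c)
      have "(\<lambda>x. iexp (Z u x) * (c * q (Z v x)) * D vs x) =
        (\<lambda>x. c * (iexp (Z u x) * q (Z v x) * D vs x))" by (simp add: algebra_simps)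
      with scale show ?case by simp
    next
      case (add q r)
      have "(\<lambda>x. iexp (Z u x) * (q (Z v x) + r (Z v x)) * D vs x) =
        (\<lambda>x. iexp (Z u x) * q (Z v x) * D vs x + iexp (Z u x) * r (Z v x) * D vs x)"
        by (simp add: algebra_simps)
      with add int[OF add.hyps(1) add.prems] int[OF add.hyps(2) add.prems] show ?case by simp
    qed
    obtain q where q: "\<And>m::nat. trig_poly (q m)" "\<And>m y. norm (q m y) \<le> 2"
      "\<And>y. (\<lambda>m. q m y) \<longlonglongrightarrow> indicator {a<..} y" by (rule half_line_trig_approx[of a]) blast
    note [measurable] = meas[OF Cons.prems(2)] measN[OF Cons.prems(2)] trig_poly_borel[OF q(1)]
    let ?f = "\<lambda>x. iexp (Z v0 x) * indicator {a<..} (Z v x) * D vs x"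
    let ?g = "\<lambda>m x. iexp (Z v0 x) * q m (Z v x) * D vs x"
    have "(\<lambda>m. integral\<^sup>L M (?g m)) \<longlonglongrightarrow> integral\<^sup>L M ?f"
      by (rule integral_dominated_convergence[where w="\<lambda>_. 2"]) (auto intro!: bound q tendsto_intros)
    moreover have "(\<lambda>m. integral\<^sup>L N (?g m)) \<longlonglongrightarrow> integral\<^sup>L N ?f"
      by (rule integral_dominated_convergence[where w="\<lambda>_. 2"]) (auto intro!: bound q tendsto_intros)
    ultimately have "integral\<^sup>L M ?f = integral\<^sup>L N ?f"
      unfolding trig[OF q(1) Cons.prems(2)] by (rule LIMSEQ_unique)
    then show ?case by (simp add: va D_Cons mult.assoc)
  qed
  define E where "E = {{x \<in> space M. \<forall>(v, a)\<in>set vs. Z v x > a} | vs. set vs \<subseteq> I \<times> UNIV}"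
  have E_sets: "X \<in> sets M" if X: "X \<in> E" for X
  proof -
    obtain vs where vs: "set vs \<subseteq> I \<times> UNIV" "X = {x \<in> space M. \<forall>(v, a)\<in>set vs. Z v x > a}"
      using X by (auto simp: E_def)
    note [measurable] = D_meas[OF vs(1)]
    have "X = {x \<in> space M. D vs x \<in> {1}}" unfolding vs(2) by (auto simp: D_def)
    also have "\<dots> \<in> sets M" by measurable
    finally show ?thesis .
  qed
  show "M = N"
  proof (rule measure_eqI_generator_eq[of E "space M" M N "\<lambda>_. space M"])
    show "Int_stable E"
    proof (rule Int_stableI)
      fix X Y assume "X \<in> E" "Y \<in> E"
      then obtain vs ws where "set vs \<subseteq> I \<times> UNIV" "X = {x \<in> space M. \<forall>(v, a)\<in>set vs. Z v x > a}"
        "set ws \<subseteq> I \<times> UNIV" "Y = {x \<in> space M. \<forall>(v, a)\<in>set ws. Z v x > a}"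
        by (auto simp: E_def)
      then have "X \<inter> Y = {x \<in> space M. \<forall>(v, a)\<in>set (vs @ ws). Z v x > a}" "set (vs @ ws) \<subseteq> I \<times> UNIV"
        by auto
      then show "X \<inter> Y \<in> E" unfolding E_def by blast
    qed
    show E_pow: "E \<subseteq> Pow (space M)" by (auto simp: E_def)
    show "emeasure M X = emeasure N X" if X: "X \<in> E" for X
    proof -
      obtain vs where vs: "set vs \<subseteq> I \<times> UNIV" "X = {x \<in> space M. \<forall>(v, a)\<in>set vs. Z v x > a}"
        using X by (auto simp: E_def)
      \<comment> \<open>Scaling by 0 gives an index of the zero variable; its character is 1, which
        removes the free factor.\<close>
      obtain k where k: "k \<in> I" "\<And>x. x \<in> space M \<Longrightarrow> Z k x = 0" using I_ne I_scale[of _ 0] by fastforce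
      from main[OF vs(1) k(1)] have "integral\<^sup>L M (D vs) = integral\<^sup>L N (D vs)"
        using Bochner_Integration.integral_cong[OF refl, of M "\<lambda>x. iexp (Z k x) * D vs x" "D vs"]
          Bochner_Integration.integral_cong[OF refl, of N "\<lambda>x. iexp (Z k x) * D vs x" "D vs"]
        by (simp add: k(2) space)
      moreover have "integral\<^sup>L M (D vs) = (\<integral>x. complex_of_real (indicator X x) \<partial>M)"
        by (intro Bochner_Integration.integral_cong) (auto simp: D_def vs(2) indicator_def)
      moreover have "integral\<^sup>L N (D vs) = (\<integral>x. complex_of_real (indicator X x) \<partial>N)"
        using space
        by (intro Bochner_Integration.integral_cong) (auto simp: D_def vs(2) indicator_def)
      ultimately have "complex_of_real (measure M X) = of_real (measure N X)"
        using E_sets[OF X] E_sets[OF X, unfolded sets] 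
        by (simp add: integral_complex_of_real)
      then show ?thesis by (simp add: M.emeasure_eq_measure N.emeasure_eq_measure)
    qed
    show M_sig: "sets M = sigma_sets (space M) E"
    proof
      show "sigma_sets (space M) E \<subseteq> sets M"
        using E_sets by (intro sets.sigma_sets_subset) auto
      have "{x \<in> space M. Z v x \<in> B} \<in> sigma_sets (space M) E" if "v \<in> I" "B \<in> sets borel" for v B
      proof -
        have "Z v \<in> borel_measurable (sigma (space M) E)"
        proof (rule borel_measurable_iff_greater[THEN iffD2], rule)
          fix a
          have "{w \<in> space M. a < Z v w} = {w \<in> space M. \<forall>(v, a)\<in>set [(v, a)]. Z v w > a}" by simp
          then have "{w \<in> space M. a < Z v w} \<in> E" unfolding E_def using \<open>v \<in> I\<close>
            by (intro CollectI exI[of _ "[(v, a)]"]) auto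
          then show "{w \<in> space (sigma (space M) E). a < Z v w} \<in> sets (sigma (space M) E)"
            using E_pow by (simp add: space_measure_of)
        qed
        from measurable_sets[OF this that(2)] show ?thesis
          using E_pow by (simp add: space_measure_of vimage_def Int_def conj_commute)
      qed
      then have "{{x \<in> space M. Z v x \<in> B} | v B. v \<in> I \<and> B \<in> sets borel} \<subseteq> sigma_sets (space M) E"
        by blast
      from sigma_sets_mono[OF this] gen show "sets M \<subseteq> sigma_sets (space M) E" by blast
    qed
    then show "sets N = sigma_sets (space M) E" using sets by simp
    show "range (\<lambda>_. space M) \<subseteq> E"
      unfolding E_def by (auto intro!: exI[of _ "[]"])
  qed auto
qed

section \<open>The Mittag-Leffler law\<close>

definition one_minus_X_powr :: "real \<Rightarrow> real fps" where
  "one_minus_X_powr b = Abs_fps (\<lambda>n. pochhammer (- b) n / fact n)"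

lemma one_minus_X_powr_nth: "one_minus_X_powr b $ n = pochhammer (- b) n / fact n"
  by (simp add: one_minus_X_powr_def)

text \<open>The Chu-Vandermonde identity for rising factorials is exactly the Cauchy product of the
  two coefficient sequences.\<close>

lemma one_minus_X_powr_add: "one_minus_X_powr (a + b) = one_minus_X_powr a * one_minus_X_powr b"
proof (rule fps_ext)
  fix n
  have "pochhammer (- a + - b) n / fact n =
      (\<Sum>k\<le>n. real (n choose k) * pochhammer (- a) k * pochhammer (- b) (n - k) / fact n)"
    by (simp only: pochhammer_binomial_sum sum_divide_distrib)
  also have "\<dots> = (\<Sum>k\<le>n. (pochhammer (- a) k / fact k) * (pochhammer (- b) (n - k) / fact (n - k)))"
    by (intro sum.cong) (auto simp: binomial_fact)
  finally show "one_minus_X_powr (a + b) $ n = (one_minus_X_powr a * one_minus_X_powr b) $ n"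
    by (simp add: one_minus_X_powr_nth fps_mult_nth atLeast0AtMost)
qed

lemma one_minus_X_powr_0: "one_minus_X_powr 0 = 1"
  by (rule fps_ext) (auto simp: one_minus_X_powr_nth pochhammer_0_left)

lemma one_minus_X_powr_1: "one_minus_X_powr 1 = 1 - fps_X"
proof (rule fps_ext)
  fix n show "one_minus_X_powr 1 $ n = (1 - fps_X) $ n"
  proof (cases "n \<le> 1")
    case True
    then have "n = 0 \<or> n = 1" by auto
    then show ?thesis by (auto simp: one_minus_X_powr_nth)
  next
    case False
    have "pochhammer (- 1 :: real) n = 0"
      using False pochhammer_of_nat_eq_0_lemma[of 1 n, where 'a=real] by simp
    then show ?thesis using False by (simp add: one_minus_X_powr_nth)
  qed
qed

lemma one_minus_X_powr_power: "one_minus_X_powr b ^ k = one_minus_X_powr (of_nat k * b)"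
proof (induction k)
  case (Suc k)
  have "of_nat (Suc k) * b = b + of_nat k * b" by (simp add: algebra_simps)
  then show ?case using Suc by (simp add: one_minus_X_powr_add)
qed (simp add: one_minus_X_powr_0)

text \<open>Since \<open>f\<close> has no constant term, \<open>f ^ k\<close> contributes nothing
  below degree k. The composite is therefore a finite sum up to degree n, which can be moved through
  the product with \<open>h\<close>.\<close>

lemma fps_compose_times_nth:
  fixes a f h :: "'a::idom fps"
  assumes f: "f $ 0 = 0"
  shows "((a oo f) * h) $ n = (\<Sum>k\<le>n. a $ k * (f ^ k * h) $ n)"
proof -
  have "(a oo f) $ m = (\<Sum>k\<le>n. a $ k * (f ^ k) $ m)" if "m \<le> n" for m
    unfolding fps_compose_nth
    by (rule sum.mono_neutral_left)
      (use that startsby_zero_power_prefix[OF f] in auto)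
  then have "((a oo f) * h) $ n = (\<Sum>m\<le>n. (\<Sum>k\<le>n. a $ k * (f ^ k) $ m) * h $ (n - m))"
    by (simp add: fps_mult_nth atLeast0AtMost)
  also have "\<dots> = (\<Sum>k\<le>n. \<Sum>m\<le>n. a $ k * ((f ^ k) $ m * h $ (n - m)))"
    by (subst sum.swap) (simp add: sum_distrib_right mult.assoc)
  finally show ?thesis
    by (simp add: fps_mult_nth atLeast0AtMost sum_distrib_left)
qed

text \<open>The number of renewals up to time \<open>n\<close> of a random walk whose steps have the generating function
  \<open>1 - (1 - X)\<^sup>\<alpha>\<close> (the Sibuya law).\<close>

definition sibuya :: "real \<Rightarrow> real fps" where
  "sibuya \<alpha> = 1 - one_minus_X_powr \<alpha>"

text \<open>The probability of exactly k renewals up to time n. The power of the step generating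
  function f generates the law of the k-th renewal epoch; the factor (1 - X)^(alpha - 1) = (1 - f) /
  (1 - X) generates the probabilities that the following step is longer than the remaining
  time.\<close>

definition renewal_prob :: "real \<Rightarrow> nat \<Rightarrow> nat \<Rightarrow> real" where
  "renewal_prob \<alpha> n k = (sibuya \<alpha> ^ k * one_minus_X_powr (\<alpha> - 1)) $ n"

lemma sibuya_nonneg:
  assumes "0 < \<alpha>" "\<alpha> < 1"
  shows "sibuya \<alpha> $ n \<ge> 0"
proof (cases n)
  case 0
  then show ?thesis by (simp add: sibuya_def one_minus_X_powr_nth)
next
  case (Suc k)
  have "pochhammer (- \<alpha>) (Suc k) = - \<alpha> * pochhammer (1 - \<alpha>) k"
    by (simp add: pochhammer_rec)
  moreover have "pochhammer (1 - \<alpha>) k > 0"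
    using assms by (intro pochhammer_pos) auto
  ultimately show ?thesis using assms Suc
    by (simp add: sibuya_def one_minus_X_powr_nth divide_nonpos_pos mult_nonneg_nonneg)
qed

lemma renewal_prob_nonneg:
  assumes "0 < \<alpha>" "\<alpha> < 1"
  shows "renewal_prob \<alpha> n k \<ge> 0"
proof -
  have *: "(f * g) $ n \<ge> 0" if "\<And>n. f $ n \<ge> 0" "\<And>n. g $ n \<ge> 0" for f g :: "real fps" and n
    using that by (auto simp: fps_mult_nth intro!: sum_nonneg)
  have "(sibuya \<alpha> ^ k) $ n \<ge> 0" for n
    by (induction k arbitrary: n) (auto intro!: * sibuya_nonneg assms)
  moreover have "one_minus_X_powr (\<alpha> - 1) $ n \<ge> 0" for n
    using assms by (cases n) (auto simp: one_minus_X_powr_nth intro!: divide_nonneg_pos less_imp_le[OF pochhammer_pos])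
  ultimately show ?thesis unfolding renewal_prob_def by (rule *)
qed

text \<open>The factors (k + j)! / (k! j!) are the coefficients of (1 - y)^(-(j + 1)). Putting y = f
  with 1 - f = (1 - X)^alpha and multiplying by (1 - X)^(alpha - 1) leaves (1 - X)^(-(alpha j + 1)),
  whose n-th coefficient is the right-hand side.\<close>

lemma renewal_prob_sum:
  "(\<Sum>k\<le>n. fact (k + j) / (fact k * fact j) * renewal_prob \<alpha> n k) = pochhammer (\<alpha> * real j + 1) n / fact n"
proof -
  let ?g = "one_minus_X_powr (- real (Suc j))" and ?f = "sibuya \<alpha>"
  have f0: "?f $ 0 = 0" by (simp add: sibuya_def one_minus_X_powr_nth)
  have "(1 - fps_X) oo ?f = one_minus_X_powr \<alpha>"
    by (simp add: fps_compose_sub_distrib f0) (simp add: sibuya_def)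
  then have "(one_minus_X_powr 1 ^ Suc j) oo ?f = one_minus_X_powr \<alpha> ^ Suc j"
    by (simp add: one_minus_X_powr_1 fps_compose_power[OF f0, symmetric] del: power_Suc)
  then have "one_minus_X_powr (real (Suc j)) oo ?f = one_minus_X_powr (real (Suc j) * \<alpha>)"
    by (simp add: one_minus_X_powr_power del: power_Suc of_nat_Suc)
  \<comment> \<open>Composition is explicit for the polynomial 1 - X and its powers; the composite
    of the negative power is then identified as the multiplicative inverse.\<close>
  moreover have "(?g oo ?f) * (one_minus_X_powr (real (Suc j)) oo ?f) = 1"
    by (subst fps_compose_mult_distrib[OF f0, symmetric])
      (simp add: one_minus_X_powr_add[symmetric] one_minus_X_powr_0 del: of_nat_Suc)
  ultimately have "(?g oo ?f) * one_minus_X_powr (real (Suc j) * \<alpha>) * one_minus_X_powr (- (real (Suc j) * \<alpha>)) =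
      one_minus_X_powr (- (real (Suc j) * \<alpha>))" by simp
  then have "?g oo ?f = one_minus_X_powr (- (real (Suc j) * \<alpha>))"
    by (simp add: mult.assoc one_minus_X_powr_add[symmetric] one_minus_X_powr_0 del: of_nat_Suc)
  then have "(?g oo ?f) * one_minus_X_powr (\<alpha> - 1) = one_minus_X_powr (- (\<alpha> * real j + 1))"
    by (simp add: one_minus_X_powr_add[symmetric] algebra_simps)
  then have "pochhammer (\<alpha> * real j + 1) n / fact n = ((?g oo ?f) * one_minus_X_powr (\<alpha> - 1)) $ n"
    by (simp only: one_minus_X_powr_nth minus_minus)
  also have "\<dots> = (\<Sum>k\<le>n. ?g $ k * renewal_prob \<alpha> n k)"
    unfolding fps_compose_times_nth[OF f0] renewal_prob_def ..
  also have "\<dots> = (\<Sum>k\<le>n. fact (k + j) / (fact k * fact j) * renewal_prob \<alpha> n k)"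
  proof (rule sum.cong[OF refl], rule arg_cong2[where f="(*)"])
    fix k
    have "pochhammer (real (Suc j)) k * fact j = fact (k + j)"
    proof (induction k)
      case (Suc k)
      have "pochhammer (real (Suc j)) (Suc k) * fact j = (pochhammer (real (Suc j)) k * fact j) * real (Suc j + k)"
        by (simp add: pochhammer_Suc)
      also have "\<dots> = fact (Suc k + j)" unfolding Suc.IH by (simp add: algebra_simps)
      finally show ?case .
    qed simp
    then have "pochhammer (real (Suc j)) k = fact (k + j) / fact j"
      by (simp add: eq_divide_eq)
    then show "?g $ k = fact (k + j) / (fact k * fact j)"
      by (simp add: one_minus_X_powr_nth mult.commute del: of_nat_Suc)
  qed simp
  finally show ?thesis by simp
qed

text \<open>The law of a sum of k + 1 independent standard exponential variables divided by n^alpha,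
  with k the random renewal count. Compared with the count itself, its j-th moment given k is the
  rising factorial (k + j)! / k! up to scaling, which \<open>renewal_prob_sum\<close> evaluates in
  closed form.\<close>

definition renewal_measure :: "real \<Rightarrow> nat \<Rightarrow> real measure" where
  "renewal_measure \<alpha> n = density lborel
     (\<lambda>x. ennreal (\<Sum>k\<le>n. renewal_prob \<alpha> n k * erlang_density k (real n powr \<alpha>) x))"

lemma renewal_measure_moment:
  assumes \<alpha>: "0 < \<alpha>" "\<alpha> < 1" and n: "n > 0"
  shows "(\<integral>\<^sup>+x. ennreal (\<bar>x\<bar> ^ j) \<partial>renewal_measure \<alpha> n) =
    ennreal (fact j * pochhammer (\<alpha> * real j + 1) n / (fact n * (real n powr \<alpha>) ^ j))"
proof -
  define l where "l = real n powr \<alpha>"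
  have l: "l > 0" using n by (simp add: l_def)
  note nn = renewal_prob_nonneg[OF \<alpha>]
  have "(\<integral>\<^sup>+x. ennreal (\<bar>x\<bar> ^ j) \<partial>renewal_measure \<alpha> n) =
    (\<integral>\<^sup>+x. ennreal (\<Sum>k\<le>n. renewal_prob \<alpha> n k * erlang_density k l x) * ennreal (\<bar>x\<bar> ^ j) \<partial>lborel)"
    unfolding renewal_measure_def l_def[symmetric] by (subst nn_integral_density) auto
  also have "\<dots> = (\<integral>\<^sup>+x. (\<Sum>k\<le>n. ennreal (renewal_prob \<alpha> n k) * ennreal (erlang_density k l x * x ^ j)) \<partial>lborel)"
  proof (rule nn_integral_cong)
    fix x :: real
    have "ennreal (\<Sum>k\<le>n. renewal_prob \<alpha> n k * erlang_density k l x) * ennreal (\<bar>x\<bar> ^ j) =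
      ennreal (\<Sum>k\<le>n. renewal_prob \<alpha> n k * (erlang_density k l x * \<bar>x\<bar> ^ j))"
      using nn l by (subst ennreal_mult[symmetric]) (auto simp: sum_distrib_right mult.assoc intro!: sum_nonneg mult_nonneg_nonneg)
    also have "\<dots> = (\<Sum>k\<le>n. ennreal (renewal_prob \<alpha> n k * (erlang_density k l x * \<bar>x\<bar> ^ j)))"
      using nn l by (subst sum_ennreal) auto
    also have "\<dots> = (\<Sum>k\<le>n. ennreal (renewal_prob \<alpha> n k) * ennreal (erlang_density k l x * \<bar>x\<bar> ^ j))"
      using nn l by (intro sum.cong) (auto simp: ennreal_mult)
    \<comment> \<open>The density vanishes on the negative half-line, so the absolute value may be
      dropped.\<close>
    also have "\<dots> = (\<Sum>k\<le>n. ennreal (renewal_prob \<alpha> n k) * ennreal (erlang_density k l x * x ^ j))"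
      by (intro sum.cong) (auto simp: erlang_density_def)
    finally show "ennreal (\<Sum>k\<le>n. renewal_prob \<alpha> n k * erlang_density k l x) * ennreal (\<bar>x\<bar> ^ j) =
      (\<Sum>k\<le>n. ennreal (renewal_prob \<alpha> n k) * ennreal (erlang_density k l x * x ^ j))" .
  qed
  also have "\<dots> = (\<Sum>k\<le>n. ennreal (renewal_prob \<alpha> n k) * ennreal (fact (k + j) / (fact k * l ^ j)))"
    using l by (simp add: nn_integral_sum nn_integral_cmult nn_integral_erlang_ith_moment)
  also have "\<dots> = ennreal (\<Sum>k\<le>n. renewal_prob \<alpha> n k * (fact (k + j) / (fact k * l ^ j)))"
    using nn l by (simp add: ennreal_mult[symmetric] sum_ennreal)
  also have "(\<Sum>k\<le>n. renewal_prob \<alpha> n k * (fact (k + j) / (fact k * l ^ j))) =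
    (fact j / l ^ j) * (\<Sum>k\<le>n. fact (k + j) / (fact k * fact j) * renewal_prob \<alpha> n k)"
    using l by (auto simp: sum_distrib_left field_simps intro!: sum.cong)
  also have "\<dots> = fact j * pochhammer (\<alpha> * real j + 1) n / (fact n * l ^ j)"
    unfolding renewal_prob_sum by simp
  finally show ?thesis by (simp add: l_def)
qed

text \<open>Euler's limit for 1/Gamma at z = alpha j, after splitting off the first factor z of the
  rising factorial. At j = 0 that factor vanishes, hence the separate case.\<close>

lemma renewal_moment_limit:
  assumes \<alpha>: "0 < \<alpha>"
  shows "(\<lambda>n. fact j * pochhammer (\<alpha> * real j + 1) n / (fact n * (real n powr \<alpha>) ^ j))
    \<longlonglongrightarrow> fact j / Gamma (\<alpha> * real j + 1)"
proof (cases "j = 0")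
  case True
  have "(\<lambda>n. fact j * pochhammer (\<alpha> * real j + 1) n / (fact n * (real n powr \<alpha>) ^ j)) = (\<lambda>n. 1)"
    using True by (simp add: pochhammer_fact[symmetric])
  then show ?thesis using True by simp
next
  case False
  define z where "z = \<alpha> * real j"
  have z: "z > 0" using False \<alpha> by (simp add: z_def)
  have "(\<lambda>n. fact j / z * rGamma_series z n) \<longlonglongrightarrow> fact j / z * rGamma z"
    by (intro tendsto_intros)
  also have "fact j / z * rGamma z = fact j / Gamma (z + 1)"
    using z Gamma_plus1[of z] by (auto simp: nonpos_Ints_def rGamma_inverse_Gamma divide_simps)
  finally have "(\<lambda>n. fact j / z * rGamma_series z n) \<longlonglongrightarrow> fact j / Gamma (z + 1)" .
  moreover have "\<forall>\<^sub>F n in sequentially. fact j / z * rGamma_series z n =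
     fact j * pochhammer (z + 1) n / (fact n * (real n powr \<alpha>) ^ j)"
    using eventually_gt_at_top[of 0]
  proof eventually_elim
    case (elim n)
    have "exp (z * ln (real n)) = (real n powr \<alpha>) ^ j"
      using elim by (simp add: powr_def z_def exp_of_nat_mult[symmetric] algebra_simps)
    then show ?case using z by (simp add: rGamma_series_def pochhammer_rec)
  qed
  ultimately show ?thesis unfolding z_def by (rule Lim_transform_eventually)
qed

text \<open>First moments give tightness by Markov's inequality, Helly's theorem a weak limit along
  a subsequence, and the moments of order 2j the uniform integrability under which the j-th moments
  pass to the limit.\<close>

lemma distribution_with_limit_moments:
  fixes \<mu> :: "nat \<Rightarrow> real measure" and m :: "nat \<Rightarrow> real"
  assumes dist: "\<And>n. real_distribution (\<mu> n)"
    and int: "\<And>n j. integrable (\<mu> n) (\<lambda>x. \<bar>x\<bar> ^ j)"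
    and lim: "\<And>j. (\<lambda>n. \<integral>x. \<bar>x\<bar> ^ j \<partial>\<mu> n) \<longlonglongrightarrow> m j"
  obtains \<nu> where "real_distribution \<nu>" "\<And>j. integrable \<nu> (\<lambda>x. \<bar>x\<bar> ^ j)" "\<And>j. (\<integral>x. \<bar>x\<bar> ^ j \<partial>\<nu>) = m j"
proof -
  interpret \<mu>: real_distribution "\<mu> n" for n by (rule dist)
  have "\<exists>C. \<forall>n. (\<integral>x. \<bar>x\<bar> ^ j \<partial>\<mu> n) \<le> C" for j
  proof -
    have "Bseq (\<lambda>n. \<integral>x. \<bar>x\<bar> ^ j \<partial>\<mu> n)" by (rule convergent_imp_Bseq[OF convergentI[OF lim]])
    then obtain K where K: "\<forall>n. norm (\<integral>x. \<bar>x\<bar> ^ j \<partial>\<mu> n) \<le> K" unfolding Bseq_def by metis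
    show ?thesis by (intro exI[of _ K] allI order_trans[OF abs_ge_self K[unfolded real_norm_def, rule_format]])
  qed
  then obtain C where C: "\<And>j n. (\<integral>x. \<bar>x\<bar> ^ j \<partial>\<mu> n) \<le> C j" by metis
  have C0: "C j \<ge> 0" for j
  proof -
    have "0 \<le> (\<integral>x. \<bar>x\<bar> ^ j \<partial>\<mu> 0)" by (rule Bochner_Integration.integral_nonneg) simp
    also have "\<dots> \<le> C j" by (rule C)
    finally show ?thesis .
  qed
  have tight: "tight \<mu>"
    unfolding tight_def
  proof (intro conjI allI impI dist)
    fix e :: real assume e: "e > 0"
    \<comment> \<open>Markov bounds the mass outside by C 1 / b; the summand 1 keeps b positive and
      makes this bound strictly smaller than e.\<close>
    define b where "b = (C 1 + 1) / e"
    have b: "b > 0" "C 1 / b < e" using e C0[of 1] by (auto simp: b_def field_simps)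
    have "measure (\<mu> n) {- b<..b} > 1 - e" for n
    proof -
      have "measure (\<mu> n) {x \<in> space (\<mu> n). b \<le> \<bar>x\<bar>} \<le> (\<integral>x. \<bar>x\<bar> \<partial>\<mu> n) / b"
        using int[of n 1] b(1) by (intro integral_Markov_inequality_measure[where A="{}"]) auto
      also have "\<dots> \<le> C 1 / b" using C[of n 1] b(1) by (intro divide_right_mono) auto
      finally have "measure (\<mu> n) {x \<in> space (\<mu> n). b \<le> \<bar>x\<bar>} < e" using b by simp
      moreover have "measure (\<mu> n) (space (\<mu> n)) \<le> measure (\<mu> n) ({- b<..b} \<union> {x \<in> space (\<mu> n). b \<le> \<bar>x\<bar>})"
        by (intro \<mu>.finite_measure_mono) auto
      moreover have "\<dots> \<le> measure (\<mu> n) {- b<..b} + measure (\<mu> n) {x \<in> space (\<mu> n). b \<le> \<bar>x\<bar>}"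
        by (intro measure_Un_le) auto
      ultimately show ?thesis using \<mu>.prob_space[of n] by linarith
    qed
    then show "\<exists>a b. a < b \<and> (\<forall>n. 1 - e < measure (\<mu> n) {a<..b})"
      using b by (intro exI[of _ "- b"] exI[of _ b]) auto
  qed
  obtain r \<nu> where r: "strict_mono (r :: nat \<Rightarrow> nat)" and \<nu>: "real_distribution \<nu>"
    and conv: "weak_conv_m (\<mu> \<circ> id \<circ> r) \<nu>"
    using tight_imp_convergent_subsubsequence[OF tight strict_mono_id] by blast
  interpret \<nu>: real_distribution \<nu> by (rule \<nu>)
  define h where "h j A x = min (\<bar>x\<bar> ^ j) A" for j and A x :: real
  have h_cont: "isCont (h j A) x" for j A x
    unfolding h_def by (intro continuous_intros)
  have h_meas[measurable]: "h j A \<in> borel_measurable borel" for j A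
    unfolding h_def by measurable
  have h_bd: "norm (h j A x) \<le> A" if "A \<ge> 0" for j A x
    using that by (auto simp: h_def min_def)
  have h_conv: "(\<lambda>n. \<integral>x. h j A x \<partial>\<mu> (r n)) \<longlonglongrightarrow> (\<integral>x. h j A x \<partial>\<nu>)" if "A \<ge> 0" for j A
    using weak_conv_imp_integral_bdd_continuous_conv[OF _ _ conv h_cont h_bd[OF that]] dist \<nu>
    by (simp add: o_def)
  have h_int: "integrable (\<mu> n) (h j A)" "integrable \<nu> (h j A)" if "A \<ge> 0" for n j A
    using h_bd[OF that, of j] by (auto intro!: \<mu>.integrable_const_bound[where B=A] \<nu>.integrable_const_bound[where B=A])
  have m_r: "(\<lambda>n. \<integral>x. \<bar>x\<bar> ^ j \<partial>\<mu> (r n)) \<longlonglongrightarrow> m j" for j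
    using LIMSEQ_subseq_LIMSEQ[OF lim r] by (simp add: o_def)
  have upper: "(\<integral>x. h j A x \<partial>\<nu>) \<le> m j" if "A \<ge> 0" for j A
    by (rule LIMSEQ_le[OF h_conv[OF that] m_r])
      (auto intro!: exI[of _ 0] integral_mono h_int int that, simp add: h_def)
  \<comment> \<open>Where |x|^j exceeds the truncation level A, it is at most |x|^(2j) / A. This
    controls what the truncation removes, uniformly in n.\<close>
  have lower: "m j \<le> (\<integral>x. h j A x \<partial>\<nu>) + C (2 * j) / A" if "A > 0" for j A
  proof (rule LIMSEQ_le[OF m_r tendsto_add[OF h_conv tendsto_const]])
    show "\<exists>N. \<forall>n\<ge>N. (\<integral>x. \<bar>x\<bar> ^ j \<partial>\<mu> (r n)) \<le> (\<integral>x. h j A x \<partial>\<mu> (r n)) + C (2 * j) / A"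
    proof (intro exI allI impI)
      fix n
      have "\<bar>x\<bar> ^ j \<le> h j A x + \<bar>x\<bar> ^ (2 * j) / A" for x
      proof (cases "\<bar>x\<bar> ^ j \<le> A")
        case False
        then have "\<bar>x\<bar> ^ j * A \<le> \<bar>x\<bar> ^ j * \<bar>x\<bar> ^ j" by (intro mult_left_mono) auto
        then have "\<bar>x\<bar> ^ j \<le> \<bar>x\<bar> ^ (2 * j) / A"
          using that by (simp add: pos_le_divide_eq mult_2 power_add)
        then show ?thesis using that by (auto simp: h_def min_def)
      qed (use that in \<open>auto simp: h_def\<close>)
      then have "(\<integral>x. \<bar>x\<bar> ^ j \<partial>\<mu> (r n)) \<le> (\<integral>x. h j A x + \<bar>x\<bar> ^ (2 * j) / A \<partial>\<mu> (r n))"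
        using that by (intro integral_mono Bochner_Integration.integrable_add int h_int integrable_divide) auto
      also have "\<dots> = (\<integral>x. h j A x \<partial>\<mu> (r n)) + (\<integral>x. \<bar>x\<bar> ^ (2 * j) \<partial>\<mu> (r n)) / A"
        using that by (subst Bochner_Integration.integral_add) (auto intro: int h_int)
      also have "\<dots> \<le> (\<integral>x. h j A x \<partial>\<mu> (r n)) + C (2 * j) / A"
        using that by (intro add_left_mono divide_right_mono C) auto
      finally show "(\<integral>x. \<bar>x\<bar> ^ j \<partial>\<mu> (r n)) \<le> (\<integral>x. h j A x \<partial>\<mu> (r n)) + C (2 * j) / A" .
    qed
  qed (use that in auto)
  have h_lim: "(\<lambda>i. \<integral>x. h j (real (Suc i)) x \<partial>\<nu>) \<longlonglongrightarrow> m j" for j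
  proof (rule tendsto_sandwich[of "\<lambda>i. m j - C (2 * j) / real (Suc i)" _ _ "\<lambda>i. m j"])
    have "(\<lambda>i. m j - C (2 * j) * (1 / real (Suc i))) \<longlonglongrightarrow> m j - C (2 * j) * 0"
      by (intro tendsto_intros LIMSEQ_Suc[OF lim_1_over_n])
    then show "(\<lambda>i. m j - C (2 * j) / real (Suc i)) \<longlonglongrightarrow> m j" by simp
  next
    show "\<forall>\<^sub>F i in sequentially. m j - C (2 * j) / real (Suc i) \<le> (\<integral>x. h j (real (Suc i)) x \<partial>\<nu>)"
      using lower by (intro always_eventually allI) (simp add: algebra_simps del: of_nat_Suc)
    show "\<forall>\<^sub>F i in sequentially. (\<integral>x. h j (real (Suc i)) x \<partial>\<nu>) \<le> m j"
      using upper by (intro always_eventually allI) (simp del: of_nat_Suc)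
  qed simp
  have hb: "has_bochner_integral \<nu> (\<lambda>x. \<bar>x\<bar> ^ j) (m j)" for j
  proof (rule has_bochner_integral_monotone_convergence[of _ "\<lambda>i. h j (real (Suc i))"])
    show "AE x in \<nu>. mono (\<lambda>n. h j (real (Suc n)) x)"
      by (intro AE_I2 monoI) (auto simp: h_def)
    show "AE x in \<nu>. (\<lambda>i. h j (real (Suc i)) x) \<longlonglongrightarrow> \<bar>x\<bar> ^ j"
    proof (rule AE_I2, rule tendsto_eventually)
      fix x :: real
      have "\<forall>\<^sub>F i in sequentially. real i > \<bar>x\<bar> ^ j"
        by (rule filterlim_real_sequentially[unfolded filterlim_at_top_dense, rule_format])
      then show "\<forall>\<^sub>F i in sequentially. h j (real (Suc i)) x = \<bar>x\<bar> ^ j"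
        by eventually_elim (auto simp: h_def)
    qed
  qed (auto intro: h_lim h_int simp del: of_nat_Suc)
  show thesis
    by (rule that[OF \<nu>]) (use hb in \<open>auto simp: has_bochner_integral_iff\<close>)
qed

lemma mittag_leffler_distribution:
  assumes \<alpha>: "0 < \<alpha>" "\<alpha> < 1"
  obtains \<nu> where "real_distribution \<nu>" "AE \<tau> in \<nu>. 0 \<le> \<tau>"
    "\<And>j. integrable \<nu> (\<lambda>\<tau>. \<tau> ^ j)" "\<And>j. (\<integral>\<tau>. \<tau> ^ j \<partial>\<nu>) = fact j / Gamma (\<alpha> * real j + 1)"
proof -
  \<comment> \<open>The index starts at 1, because at n = 0 the rate n^alpha of the Gamma laws would
    be 0.\<close>
  define \<mu> where "\<mu> n = renewal_measure \<alpha> (Suc n)" for n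
  define c where "c j n = fact j * pochhammer (\<alpha> * real j + 1) n / (fact n * (real n powr \<alpha>) ^ j)" for j n
  have sets: "sets (\<mu> n) = sets borel" for n by (simp add: \<mu>_def renewal_measure_def)
  have mom: "(\<integral>\<^sup>+x. ennreal (\<bar>x\<bar> ^ j) \<partial>\<mu> n) = ennreal (c j (Suc n))" for n j
    unfolding \<mu>_def c_def by (rule renewal_measure_moment[OF \<alpha>]) simp
  have c0: "c j n \<ge> 0" for j n
    unfolding c_def using \<alpha> by (intro divide_nonneg_nonneg mult_nonneg_nonneg pochhammer_nonneg add_nonneg_pos) auto
  have hb: "has_bochner_integral (\<mu> n) (\<lambda>x. \<bar>x\<bar> ^ j) (c j (Suc n))" for n j
    using mom c0 by (intro has_bochner_integral_nn_integral) (auto simp: measurable_cong_sets[OF sets refl])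
  have "emeasure (\<mu> n) (space (\<mu> n)) = ennreal (c 0 (Suc n))" for n
    using mom[of n 0] by simp
  moreover have "c 0 n = 1" for n by (simp add: c_def pochhammer_fact[symmetric])
  ultimately have "real_distribution (\<mu> n)" for n
    by (intro real_distribution.intro prob_spaceI real_distribution_axioms.intro)
      (auto simp: sets sets_eq_imp_space_eq[OF sets])
  moreover have "(\<lambda>n. c j (Suc n)) \<longlonglongrightarrow> fact j / Gamma (\<alpha> * real j + 1)" for j
    unfolding c_def by (rule LIMSEQ_Suc[OF renewal_moment_limit[OF \<alpha>(1)]])
  ultimately obtain \<nu>' where \<nu>': "real_distribution \<nu>'" "\<And>j. integrable \<nu>' (\<lambda>x. \<bar>x\<bar> ^ j)"
    "\<And>j. (\<integral>x. \<bar>x\<bar> ^ j \<partial>\<nu>') = fact j / Gamma (\<alpha> * real j + 1)"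
    using distribution_with_limit_moments[of \<mu> "\<lambda>j. fact j / Gamma (\<alpha> * real j + 1)"] hb
    by (auto simp: has_bochner_integral_iff)
  interpret \<nu>': real_distribution \<nu>' by fact
  \<comment> \<open>Only absolute moments of the limit are known so far. Its image under the
    absolute value lives on the half-line and has these as its moments.\<close>
  show thesis
  proof
    show "real_distribution (distr \<nu>' borel abs)"
      by (intro real_distribution.intro \<nu>'.prob_space_distr real_distribution_axioms.intro) auto
    show "AE \<tau> in distr \<nu>' borel abs. 0 \<le> \<tau>" by (subst AE_distr_iff) auto
    show "integrable (distr \<nu>' borel abs) (\<lambda>\<tau>. \<tau> ^ j)" for j
      by (subst integrable_distr_eq) (auto intro: \<nu>')
    show "(\<integral>\<tau>. \<tau> ^ j \<partial>distr \<nu>' borel abs) = fact j / Gamma (\<alpha> * real j + 1)" for j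
      by (subst integral_distr) (auto simp: \<nu>')
  qed
qed

section \<open>Growth of the Gamma function and the mixture representation of E_alpha\<close>

lemma Gamma_lower_bound:
  fixes x A :: real
  assumes x: "x \<ge> 0" and A: "A > 0"
  shows "A powr x * exp (- A) \<le> Gamma (x + 1)"
proof (rule has_integral_le)
  show "((\<lambda>t. t powr (x + 1 - 1) / exp t) has_integral Gamma (x + 1)) {0..}"
    using x by (intro Gamma_integral_real) auto
  \<comment> \<open>Of Euler's integral only the part over t >= A is kept, where t^x is at least
    A^x.\<close>
  have "((\<lambda>t. exp (- 1 * t)) has_integral exp (- 1 * A) / 1) {A..}"
    by (rule has_integral_exp_minus_to_infinity) simp
  then have "((\<lambda>t. A powr x * exp (- t)) has_integral A powr x * exp (- A)) {A..}"
    by (intro has_integral_mult_right) simp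
  then show "((\<lambda>t. if t \<in> {A..} then A powr x * exp (- t) else 0) has_integral A powr x * exp (- A)) {0..}"
    using A by (subst has_integral_restrict) auto
  show "(if t \<in> {A..} then A powr x * exp (- t) else 0) \<le> t powr (x + 1 - 1) / exp t" if "t \<in> {0..}" for t
    using A x that by (auto simp: exp_minus field_simps intro!: powr_mono2)
qed

lemma summable_mittag_leffler:
  assumes \<alpha>: "0 < \<alpha>" and r: "r \<ge> 0"
  shows "summable (\<lambda>j. r ^ j / Gamma (\<alpha> * real j + 1))"
proof -
  \<comment> \<open>Chosen so that A^(alpha j) = (2 (r + 1))^j, which beats r^j by a factor 2^j;
    using r + 1 keeps A positive when r = 0.\<close>
  define A where "A = (2 * (r + 1)) powr (1 / \<alpha>)"
  have A: "A > 0" "A powr \<alpha> = 2 * (r + 1)" using \<alpha> r by (auto simp: A_def powr_powr)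
  have "norm (r ^ j / Gamma (\<alpha> * real j + 1)) \<le> exp A * (1 / 2) ^ j" for j
  proof -
    have "A powr (\<alpha> * real j) = (2 * (r + 1)) ^ j"
      using A r by (simp add: powr_powr[symmetric] powr_realpow)
    then have *: "(2 * (r + 1)) ^ j * exp (- A) \<le> Gamma (\<alpha> * real j + 1)"
      using Gamma_lower_bound[of "\<alpha> * real j" A] \<alpha> A by simp
    have pos: "0 < (2 * (r + 1)) ^ j * exp (- A)" using r by simp
    have "norm (r ^ j / Gamma (\<alpha> * real j + 1)) = r ^ j / Gamma (\<alpha> * real j + 1)"
      unfolding real_norm_def
      by (rule abs_of_nonneg[OF divide_nonneg_pos[OF zero_le_power[OF r] less_le_trans[OF pos *]]])
    also have "\<dots> \<le> (r + 1) ^ j / ((2 * (r + 1)) ^ j * exp (- A))"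
      using r pos * by (intro frac_le power_mono) auto
    also have "\<dots> = exp A * (1 / 2) ^ j"
    proof -
      have aux: "R / (p * R * inverse E) = E * (1 / p)" if "R \<noteq> 0" for R p E :: real
        using that by (simp add: divide_simps)
      have R: "(r + 1) ^ j \<noteq> 0" using r by auto
      show ?thesis unfolding power_mult_distrib exp_minus power_divide power_one by (rule aux[OF R])
    qed
    finally show ?thesis .
  qed
  moreover have "summable (\<lambda>j. exp A * (1 / 2) ^ j)"
    by (intro summable_mult summable_geometric) simp
  ultimately show ?thesis by (rule summable_comparison_test'[rotated])
qed

locale mittag_leffler_mixing =
  fixes \<alpha> :: real and \<nu> :: "real measure"
  assumes \<alpha>: "0 < \<alpha>"
    and \<nu>: "real_distribution \<nu>"
    and \<nu>_nonneg: "AE \<tau> in \<nu>. 0 \<le> \<tau>"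
    and \<nu>_int: "\<And>j. integrable \<nu> (\<lambda>\<tau>. \<tau> ^ j)"
    and \<nu>_moment: "\<And>j. (\<integral>\<tau>. \<tau> ^ j \<partial>\<nu>) = fact j / Gamma (\<alpha> * real j + 1)"
begin

sublocale real_distribution \<nu> by (rule \<nu>)

lemma exp_int: "m \<ge> 0 \<Longrightarrow> integrable \<nu> (\<lambda>\<tau>. exp (- \<tau> * m) * \<tau> ^ j)"
proof (rule Bochner_Integration.integrable_bound[OF \<nu>_int[of j]])
  assume m: "m \<ge> 0"
  show "AE \<tau> in \<nu>. norm (exp (- \<tau> * m) * \<tau> ^ j) \<le> norm (\<tau> ^ j)"
    using \<nu>_nonneg by eventually_elim (use m in \<open>auto simp: norm_mult intro!: mult_left_le_one_le\<close>)
qed simp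

text \<open>A mixed Poisson probability without its factor m^n, since that factor is the total mass
  of the n-point measure which the weight multiplies.\<close>

definition weight :: "real \<Rightarrow> nat \<Rightarrow> real" where
  "weight m n = (\<integral>\<tau>. exp (- \<tau> * m) * \<tau> ^ n / fact n \<partial>\<nu>)"

lemma weight_nonneg: "weight m n \<ge> 0"
  unfolding weight_def using \<nu>_nonneg by (intro integral_nonneg_AE) (auto elim!: eventually_mono)

text \<open>The exponential series in \<tau> z is integrated termwise against \<nu> with the density
  exp(-\<tau> m) kept as a factor. Shifting by m at this stage yields the expansion of E_alpha about
  -m directly, with the weights as coefficients.\<close>

lemma weight_sums_aux:
  fixes z :: complex
  assumes m: "m \<ge> 0"
  shows "integrable \<nu> (\<lambda>\<tau>. exp (of_real \<tau> * (z - of_real m)))" (is ?int)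
    and "(\<lambda>n. of_real (weight m n) * z ^ n) sums (\<integral>\<tau>. exp (of_real \<tau> * (z - of_real m)) \<partial>\<nu>)" (is ?sums)
proof -
  define f where "f n \<tau> = of_real (exp (- \<tau> * m) * \<tau> ^ n / fact n) * z ^ n" for n \<tau>
  have f_int: "integrable \<nu> (f n)" for n
    unfolding f_def using exp_int[OF m, of n]
    by (intro integrable_mult_left integrable_of_real integrable_divide) auto
  have norm_f: "norm (f n \<tau>) = \<bar>exp (- \<tau> * m) * \<tau> ^ n / fact n\<bar> * norm z ^ n" for n \<tau>
    by (simp only: f_def norm_mult norm_of_real norm_power)
  have exp: "(\<lambda>n. f n \<tau>) sums exp (of_real \<tau> * (z - of_real m))" for \<tau>
  proof -
    have "(\<lambda>n. of_real (exp (- \<tau> * m)) * ((of_real \<tau> * z) ^ n /\<^sub>R fact n)) sums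
      (of_real (exp (- \<tau> * m)) * exp (of_real \<tau> * z))"
      by (intro sums_mult exp_converges)
    also have "(\<lambda>n. of_real (exp (- \<tau> * m)) * ((of_real \<tau> * z) ^ n /\<^sub>R fact n)) = (\<lambda>n. f n \<tau>)"
      by (auto simp: f_def scaleR_conv_of_real power_mult_distrib field_simps)
    also have "of_real (exp (- \<tau> * m)) * exp (of_real \<tau> * z) = exp (of_real \<tau> * (z - of_real m))"
      by (simp add: exp_of_real[symmetric] exp_add[symmetric] algebra_simps)
    finally show ?thesis .
  qed
  have 1: "AE \<tau> in \<nu>. summable (\<lambda>n. norm (f n \<tau>))"
  proof (rule AE_I2)
    fix \<tau>
    have "summable (\<lambda>n. exp (- \<tau> * m) * (norm (\<bar>\<tau>\<bar> * norm z) ^ n /\<^sub>R fact n))"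
      by (intro summable_mult) (use summable_norm_exp[of "\<bar>\<tau>\<bar> * norm z"] in \<open>simp add: abs_mult power_abs\<close>)
    then show "summable (\<lambda>n. norm (f n \<tau>))"
      unfolding norm_f by (simp add: abs_mult power_abs power_mult_distrib field_simps)
  qed
  \<comment> \<open>Dropping the factor exp(-\<tau> m) \<le> 1 leaves the moments of \<nu>, so the
    Mittag-Leffler series at |z| is itself the dominating series.\<close>
  have 2: "summable (\<lambda>n. \<integral>\<tau>. norm (f n \<tau>) \<partial>\<nu>)"
  proof (rule summable_comparison_test'[where N=0 and g="\<lambda>n. norm z ^ n / Gamma (\<alpha> * real n + 1)"])
    show "summable (\<lambda>n. norm z ^ n / Gamma (\<alpha> * real n + 1))"
      by (rule summable_mittag_leffler[OF \<alpha>]) simp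
    fix n
    have "norm (\<integral>\<tau>. norm (f n \<tau>) \<partial>\<nu>) = (\<integral>\<tau>. norm (f n \<tau>) \<partial>\<nu>)" by simp
    also have "\<dots> \<le> (\<integral>\<tau>. \<tau> ^ n * (norm z ^ n / fact n) \<partial>\<nu>)"
    proof (rule integral_mono_AE)
      show "AE \<tau> in \<nu>. norm (f n \<tau>) \<le> \<tau> ^ n * (norm z ^ n / fact n)"
        using \<nu>_nonneg
      proof eventually_elim
        case (elim \<tau>)
        then have "exp (- \<tau> * m) * \<tau> ^ n \<le> \<tau> ^ n" using m by (intro mult_left_le_one_le) auto
        then have "\<bar>exp (- \<tau> * m) * \<tau> ^ n / fact n\<bar> \<le> \<tau> ^ n / fact n"
          using elim by (auto simp: abs_mult intro!: divide_right_mono)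
        from mult_right_mono[OF this, of "norm z ^ n"] show ?case by (simp add: norm_f)
      qed
    qed (use f_int \<nu>_int in auto)
    also have "\<dots> = norm z ^ n / Gamma (\<alpha> * real n + 1)" by (simp add: \<nu>_moment)
    finally show "norm (\<integral>\<tau>. norm (f n \<tau>) \<partial>\<nu>) \<le> norm z ^ n / Gamma (\<alpha> * real n + 1)" .
  qed
  have eq: "(\<Sum>n. f n \<tau>) = exp (of_real \<tau> * (z - of_real m))" for \<tau> using exp by (rule sums_unique[symmetric])
  show ?int using integrable_suminf[OF f_int 1 2] unfolding eq .
  have "(\<integral>\<tau>. f n \<tau> \<partial>\<nu>) = of_real (weight m n) * z ^ n" for n
    unfolding f_def weight_def by (subst integral_mult_left_zero) (simp only: integral_complex_of_real)
  then show ?sums using sums_integral[OF f_int 1 2] unfolding eq by simp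
qed

lemma exp_integral_eq_mittag_leffler:
  "(\<integral>\<tau>. exp (of_real \<tau> * z) \<partial>\<nu>) = mittag_leffler \<alpha> z"
proof -
  have "(\<lambda>n. of_real (weight 0 n) * z ^ n) sums (\<integral>\<tau>. exp (of_real \<tau> * z) \<partial>\<nu>)"
    using weight_sums_aux(2)[of 0 z] by simp
  moreover have "of_real (weight 0 n) * z ^ n = z ^ n / Gamma (of_real (\<alpha> * real n + 1))" for n
    by (simp add: weight_def \<nu>_moment del: of_real_add of_real_mult add: Gamma_complex_of_real)
  ultimately show ?thesis unfolding mittag_leffler_def by (simp add: sums_iff)
qed

lemma weight_sums:
  "m \<ge> 0 \<Longrightarrow> (\<lambda>n. of_real (weight m n) * z ^ n) sums mittag_leffler \<alpha> (z - of_real m)"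
  using weight_sums_aux(2)[of m z] unfolding exp_integral_eq_mittag_leffler .

text \<open>E_alpha is entire and \<open>weight_sums\<close> is a power series for it about -m, so
  the weights are its Taylor coefficients there. This turns the integral formula, and with it
  nonnegativity, into a statement about derivatives.\<close>

lemma fractional_poisson_weight_eq:
  assumes m: "m \<ge> 0"
  shows "fractional_poisson_weight \<alpha> m n = of_real (weight m n)"
proof -
  let ?E = "mittag_leffler \<alpha>"
  have ball: "?E holomorphic_on ball 0 R" for R
    using weight_sums[of 0] by (intro power_series_holomorphic[where a="\<lambda>n. of_real (weight 0 n)"]) auto
  have "?E field_differentiable at z" for z
    by (rule holomorphic_on_imp_differentiable_at[OF ball[of "norm z + 1"]]) auto
  then have hol: "?E holomorphic_on UNIV"
    by (simp add: holomorphic_on_def)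
  define F where "F = Abs_fps (\<lambda>n. complex_of_real (weight m n))"
  have sums: "(\<lambda>n. F $ n * z ^ n) sums ?E (z - of_real m)" for z
    using weight_sums[OF m] by (simp add: F_def)
  have "conv_radius (fps_nth F) = \<infinity>"
    using sums by (intro conv_radius_inftyI'') (auto simp: sums_iff)
  then have "(\<lambda>z. ?E (1 * z + - of_real m)) has_fps_expansion F"
    using sums by (auto simp: has_fps_expansion_def fps_conv_radius_def eval_fps_def sums_iff)
  then have "F $ n = (deriv ^^ n) (\<lambda>z. ?E (1 * z + - of_real m)) 0 / fact n"
    by (rule fps_nth_fps_expansion)
  also have "(deriv ^^ n) (\<lambda>z. ?E (1 * z + - of_real m)) 0 = 1 ^ n * (deriv ^^ n) ?E (1 * 0 + - of_real m)"
    by (rule higher_deriv_compose_linear'[OF hol, of UNIV]) auto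
  finally show ?thesis by (simp add: fractional_poisson_weight_def F_def)
qed

end

section \<open>Borel structures on configuration spaces\<close>

text \<open>One description to which the Borel structures on all configurations, on those inside a
  set and on the n-point ones are reduced. Intersections of configurations with relatively compact
  sets are finite, so \<open>card\<close> is a true count here.\<close>

definition count_algebra :: "'a::topological_space set set \<Rightarrow> 'a set measure" where
  "count_algebra \<Omega> = sigma \<Omega> {{\<gamma> \<in> \<Omega>. card (\<gamma> \<inter> B) = k} | B k. B \<in> relatively_compact_borel}"

lemma space_count_algebra [simp]: "space (count_algebra \<Omega>) = \<Omega>"
  unfolding count_algebra_def by (subst space_measure_of) auto

lemma sets_count_algebra: "sets (count_algebra \<Omega>) =
    sigma_sets \<Omega> {{\<gamma> \<in> \<Omega>. card (\<gamma> \<inter> B) = k} | B k. B \<in> relatively_compact_borel}"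
  unfolding count_algebra_def by (subst sets_measure_of) auto

text \<open>This turns inclusions of sigma-algebras into measurability statements about
  counts.\<close>

lemma measurable_ident_imp_sets_subset:
  assumes "(\<lambda>x. x) \<in> M \<rightarrow>\<^sub>M N" "space M = space N"
  shows "sets N \<subseteq> sets M"
proof
  fix A assume "A \<in> sets N"
  with measurable_sets[OF assms(1) this] sets.sets_into_space[OF this] assms(2)
  show "A \<in> sets M" by (simp add: Int_absorb2)
qed

lemma measurable_into_count_algebra:
  assumes "f \<in> space M \<rightarrow> \<Omega>"
    and "\<And>B. B \<in> relatively_compact_borel \<Longrightarrow> (\<lambda>x. card (f x \<inter> B)) \<in> M \<rightarrow>\<^sub>M count_space UNIV"
  shows "f \<in> M \<rightarrow>\<^sub>M count_algebra \<Omega>"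
proof (rule measurable_sigma_sets[OF sets_count_algebra])
  show "f \<in> space M \<rightarrow> \<Omega>" by fact
  fix A assume "A \<in> {{\<gamma> \<in> \<Omega>. card (\<gamma> \<inter> B) = k} | B k. B \<in> relatively_compact_borel}"
  then obtain B k where B: "B \<in> relatively_compact_borel" "A = {\<gamma> \<in> \<Omega>. card (\<gamma> \<inter> B) = k}" by blast
  have "f -` A \<inter> space M = (\<lambda>x. card (f x \<inter> B)) -` {k} \<inter> space M"
    using assms(1) B(2) by auto
  also have "\<dots> \<in> sets M" by (rule measurable_sets[OF assms(2)[OF B(1)]]) simp
  finally show "f -` A \<inter> space M \<in> sets M" .
qed auto

lemma measurable_card_count_algebra:
  assumes "B \<in> relatively_compact_borel"
  shows "(\<lambda>\<gamma>. card (\<gamma> \<inter> B)) \<in> count_algebra \<Omega> \<rightarrow>\<^sub>M count_space UNIV"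
proof (rule measurable_count_space_eq2_countable[THEN iffD2], intro conjI ballI)
  fix k :: nat
  have "(\<lambda>\<gamma>. card (\<gamma> \<inter> B)) -` {k} \<inter> space (count_algebra \<Omega>) = {\<gamma> \<in> \<Omega>. card (\<gamma> \<inter> B) = k}" by auto
  also have "\<dots> \<in> sets (count_algebra \<Omega>)" unfolding sets_count_algebra using assms by blast
  finally show "(\<lambda>\<gamma>. card (\<gamma> \<inter> B)) -` {k} \<inter> space (count_algebra \<Omega>) \<in> sets (count_algebra \<Omega>)" .
qed auto

lemma finite_configuration_Int:
  assumes "\<gamma> \<in> configurations" "\<Lambda> \<in> relatively_compact_borel"
  shows "finite (\<gamma> \<inter> \<Lambda>)"
proof (rule finite_subset)
  show "\<gamma> \<inter> \<Lambda> \<subseteq> \<gamma> \<inter> closure \<Lambda>" using closure_subset by auto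
  show "finite (\<gamma> \<inter> closure \<Lambda>)" using assms by (auto simp: configurations_def relatively_compact_borel_def)
qed

lemma relatively_compact_borel_Int [intro]:
  fixes \<Lambda> :: "'a::t2_space set"
  assumes "\<Lambda> \<in> relatively_compact_borel" "B \<in> sets borel"
  shows "\<Lambda> \<inter> B \<in> relatively_compact_borel"
proof -
  have "closure (\<Lambda> \<inter> B) = closure \<Lambda> \<inter> closure (\<Lambda> \<inter> B)" using closure_mono[of "\<Lambda> \<inter> B" \<Lambda>] by auto
  moreover have "compact (closure \<Lambda> \<inter> closure (\<Lambda> \<inter> B))"
    using assms by (intro compact_Int_closed) (auto simp: relatively_compact_borel_def)
  ultimately show ?thesis using assms by (auto simp: relatively_compact_borel_def)
qed

lemma compact_relatively_compact_borel [intro]: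
  fixes K :: "'a::t2_space set"
  shows "compact K \<Longrightarrow> K \<in> relatively_compact_borel"
  by (simp add: relatively_compact_borel_def compact_imp_closed borel_closed)

text \<open>For an indicator the sum is a count; linearity, monotone limits and the splitting into
  positive and negative parts do the rest. The sums over \<gamma> \<inter> \<Lambda> are finite, so
  limits pass through them termwise.\<close>

lemma measurable_sum_count_algebra:
  fixes f :: "'a::t2_space \<Rightarrow> real"
  assumes \<Omega>: "\<Omega> \<subseteq> configurations" and \<Lambda>: "\<Lambda> \<in> relatively_compact_borel"
    and f: "f \<in> borel_measurable borel"
  shows "(\<lambda>\<gamma>. \<Sum>x\<in>\<gamma> \<inter> \<Lambda>. f x) \<in> borel_measurable (count_algebra \<Omega>)"
proof -
  have fin: "finite (\<gamma> \<inter> \<Lambda>)" if "\<gamma> \<in> \<Omega>" for \<gamma>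
    using finite_configuration_Int \<Omega> \<Lambda> that by auto
  have nonneg: "(\<lambda>\<gamma>. \<Sum>x\<in>\<gamma> \<inter> \<Lambda>. g x) \<in> borel_measurable (count_algebra \<Omega>)"
    if "g \<in> borel_measurable borel" "\<And>x. 0 \<le> g x" for g :: "'a \<Rightarrow> real"
    using that
  proof (induction rule: borel_measurable_induct_real)
    case (set A)
    then have "\<Lambda> \<inter> A \<in> relatively_compact_borel" using \<Lambda> by auto
    then have "(\<lambda>\<gamma>. real (card (\<gamma> \<inter> (\<Lambda> \<inter> A)))) \<in> borel_measurable (count_algebra \<Omega>)"
      by (intro measurable_compose[OF measurable_card_count_algebra]) auto
    also have "?this \<longleftrightarrow> ?case"
    proof (rule measurable_cong)
      fix \<gamma> assume "\<gamma> \<in> space (count_algebra \<Omega>)"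
      then have "(\<Sum>x\<in>\<gamma> \<inter> \<Lambda>. indicator A x) = card (\<gamma> \<inter> \<Lambda> \<inter> A)"
        using fin[of \<gamma>] by (intro sum_indicator_eq_card) simp
      then have "real (\<Sum>x\<in>\<gamma> \<inter> \<Lambda>. indicator A x) = real (card (\<gamma> \<inter> (\<Lambda> \<inter> A)))" by (simp add: Int_assoc)
      then show "real (card (\<gamma> \<inter> (\<Lambda> \<inter> A))) = (\<Sum>x\<in>\<gamma> \<inter> \<Lambda>. indicat_real A x)"
        by (simp add: indicator_def of_bool_def if_distrib cong: if_cong)
    qed
    finally show ?case .
  next
    case (mult u c)
    then show ?case by (simp add: sum_distrib_left[symmetric])
  next
    case (add u v)
    then show ?case by (simp add: sum.distrib)
  next
    case (seq U)
    show ?case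
    proof (rule borel_measurable_LIMSEQ_real)
      show "(\<lambda>i. \<Sum>x\<in>\<gamma> \<inter> \<Lambda>. U i x) \<longlonglongrightarrow> (\<Sum>x\<in>\<gamma> \<inter> \<Lambda>. g x)" for \<gamma>
        using seq by (intro tendsto_sum) auto
    qed (rule seq)
  qed
  have "(\<lambda>\<gamma>. (\<Sum>x\<in>\<gamma> \<inter> \<Lambda>. max 0 (f x)) - (\<Sum>x\<in>\<gamma> \<inter> \<Lambda>. max 0 (- f x))) \<in> borel_measurable (count_algebra \<Omega>)"
    using f by (intro borel_measurable_diff nonneg) auto
  also have "(\<lambda>\<gamma>. (\<Sum>x\<in>\<gamma> \<inter> \<Lambda>. max 0 (f x)) - (\<Sum>x\<in>\<gamma> \<inter> \<Lambda>. max 0 (- f x))) = (\<lambda>\<gamma>. \<Sum>x\<in>\<gamma> \<inter> \<Lambda>. f x)"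
    by (auto simp: sum_subtractf[symmetric] max_def intro!: sum.cong)
  finally show ?thesis .
qed

lemma measurable_restrict_count_algebra:
  fixes \<Omega> :: "'a::t2_space set set"
  assumes "\<Lambda> \<in> relatively_compact_borel" "\<And>\<gamma>. \<gamma> \<in> \<Omega> \<Longrightarrow> \<gamma> \<inter> \<Lambda> \<in> \<Omega>'"
  shows "restrict_configuration \<Lambda> \<in> count_algebra \<Omega> \<rightarrow>\<^sub>M count_algebra \<Omega>'"
proof (rule measurable_into_count_algebra)
  fix B :: "'a set" assume "B \<in> relatively_compact_borel"
  then have "\<Lambda> \<inter> B \<in> relatively_compact_borel"
    by (intro relatively_compact_borel_Int assms(1)) (auto simp: relatively_compact_borel_def)
  from measurable_card_count_algebra[OF this]
  show "(\<lambda>\<gamma>. card (restrict_configuration \<Lambda> \<gamma> \<inter> B)) \<in> count_algebra \<Omega> \<rightarrow>\<^sub>M count_space UNIV"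
    by (simp add: restrict_configuration_def Int_assoc)
qed (auto simp: restrict_configuration_def assms)

lemma pairing_eq_sum:
  assumes "finite F" "F \<subseteq> \<gamma>" "\<And>x. x \<in> \<gamma> - F \<Longrightarrow> f x = 0"
  shows "pairing \<gamma> f = (\<Sum>x\<in>F. f x)"
proof -
  have "infsum f \<gamma> = infsum f F" by (rule infsum_cong_neutral) (use assms in auto)
  then show ?thesis using assms(1) by (simp add: pairing_def)
qed

lemma pairing_eq_sum_Int:
  fixes \<gamma> :: "'a::t2_space set"
  assumes "\<gamma> \<in> configurations" "\<Lambda> \<in> relatively_compact_borel" "\<And>x. x \<notin> \<Lambda> \<Longrightarrow> f x = 0"
  shows "pairing \<gamma> f = (\<Sum>x\<in>\<gamma> \<inter> \<Lambda>. f x)"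
  by (rule pairing_eq_sum[OF finite_configuration_Int[OF assms(1,2)]]) (use assms(3) in auto)

section \<open>Countable bases and measurability of counts\<close>

lemma finite_disjoint_open_neighbourhoods:
  fixes S :: "'a::t2_space set"
  assumes "finite S"
  obtains U where "\<And>x. x \<in> S \<Longrightarrow> open (U x)" "\<And>x. x \<in> S \<Longrightarrow> x \<in> U x"
    "\<And>x y. x \<in> S \<Longrightarrow> y \<in> S \<Longrightarrow> x \<noteq> y \<Longrightarrow> U x \<inter> U y = {}"
proof -
  have "\<forall>x y :: 'a. \<exists>V W. x \<noteq> y \<longrightarrow> open V \<and> open W \<and> x \<in> V \<and> y \<in> W \<and> V \<inter> W = {}"
  proof (intro allI)
    fix x y :: 'a
    show "\<exists>V W. x \<noteq> y \<longrightarrow> open V \<and> open W \<and> x \<in> V \<and> y \<in> W \<and> V \<inter> W = {}"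
      by (cases "x = y") (use hausdorff[of x y] in auto)
  qed
  then obtain V W where VW: "\<And>x y :: 'a. x \<noteq> y \<Longrightarrow>
      open (V x y) \<and> open (W x y) \<and> x \<in> V x y \<and> y \<in> W x y \<and> V x y \<inter> W x y = {}"
    by metis
  define U where "U x = (\<Inter>y\<in>S - {x}. V x y \<inter> W y x)" for x
  show thesis
  proof
    show "open (U x)" for x unfolding U_def using assms VW by (intro open_INT) auto
    show "x \<in> U x" for x
      unfolding U_def
    proof (intro INT_I IntI)
      fix y assume "y \<in> S - {x}"
      then show "x \<in> V x y" "x \<in> W y x" using VW[of x y] VW[of y x] by auto
    qed
    fix x y assume "x \<in> S" "y \<in> S" "x \<noteq> y"
    then have "U x \<subseteq> V x y" "U y \<subseteq> W x y" unfolding U_def by auto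
    moreover have "V x y \<inter> W x y = {}" using VW[OF \<open>x \<noteq> y\<close>] by simp
    ultimately show "U x \<inter> U y = {}" by blast
  qed
qed

text \<open>A countable family has only countably many finite subfamilies, so G is a countable union
  of finite intersections. Open sets become measurable in this way once neighbourhoods are described
  by countably many count conditions. The space is intersected in explicitly because the empty
  family has intersection \<open>UNIV\<close>.\<close>

lemma in_sets_if_locally_in_countable:
  assumes "countable \<S>" "\<S> \<subseteq> sets M" "G \<subseteq> space M"
    and loc: "\<And>x. x \<in> G \<Longrightarrow> \<exists>F. finite F \<and> F \<subseteq> \<S> \<and> x \<in> space M \<inter> \<Inter>F \<and> space M \<inter> \<Inter>F \<subseteq> G"
  shows "G \<in> sets M"
proof -
  let ?C = "{F. finite F \<and> F \<subseteq> \<S> \<and> space M \<inter> \<Inter>F \<subseteq> G}"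
  have "G = (\<Union>F\<in>?C. space M \<inter> \<Inter>F)"
  proof (intro equalityI subsetI)
    fix x assume "x \<in> G"
    then obtain F where "finite F" "F \<subseteq> \<S>" "x \<in> space M \<inter> \<Inter>F" "space M \<inter> \<Inter>F \<subseteq> G" using loc by metis
    then show "x \<in> (\<Union>F\<in>?C. space M \<inter> \<Inter>F)" by (intro UN_I[of F]) auto
  qed auto
  moreover have "(\<Union>F\<in>?C. space M \<inter> \<Inter>F) \<in> sets M"
  proof (rule sets.countable_UN')
    show "countable ?C"
      by (rule countable_subset[OF _ countable_Collect_finite_subset[OF assms(1)]]) auto
    have "space M \<inter> \<Inter>F \<in> sets M" if "finite F" "F \<subseteq> sets M" for F
      using that by (induction F) (auto simp: Int_left_commute)
    then show "(\<lambda>F. space M \<inter> \<Inter>F) ` ?C \<subseteq> sets M" using assms(2) by auto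
  qed
  ultimately show ?thesis by simp
qed

locale locally_compact_base =
  fixes b :: "nat \<Rightarrow> 'a::{t2_space, second_countable_topology} set"
  assumes b_open: "\<And>i. open (b i)" and b_compact: "\<And>i. compact (closure (b i))"
    and b_base: "\<And>U x. open U \<Longrightarrow> x \<in> U \<Longrightarrow> \<exists>i. x \<in> b i \<and> closure (b i) \<subseteq> U"

lemma Hausdorff_space_euclidean_t2: "Hausdorff_space (euclidean :: 'a::t2_space topology)"
  unfolding Hausdorff_space_def disjnt_def
proof clarsimp
  fix x y :: 'a assume "x \<noteq> y"
  then obtain U V where "open U \<and> open V \<and> x \<in> U \<and> y \<in> V \<and> U \<inter> V = {}" using hausdorff[OF \<open>x \<noteq> y\<close>] by metis
  then show "\<exists>U. open U \<and> (\<exists>V. open V \<and> x \<in> U \<and> y \<in> V \<and> U \<inter> V = {})" by blast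
qed

text \<open>Of any countable base, keep the members with compact closure. They still form a base:
  inside U there is a compact closed neighbourhood C, and a base set inside the interior part of C
  has its closure in C.\<close>

lemma ex_locally_compact_base:
  assumes "locally_compact_space (euclidean :: 'a::{t2_space, second_countable_topology} topology)"
  shows "\<exists>b :: nat \<Rightarrow> 'a set. locally_compact_base b"
proof -
  have "neighbourhood_base_of (\<lambda>C. compactin euclidean C \<and> closedin euclidean C) (euclidean :: 'a topology)"
    using assms locally_compact_Hausdorff_imp_regular_space[OF assms Hausdorff_space_euclidean_t2]
    by (subst locally_compact_regular_space_neighbourhood_base[symmetric]) auto
  then have nb: "\<exists>V C. open V \<and> compact C \<and> closed C \<and> x \<in> V \<and> V \<subseteq> C \<and> C \<subseteq> U" if "open U" "x \<in> U" for x :: 'a and U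
    using that unfolding neighbourhood_base_of by auto
  obtain \<B> :: "'a set set" where \<B>: "countable \<B>" "topological_basis \<B>"
    using ex_countable_basis by blast
  define \<C> where "\<C> = {B \<in> \<B>. compact (closure B)}"
  have base: "\<exists>B\<in>\<C>. x \<in> B \<and> closure B \<subseteq> U" if U: "open U" "x \<in> U" for x U
  proof -
    obtain V C where VC: "open V" "compact C" "closed C" "x \<in> V" "V \<subseteq> C" "C \<subseteq> U"
      using nb[OF U] by blast
    obtain B where B: "B \<in> \<B>" "x \<in> B" "B \<subseteq> V" using topological_basisE[OF \<B>(2) VC(1,4)] by blast
    have "closure B \<subseteq> C" using B VC by (intro closure_minimal) auto
    moreover from this have "compact (closure B)" using VC(2) by (metis closed_closure compact_Int_closed inf.absorb_iff2)
    ultimately show ?thesis using B VC unfolding \<C>_def by blast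
  qed
  have "\<C> \<noteq> {}" using base[of UNIV undefined] by auto
  moreover have "countable \<C>" using \<B>(1) unfolding \<C>_def by auto
  ultimately have r: "range (from_nat_into \<C>) = \<C>" by (rule range_from_nat_into)
  show ?thesis
  proof (rule exI[of _ "from_nat_into \<C>"], rule locally_compact_base.intro)
    fix i
    have "from_nat_into \<C> i \<in> \<C>" using r by blast
    then show "open (from_nat_into \<C> i)" "compact (closure (from_nat_into \<C> i))"
      unfolding \<C>_def using topological_basis_open[OF \<B>(2)] by auto
  next
    fix U and x :: 'a assume "open U" "x \<in> U"
    from base[OF this] show "\<exists>i. x \<in> from_nat_into \<C> i \<and> closure (from_nat_into \<C> i) \<subseteq> U"
      using r by (metis rangeE)
  qed
qed

context locally_compact_base
begin

lemma locally_compact: "locally_compact_space (euclidean :: 'a topology)"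
  unfolding locally_compact_space_def
proof
  fix x :: 'a
  obtain i where "x \<in> b i" using b_base[of UNIV x] by auto
  then show "\<exists>U K. openin euclidean U \<and> compactin euclidean K \<and> x \<in> U \<and> U \<subseteq> K"
    using b_open b_compact closure_subset by (intro exI[of _ "b i"] exI[of _ "closure (b i)"]) auto
qed

lemma b_rcb: "b i \<in> relatively_compact_borel"
  using b_open b_compact by (auto simp: relatively_compact_borel_def)

lemma compact_subset_union:
  assumes "compact K"
  obtains N where "K \<subseteq> (\<Union>i<N. b i)"
proof -
  have "K \<subseteq> \<Union>(range b)" using b_base[OF open_UNIV] by auto
  then obtain F where F: "F \<subseteq> range b" "finite F" "K \<subseteq> \<Union>F"
    using compactE[OF assms] b_open by (metis rangeE)
  obtain I where I: "finite I" "F = b ` I" using finite_subset_image[OF F(2), of b UNIV] F(1) by auto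
  obtain N where "I \<subseteq> {..<N}" using I(1) finite_nat_iff_bounded by blast
  then show thesis using that[of N] F(3) I(2) by blast
qed

lemma Urysohn_compact_open:
  assumes K: "compact K" and U: "open (U :: 'a set)" "K \<subseteq> U"
  obtains f :: "'a \<Rightarrow> real" where "continuous_on UNIV f" "\<And>x. x \<in> K \<Longrightarrow> f x = 1" "\<And>x. x \<notin> U \<Longrightarrow> f x = 0"
proof -
  have "completely_regular_space (euclidean :: 'a topology)"
    by (rule locally_compact_regular_imp_completely_regular_space[OF locally_compact])
      (simp add: Hausdorff_space_euclidean_t2)
  from Urysohn_completely_regular_compact_closed_alt[OF this, of K "- U" 0 1] K U
  obtain f :: "'a \<Rightarrow> real" where "continuous_map euclidean euclideanreal f" "f ` (- U) \<subseteq> {0}" "f ` K \<subseteq> {1}"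
    by (auto simp: disjnt_def closed_def)
  then show thesis by (intro that[of f]) auto
qed

text \<open>A Dynkin class argument from open to Borel sets, shared by the Borel structures on all
  configurations and on n-point configurations.\<close>

lemma measurable_card_if_open:
  fixes M :: "'a set measure"
  assumes M: "space M \<subseteq> configurations"
    and op: "\<And>U. open U \<Longrightarrow> compact (closure U) \<Longrightarrow> (\<lambda>\<gamma>. real (card (\<gamma> \<inter> U))) \<in> borel_measurable M"
    and B: "B \<in> relatively_compact_borel"
  shows "(\<lambda>\<gamma>. card (\<gamma> \<inter> B)) \<in> M \<rightarrow>\<^sub>M count_space UNIV"
proof -
  have B': "compact (closure B)" "B \<in> sets borel" using B by (auto simp: relatively_compact_borel_def)
  obtain N where N: "closure B \<subseteq> (\<Union>i<N. b i)" using compact_subset_union[OF B'(1)] .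
  \<comment> \<open>All sets are cut down to a relatively compact open set containing B, so that
    counts are finite and complements can be handled by subtraction.\<close>
  define O' where "O' = (\<Union>i<N. b i)"
  have O: "open O'" "compact (closure O')"
  proof -
    show "open O'" unfolding O'_def using b_open by auto
    have "closure O' \<subseteq> (\<Union>i<N. closure (b i))"
      unfolding O'_def using closure_subset by (intro closure_minimal) auto
    moreover have "compact (\<Union>i<N. closure (b i))" using b_compact by (intro compact_UN) auto
    ultimately show "compact (closure O')" by (metis closed_closure compact_Int_closed inf.absorb_iff2)
  qed
  then have O_rcb: "O' \<in> relatively_compact_borel" by (auto simp: relatively_compact_borel_def)
  have fin: "finite (\<gamma> \<inter> O')" if "\<gamma> \<in> space M" for \<gamma>
    using finite_configuration_Int[OF _ O_rcb] that M by auto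
  have "(\<lambda>\<gamma>. real (card (\<gamma> \<inter> (A \<inter> O')))) \<in> borel_measurable M" if A: "A \<in> sets borel" for A
  proof -
    have "Int_stable (Collect open :: 'a set set)" "Collect open \<subseteq> Pow (UNIV :: 'a set)"
      "A \<in> sigma_sets UNIV (Collect open)" using A by (auto simp: borel_def Int_stable_def)
    then show ?thesis
    proof (induction rule: sigma_sets_induct_disjoint)
    case (basic A)
    have "closure (A \<inter> O') = closure O' \<inter> closure (A \<inter> O')" using closure_mono[of "A \<inter> O'" O'] by auto
    then have "compact (closure (A \<inter> O'))" using O by (metis closed_closure compact_Int_closed)
    then show ?case using op[of "A \<inter> O'"] basic O by (auto intro: open_Int)
  next
    case (compl A)
    have "card (\<gamma> \<inter> ((UNIV - A) \<inter> O')) = card (\<gamma> \<inter> O') - card (\<gamma> \<inter> (A \<inter> O'))" and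
      "card (\<gamma> \<inter> (A \<inter> O')) \<le> card (\<gamma> \<inter> O')" if "\<gamma> \<in> space M" for \<gamma>
    proof -
      have "\<gamma> \<inter> ((UNIV - A) \<inter> O') = (\<gamma> \<inter> O') - (\<gamma> \<inter> (A \<inter> O'))" by auto
      then show "card (\<gamma> \<inter> ((UNIV - A) \<inter> O')) = card (\<gamma> \<inter> O') - card (\<gamma> \<inter> (A \<inter> O'))"
        by (simp only:) (rule card_Diff_subset, auto intro: finite_subset[OF _ fin[OF that]])
      show "card (\<gamma> \<inter> (A \<inter> O')) \<le> card (\<gamma> \<inter> O')" using fin[OF that] by (intro card_mono) auto
    qed
    then have "?case \<longleftrightarrow> (\<lambda>\<gamma>. real (card (\<gamma> \<inter> O')) - real (card (\<gamma> \<inter> (A \<inter> O')))) \<in> borel_measurable M"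
      by (intro measurable_cong) (simp add: of_nat_diff)
    then show ?case using compl op[OF O] by simp
  next
    case (union A)
    \<comment> \<open>The finitely many points involved lie in finitely many of the sets
      \<open>A i\<close>, so the partial sums are eventually constant.\<close>
    have "(\<lambda>n. \<Sum>i<n. real (card (\<gamma> \<inter> (A i \<inter> O')))) \<longlonglongrightarrow> real (card (\<gamma> \<inter> (\<Union>(range A) \<inter> O')))" if \<gamma>: "\<gamma> \<in> space M" for \<gamma>
    proof -
      have f: "finite (\<gamma> \<inter> (\<Union>(range A) \<inter> O'))" by (rule finite_subset[OF _ fin[OF \<gamma>]]) auto
      have "\<forall>x\<in>\<gamma> \<inter> (\<Union>(range A) \<inter> O'). \<exists>i. x \<in> A i" by auto
      then obtain i where i: "\<And>x. x \<in> \<gamma> \<inter> (\<Union>(range A) \<inter> O') \<Longrightarrow> x \<in> A (i x)" by metis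
      obtain N where N: "i ` (\<gamma> \<inter> (\<Union>(range A) \<inter> O')) \<subseteq> {..<N}"
        using finite_imageI[OF f] finite_nat_iff_bounded by metis
      have "(\<Sum>i<n. real (card (\<gamma> \<inter> (A i \<inter> O')))) = real (card (\<gamma> \<inter> (\<Union>(range A) \<inter> O')))" if "n \<ge> N" for n
      proof -
        have "\<gamma> \<inter> (\<Union>(range A) \<inter> O') = (\<Union>j<n. \<gamma> \<inter> (A j \<inter> O'))"
        proof (intro equalityI subsetI)
          fix x assume x: "x \<in> \<gamma> \<inter> (\<Union>(range A) \<inter> O')"
          then have "i x \<in> {..<n}" using N that by force
          then show "x \<in> (\<Union>j<n. \<gamma> \<inter> (A j \<inter> O'))" using i[OF x] x by blast
        qed auto
        also have "card \<dots> = (\<Sum>j<n. card (\<gamma> \<inter> (A j \<inter> O')))"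
          using union(1) fin[OF \<gamma>]
          by (intro card_UN_disjoint) (auto simp: disjoint_family_on_def intro: finite_subset)
        finally show ?thesis by simp
      qed
      then show ?thesis by (intro tendsto_eventually) (auto simp: eventually_sequentially)
    qed
    then show ?case
      by (rule borel_measurable_LIMSEQ_real) (use union in auto)
    qed simp
  qed
  from this[OF B'(2)] have *: "(\<lambda>\<gamma>. real (card (\<gamma> \<inter> B))) \<in> borel_measurable M"
    using N closure_subset[of B] by (metis O'_def inf.absorb1 subset_trans)
  show ?thesis
  proof (rule measurable_count_space_eq2_countable[THEN iffD2], intro conjI ballI)
    fix k :: nat
    have "(\<lambda>\<gamma>. real (card (\<gamma> \<inter> B))) -` {real k} \<inter> space M \<in> sets M"
      using * by (rule measurable_sets) simp
    then show "(\<lambda>\<gamma>. card (\<gamma> \<inter> B)) -` {k} \<inter> space M \<in> sets M"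
      by (simp add: vimage_def)
  qed auto
qed

text \<open>The countable family to which \<open>in_sets_if_locally_in_countable\<close> is applied,
  both on all configurations and on n-point configurations.\<close>

definition base_count_sets :: "'a set set \<Rightarrow> 'a set set set" where
  "base_count_sets \<Omega> = (\<lambda>(i, k). {\<gamma> \<in> \<Omega>. card (\<gamma> \<inter> b i) = k}) ` UNIV"

lemma base_count_sets: "countable (base_count_sets \<Omega>)" "base_count_sets \<Omega> \<subseteq> sets (count_algebra \<Omega>)"
  "{\<gamma> \<in> \<Omega>. card (\<gamma> \<inter> b i) = k} \<in> base_count_sets \<Omega>"
  unfolding base_count_sets_def sets_count_algebra using b_rcb by auto

lemma obtain_disjoint_base_sets:
  assumes "finite S" "\<And>x. x \<in> S \<Longrightarrow> open (W x)" "\<And>x. x \<in> S \<Longrightarrow> x \<in> W x"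
  obtains i where "\<And>x. x \<in> S \<Longrightarrow> x \<in> b (i x)" "\<And>x. x \<in> S \<Longrightarrow> b (i x) \<subseteq> W x"
    "\<And>x y. x \<in> S \<Longrightarrow> y \<in> S \<Longrightarrow> x \<noteq> y \<Longrightarrow> b (i x) \<inter> b (i y) = {}"
proof -
  obtain U where U: "\<And>x. x \<in> S \<Longrightarrow> open (U x)" "\<And>x. x \<in> S \<Longrightarrow> x \<in> U x"
    "\<And>x y. x \<in> S \<Longrightarrow> y \<in> S \<Longrightarrow> x \<noteq> y \<Longrightarrow> U x \<inter> U y = {}"
    using finite_disjoint_open_neighbourhoods[OF assms(1)] by blast
  have "\<exists>i. x \<in> b i \<and> b i \<subseteq> U x \<inter> W x" if x: "x \<in> S" for x
  proof -
    obtain i where "x \<in> b i \<and> closure (b i) \<subseteq> U x \<inter> W x"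
      using b_base[of "U x \<inter> W x" x] U(1,2)[OF x] assms(2,3)[OF x] by auto
    then show ?thesis using closure_subset[of "b i"] by (intro exI[of _ i]) auto
  qed
  then obtain i where i: "\<And>x. x \<in> S \<Longrightarrow> x \<in> b (i x) \<and> b (i x) \<subseteq> U x \<inter> W x" by metis
  show thesis
  proof (rule that[of i])
    fix x y assume xy: "x \<in> S" "y \<in> S" "x \<noteq> y"
    show "b (i x) \<inter> b (i y) = {}" using i[OF xy(1)] i[OF xy(2)] U(3)[OF xy] by auto
  qed (use i in auto)
qed

section \<open>The vague Borel sigma-algebra is generated by counts\<close>

lemma configuration_isolating_open:
  fixes z :: 'a
  assumes "\<gamma> \<in> configurations"
  obtains N where "open N" "z \<in> N" "\<gamma> \<inter> N \<subseteq> {z}"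
proof -
  obtain j where j: "z \<in> b j" using b_base[OF open_UNIV, of z] by auto
  have "finite (\<gamma> \<inter> b j - {z})" using finite_configuration_Int[OF assms b_rcb] by auto
  then have "closed (\<gamma> \<inter> b j - {z})" by (rule finite_imp_closed)
  then show thesis using j b_open[of j] by (intro that[of "b j - (\<gamma> \<inter> b j - {z})"] open_Diff) auto
qed

text \<open>Near \<gamma>, prescribe exactly one point in a small neighbourhood of each point of
  \<gamma> in the support of f, and none in finitely many base sets covering the rest of the
  support. A configuration with these counts differs from \<gamma> on the support by moving each
  point slightly, so its pairing with f is close.\<close>

lemma pairing_preimage_locally_count:
  assumes f: "continuous_on UNIV f" "compact (closure {x. f x \<noteq> 0})" and V: "open V"
    and \<gamma>: "\<gamma> \<in> configurations" "pairing \<gamma> f \<in> V"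
  shows "\<exists>F. finite F \<and> F \<subseteq> base_count_sets configurations \<and> \<gamma> \<in> configurations \<inter> \<Inter>F \<and>
    configurations \<inter> \<Inter>F \<subseteq> {\<gamma> \<in> configurations. pairing \<gamma> f \<in> V}"
proof -
  define K where "K = closure {x. f x \<noteq> 0}"
  have K: "compact K" "\<And>x. x \<notin> K \<Longrightarrow> f x = 0" using f(2) closure_subset[of "{x. f x \<noteq> 0}"] unfolding K_def by auto
  obtain e where e: "e > 0" "ball (pairing \<gamma> f) e \<subseteq> V" using openE[OF V \<gamma>(2)] by auto
  define S where "S = \<gamma> \<inter> K"
  have S: "finite S" unfolding S_def using \<gamma>(1) K(1) by (auto simp: configurations_def)
  \<comment> \<open>The tolerance per point; the summand 1 makes the total error strictly less than
    e and covers the case of no points.\<close>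
  define d where "d = e / (real (card S) + 1)"
  have d: "d > 0" unfolding d_def using e by (intro divide_pos_pos) auto
  have W_open: "open {y. dist (f y) (f x) < d}" for x
    using open_vimage[OF open_ball[of "f x" d] f(1)] by (simp add: vimage_def dist_commute)
  have "\<exists>N. open N \<and> x \<in> N \<and> \<gamma> \<inter> N \<subseteq> {x}" for x
    by (rule configuration_isolating_open[OF \<gamma>(1), of x]) blast
  then obtain N where N: "\<And>x. open (N x) \<and> x \<in> N x \<and> \<gamma> \<inter> N x \<subseteq> {x}" by metis
  define W where "W x = {y. dist (f y) (f x) < d} \<inter> N x" for x
  have W: "open (W x)" "x \<in> W x" for x using W_open N d unfolding W_def by auto
  have "\<exists>i. (\<forall>x\<in>S. x \<in> b (i x)) \<and> (\<forall>x\<in>S. b (i x) \<subseteq> W x) \<and>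
      (\<forall>x\<in>S. \<forall>y\<in>S. x \<noteq> y \<longrightarrow> b (i x) \<inter> b (i y) = {})"
    by (rule obtain_disjoint_base_sets[OF S W]) blast
  then obtain i where i: "\<And>x. x \<in> S \<Longrightarrow> x \<in> b (i x)" "\<And>x. x \<in> S \<Longrightarrow> b (i x) \<subseteq> W x"
      "\<And>x y. x \<in> S \<Longrightarrow> y \<in> S \<Longrightarrow> x \<noteq> y \<Longrightarrow> b (i x) \<inter> b (i y) = {}"
    by metis
  \<comment> \<open>The remaining part of the support is compact and free of \<gamma>, so finitely
    many base sets avoiding \<gamma> cover it.\<close>
  define C where "C = K - (\<Union>x\<in>S. b (i x))"
  have C: "compact C" unfolding C_def using K(1) b_open by (intro compact_diff) auto
  have "\<exists>j. z \<in> b j \<and> \<gamma> \<inter> b j = {}" if z: "z \<in> C" for z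
  proof -
    obtain j where j: "z \<in> b j \<and> closure (b j) \<subseteq> N z"
      using b_base[of "N z" z] N by blast
    have "z \<notin> \<gamma>" using z i(1) unfolding C_def S_def by blast
    then have "\<gamma> \<inter> b j = {}" using j N[of z] closure_subset[of "b j"] by blast
    then show ?thesis using j by blast
  qed
  then obtain J where J: "\<And>z. z \<in> C \<Longrightarrow> z \<in> b (J z)" "\<And>z. z \<in> C \<Longrightarrow> \<gamma> \<inter> b (J z) = {}" by metis
  obtain Z where Z: "Z \<subseteq> C" "finite Z" "C \<subseteq> (\<Union>z\<in>Z. b (J z))"
    using compactE_image[OF C, of C "\<lambda>z. b (J z)"] b_open J(1) by (metis UN_I subsetI)
  define F where "F = (\<lambda>x. {\<gamma> \<in> configurations. card (\<gamma> \<inter> b (i x)) = 1}) ` S \<union>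
    (\<lambda>z. {\<gamma> \<in> configurations. card (\<gamma> \<inter> b (J z)) = 0}) ` Z"
  have "\<gamma> \<inter> b (i x) = {x}" if "x \<in> S" for x
    using i(1,2)[OF that] N[of x] that unfolding W_def S_def by blast
  then have "\<gamma> \<in> configurations \<inter> \<Inter>F"
    unfolding F_def using \<gamma>(1) J(2) Z(1) by auto
  moreover have "finite F" "F \<subseteq> base_count_sets configurations"
    unfolding F_def using S Z(2) base_count_sets(3) by auto
  moreover have "pairing \<gamma>' f \<in> V" if \<gamma>': "\<gamma>' \<in> configurations" "\<gamma>' \<in> \<Inter>F" for \<gamma>'
  proof -
    have "card (\<gamma>' \<inter> b (i x)) = 1" if "x \<in> S" for x
    proof -
      have "{\<gamma> \<in> configurations. card (\<gamma> \<inter> b (i x)) = 1} \<in> F" unfolding F_def by (intro UnI1 imageI that)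
      from InterD[OF \<gamma>'(2) this] show ?thesis by simp
    qed
    then have "\<exists>y. \<gamma>' \<inter> b (i x) = {y}" if "x \<in> S" for x using that card_1_singletonE by metis
    then obtain y where y: "\<And>x. x \<in> S \<Longrightarrow> \<gamma>' \<inter> b (i x) = {y x}" by metis
    have card0: "card (\<gamma>' \<inter> b (J z)) = 0" if "z \<in> Z" for z
    proof -
      have "{\<gamma> \<in> configurations. card (\<gamma> \<inter> b (J z)) = 0} \<in> F" unfolding F_def by (intro UnI2 imageI that)
      from InterD[OF \<gamma>'(2) this] show ?thesis by simp
    qed
    \<comment> \<open>Since \<open>card\<close> is also 0 on infinite sets, emptiness needs that a
      configuration meets \<open>b (J z)\<close> in a finite set.\<close>
    have empty: "\<gamma>' \<inter> b (J z) = {}" if "z \<in> Z" for z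
      using card0[OF that] finite_configuration_Int[OF \<gamma>'(1) b_rcb] by (simp only: card_0_eq)
    have "inj_on y S"
    proof (rule inj_onI, rule ccontr)
      fix u v assume uv: "u \<in> S" "v \<in> S" "y u = y v" "u \<noteq> v"
      then show False using y[OF uv(1)] y[OF uv(2)] i(3)[OF uv(1,2,4)] by auto
    qed
    have "pairing \<gamma>' f = (\<Sum>p\<in>y ` S. f p)"
    proof (rule pairing_eq_sum)
      show "finite (y ` S)" using S by simp
      show "y ` S \<subseteq> \<gamma>'" using y by auto
      fix p assume p: "p \<in> \<gamma>' - y ` S"
      then have "p \<notin> b (i x)" if "x \<in> S" for x using y[OF that] that by auto
      moreover have "p \<notin> b (J z)" if "z \<in> Z" for z using empty[OF that] p by auto
      ultimately have "p \<notin> K" using Z(3) unfolding C_def by blast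
      then show "f p = 0" by (rule K(2))
    qed
    also have "\<dots> = (\<Sum>x\<in>S. f (y x))" using \<open>inj_on y S\<close> by (simp add: sum.reindex)
    finally have 1: "pairing \<gamma>' f = (\<Sum>x\<in>S. f (y x))" .
    have 2: "pairing \<gamma> f = (\<Sum>x\<in>S. f x)" unfolding S_def using K \<gamma>(1) by (intro pairing_eq_sum_Int) auto
    have "\<bar>pairing \<gamma> f - pairing \<gamma>' f\<bar> \<le> (\<Sum>x\<in>S. \<bar>f x - f (y x)\<bar>)"
      unfolding 1 2 sum_subtractf[symmetric] by (rule sum_abs)
    also have "\<dots> \<le> (\<Sum>x\<in>S. d)"
    proof (rule sum_mono)
      fix x assume x: "x \<in> S"
      have "y x \<in> W x" using y[OF x] i(2)[OF x] by blast
      then show "\<bar>f x - f (y x)\<bar> \<le> d" unfolding W_def by (auto simp: dist_real_def)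
    qed
    also have "\<dots> < e" using e by (simp add: d_def field_simps)
    finally have "pairing \<gamma>' f \<in> ball (pairing \<gamma> f) e" by (simp add: dist_real_def)
    then show ?thesis using e(2) by auto
  qed
  ultimately show ?thesis by (intro exI[of _ F]) auto
qed

text \<open>Vaguely open sets are locally described by countably many count conditions, which gives
  one inclusion. Conversely, the count of an open set is a limit of pairings with continuous
  functions increasing in support size, and \<open>measurable_card_if_open\<close> passes to Borel
  sets.\<close>

lemma sets_borel_configurations:
  "sets (borel_configurations :: 'a set measure) = sets (count_algebra configurations)"
proof -
  have top: "U \<subseteq> configurations" if "openin vague_topology U" for U :: "'a set set"
    using openin_subset[OF that] unfolding vague_topology_def topology_generated_by_topspace by auto
  have space: "space (borel_configurations :: 'a set measure) = configurations"
    unfolding borel_configurations_def using top by (subst space_measure_of) auto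
  have sets: "sets (borel_configurations :: 'a set measure) = sigma_sets configurations {U. openin vague_topology U}"
    unfolding borel_configurations_def using top by (subst sets_measure_of) auto
  show ?thesis
  proof
    \<comment> \<open>This local property is stable under finite intersections and arbitrary unions,
      so it follows the generation of the topology from its subbasis.\<close>
    let ?Q = "\<lambda>U. \<forall>\<gamma>\<in>U. \<exists>F. finite F \<and> F \<subseteq> base_count_sets configurations \<and> \<gamma> \<in> configurations \<inter> \<Inter>F \<and>
        configurations \<inter> \<Inter>F \<subseteq> U"
    have Q: "?Q U" if "openin vague_topology U" for U :: "'a set set"
      using that unfolding vague_topology_def openin_topology_generated_by_iff
    proof (induction rule: generate_topology_on.induct)
      case Empty
      then show ?case by simp
    next
      case (Int U V)
      show ?case
      proof
        fix \<gamma> assume "\<gamma> \<in> U \<inter> V"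
        then obtain F F' where "finite F" "F \<subseteq> base_count_sets configurations" "\<gamma> \<in> configurations \<inter> \<Inter>F"
          "configurations \<inter> \<Inter>F \<subseteq> U" "finite F'" "F' \<subseteq> base_count_sets configurations"
          "\<gamma> \<in> configurations \<inter> \<Inter>F'" "configurations \<inter> \<Inter>F' \<subseteq> V"
          using Int.IH by (metis IntE)
        then show "\<exists>F. finite F \<and> F \<subseteq> base_count_sets configurations \<and> \<gamma> \<in> configurations \<inter> \<Inter>F \<and>
            configurations \<inter> \<Inter>F \<subseteq> U \<inter> V"
          by (intro exI[of _ "F \<union> F'"]) auto
      qed
    next
      case (UN K)
      show ?case
      proof
        fix \<gamma> assume "\<gamma> \<in> \<Union>K"
        then obtain U where U: "U \<in> K" "\<gamma> \<in> U" by auto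
        from bspec[OF UN.IH[OF U(1)] U(2)] show "\<exists>F. finite F \<and> F \<subseteq> base_count_sets configurations \<and> \<gamma> \<in> configurations \<inter> \<Inter>F \<and>
            configurations \<inter> \<Inter>F \<subseteq> \<Union>K"
          using U(1) by (meson Union_upper order_trans)
      qed
    next
      case (Basis s)
      then obtain f V where fV: "s = {\<gamma> \<in> configurations. pairing \<gamma> f \<in> V}"
        "continuous_on UNIV f" "compact (closure {x. f x \<noteq> 0})" "open V" by blast
      show ?case unfolding fV(1)
        using pairing_preimage_locally_count[OF fV(2-4)] by blast
    qed
    have "U \<in> sets (count_algebra configurations)" if U: "openin vague_topology U" for U :: "'a set set"
    proof (rule in_sets_if_locally_in_countable[OF base_count_sets(1)[of configurations] base_count_sets(2)])
      show "U \<subseteq> space (count_algebra configurations)" using top[OF U] by simp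
    qed (use Q[OF U] in simp)
    then show "sets (borel_configurations :: 'a set measure) \<subseteq> sets (count_algebra configurations)"
      unfolding sets using sets.sigma_sets_subset[of "{U. openin vague_topology U}" "count_algebra configurations"]
      by auto
  next
    have card: "(\<lambda>\<gamma>. card (\<gamma> \<inter> B)) \<in> borel_configurations \<rightarrow>\<^sub>M count_space UNIV"
      if B: "B \<in> relatively_compact_borel" for B :: "'a set"
    proof (rule measurable_card_if_open[OF _ _ B])
      show "space (borel_configurations :: 'a set measure) \<subseteq> configurations" using space by simp
      fix U :: "'a set" assume U: "open U" "compact (closure U)"
      have U_rcb: "U \<in> relatively_compact_borel" using U by (auto simp: relatively_compact_borel_def)
      \<comment> \<open>Closures of base sets inside U exhaust U by compact sets \<open>K n\<close>;
        Urysohn functions that are 1 on \<open>K n\<close> and 0 off U converge pointwise to the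
        indicator of U.\<close>
      define I where "I = {i. closure (b i) \<subseteq> U}"
      define K where "K n = (\<Union>i\<in>I \<inter> {..<n}. closure (b i))" for n
      have K: "compact (K n)" "K n \<subseteq> U" for n
        unfolding K_def using b_compact by (auto simp: I_def intro!: compact_UN)
      have "\<exists>f :: 'a \<Rightarrow> real. continuous_on UNIV f \<and> (\<forall>x\<in>K n. f x = 1) \<and> (\<forall>x. x \<notin> U \<longrightarrow> f x = 0)" for n
        by (rule Urysohn_compact_open[OF K(1) U(1) K(2)]) blast
      then obtain f :: "nat \<Rightarrow> 'a \<Rightarrow> real" where f: "\<And>n. continuous_on UNIV (f n)"
        "\<And>n x. x \<in> K n \<Longrightarrow> f n x = 1" "\<And>n x. x \<notin> U \<Longrightarrow> f n x = 0" by metis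
      have meas: "(\<lambda>\<gamma>. pairing \<gamma> (f n)) \<in> borel_measurable borel_configurations" for n
      proof (rule borel_measurableI)
        fix V :: "real set" assume V: "open V"
        have "closure {x. f n x \<noteq> 0} = closure U \<inter> closure {x. f n x \<noteq> 0}"
          using f(3)[of _ n] closure_mono[of "{x. f n x \<noteq> 0}" U] by auto
        then have "compact (closure {x. f n x \<noteq> 0})" using U(2) by (metis closed_closure compact_Int_closed)
        then have "openin vague_topology {\<gamma> \<in> configurations. pairing \<gamma> (f n) \<in> V}"
          unfolding vague_topology_def using f(1) V by (intro topology_generated_by_Basis) blast
        moreover have "(\<lambda>\<gamma>. pairing \<gamma> (f n)) -` V \<inter> space borel_configurations = {\<gamma> \<in> configurations. pairing \<gamma> (f n) \<in> V}"
          unfolding space by auto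
        ultimately show "(\<lambda>\<gamma>. pairing \<gamma> (f n)) -` V \<inter> space borel_configurations \<in> sets borel_configurations"
          unfolding sets by auto
      qed
      show "(\<lambda>\<gamma>. real (card (\<gamma> \<inter> U))) \<in> borel_measurable borel_configurations"
      proof (rule borel_measurable_LIMSEQ_real[OF _ meas])
        fix \<gamma> :: "'a set" assume "\<gamma> \<in> space borel_configurations"
        then have \<gamma>: "\<gamma> \<in> configurations" using space by simp
        have "(\<lambda>n. \<Sum>x\<in>\<gamma> \<inter> U. f n x) \<longlonglongrightarrow> (\<Sum>x\<in>\<gamma> \<inter> U. 1)"
        proof (rule tendsto_sum)
          fix x assume "x \<in> \<gamma> \<inter> U"
          then obtain i where i: "x \<in> b i" "i \<in> I" using b_base[OF U(1)] unfolding I_def by blast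
          then have "x \<in> K n" if "n > i" for n
            unfolding K_def using that closure_subset[of "b i"] by blast
          then have "f n x = 1" if "n > i" for n using that f(2) by blast
          then show "(\<lambda>n. f n x) \<longlonglongrightarrow> 1"
            by (intro tendsto_eventually eventually_sequentiallyI[of "Suc i"]) auto
        qed
        moreover have "pairing \<gamma> (f n) = (\<Sum>x\<in>\<gamma> \<inter> U. f n x)" for n
          by (rule pairing_eq_sum_Int[OF \<gamma> U_rcb f(3)])
        ultimately show "(\<lambda>n. pairing \<gamma> (f n)) \<longlonglongrightarrow> real (card (\<gamma> \<inter> U))" by simp
      qed
    qed
    have "(\<lambda>\<gamma>. \<gamma>) \<in> borel_configurations \<rightarrow>\<^sub>M (count_algebra configurations :: 'a set measure)"
      by (rule measurable_into_count_algebra) (use space card in auto)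
    from measurable_ident_imp_sets_subset[OF this] space
    show "sets (count_algebra configurations) \<subseteq> sets (borel_configurations :: 'a set measure)"
      by simp
  qed
qed

lemma space_borel_configurations: "space (borel_configurations :: 'a set measure) = configurations"
  using sets_eq_imp_space_eq[OF sets_borel_configurations] by simp

section \<open>Configurations of n points as a quotient of distinct tuples\<close>

lemma n_configurations_in_iff:
  "\<gamma> \<in> n_configurations_in \<Lambda> n \<longleftrightarrow> \<gamma> \<in> configurations \<and> \<gamma> \<subseteq> \<Lambda> \<and> finite \<gamma> \<and> card \<gamma> = n"
  by (auto simp: n_configurations_in_def configurations_in_def)

lemma finite_imp_configuration: "finite \<gamma> \<Longrightarrow> \<gamma> \<in> configurations"
  by (auto simp: configurations_def)

lemma sym_map_in_n_configurations:
  "x \<in> distinct_tuples \<Lambda> n \<Longrightarrow> sym_map n x \<in> n_configurations_in \<Lambda> n"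
  by (auto simp: distinct_tuples_def sym_map_def n_configurations_in_iff card_image intro!: finite_imp_configuration)

lemma n_configuration_eq_sym_map:
  assumes "\<gamma> \<in> n_configurations_in \<Lambda> n"
  obtains x where "x \<in> distinct_tuples \<Lambda> n" "sym_map n x = \<gamma>"
proof -
  have "finite \<gamma>" "card \<gamma> = n" "\<gamma> \<subseteq> \<Lambda>" using assms by (auto simp: n_configurations_in_iff)
  then obtain h where h: "bij_betw h {0..<n} \<gamma>" using ex_bij_betw_nat_finite by metis
  then have "inj_on h {..<n}" "h ` {..<n} = \<gamma>" by (auto simp: bij_betw_def atLeast0LessThan)
  then have "restrict h {..<n} \<in> distinct_tuples \<Lambda> n" "sym_map n (restrict h {..<n}) = \<gamma>"
    using \<open>\<gamma> \<subseteq> \<Lambda>\<close> by (auto simp: distinct_tuples_def sym_map_def inj_on_def image_subset_iff)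
  then show thesis by (rule that)
qed

lemma borel_n_configurations_in_space_sets:
  "space (borel_n_configurations_in \<Lambda> n :: 'a set measure) = n_configurations_in \<Lambda> n"
  "sets (borel_n_configurations_in \<Lambda> n :: 'a set measure) =
    sigma_sets (n_configurations_in \<Lambda> n) {U. openin (n_configuration_topology \<Lambda> n) U}"
proof -
  have "{U. openin (n_configuration_topology \<Lambda> n) U} \<subseteq> Pow (n_configurations_in \<Lambda> n :: 'a set set)"
    by (auto simp: openin_n_configuration_topology)
  then show "space (borel_n_configurations_in \<Lambda> n :: 'a set measure) = n_configurations_in \<Lambda> n"
    "sets (borel_n_configurations_in \<Lambda> n :: 'a set measure) =
      sigma_sets (n_configurations_in \<Lambda> n) {U. openin (n_configuration_topology \<Lambda> n) U}"
    unfolding borel_n_configurations_in_def by (simp_all add: space_measure_of sets_measure_of)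
qed

text \<open>Lift \<gamma> to an ordering x and take an open box around x inside the open preimage of
  G. Shrinking the sides to disjoint base sets, the requirement of one point in each forces any
  other n-point configuration to have an ordering in the same box.\<close>

lemma n_configuration_open_locally_count:
  assumes G: "openin (n_configuration_topology \<Lambda> n) G" and \<gamma>: "\<gamma> \<in> (G :: 'a set set)"
  shows "\<exists>F. finite F \<and> F \<subseteq> base_count_sets (n_configurations_in \<Lambda> n) \<and>
    \<gamma> \<in> n_configurations_in \<Lambda> n \<inter> \<Inter>F \<and> n_configurations_in \<Lambda> n \<inter> \<Inter>F \<subseteq> G"
proof -
  let ?T = "product_topology (\<lambda>_. euclidean :: 'a topology) {..<n}"
  have G': "G \<subseteq> n_configurations_in \<Lambda> n"
    "openin (subtopology ?T (distinct_tuples \<Lambda> n)) {x \<in> distinct_tuples \<Lambda> n. sym_map n x \<in> G}"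
    using G unfolding openin_n_configuration_topology by auto
  obtain x where x: "x \<in> distinct_tuples \<Lambda> n" "sym_map n x = \<gamma>"
    using n_configuration_eq_sym_map \<gamma> G'(1) by blast
  obtain P where P: "openin ?T P" "{x \<in> distinct_tuples \<Lambda> n. sym_map n x \<in> G} = P \<inter> distinct_tuples \<Lambda> n"
    using G'(2) unfolding openin_subtopology by auto
  have "x \<in> P" using P(2) x \<gamma> by blast
  then obtain U where U: "\<forall>i\<in>{..<n}. openin euclidean (U i)" "x \<in> Pi\<^sub>E {..<n} U" "Pi\<^sub>E {..<n} U \<subseteq> P"
    using P(1) unfolding openin_product_topology_alt by blast
  have x_inj: "inj_on x {..<n}" using x(1) by (simp add: distinct_tuples_def)
  \<comment> \<open>The sides of the box are re-indexed by the points of \<gamma> instead of by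
    positions, which is possible because x is injective.\<close>
  define W where "W p = U (the_inv_into {..<n} x p)" for p
  have W: "W (x k) = U k" if "k < n" for k
    using the_inv_into_f_f[OF x_inj, of k] that by (simp add: W_def)
  have W': "open (W p)" "p \<in> W p" if "p \<in> x ` {..<n}" for p
    using that W U(1,2) by (auto simp: PiE_iff)
  have "\<exists>i. (\<forall>p\<in>x ` {..<n}. p \<in> b (i p)) \<and> (\<forall>p\<in>x ` {..<n}. b (i p) \<subseteq> W p) \<and>
      (\<forall>p\<in>x ` {..<n}. \<forall>q\<in>x ` {..<n}. p \<noteq> q \<longrightarrow> b (i p) \<inter> b (i q) = {})"
    by (rule obtain_disjoint_base_sets[of "x ` {..<n}" W]) (use W' in \<open>blast | simp\<close>)+
  then obtain i where i: "\<And>p. p \<in> x ` {..<n} \<Longrightarrow> p \<in> b (i p)" "\<And>p. p \<in> x ` {..<n} \<Longrightarrow> b (i p) \<subseteq> W p"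
      "\<And>p q. p \<in> x ` {..<n} \<Longrightarrow> q \<in> x ` {..<n} \<Longrightarrow> p \<noteq> q \<Longrightarrow> b (i p) \<inter> b (i q) = {}"
    by metis
  define F where "F = (\<lambda>p. {\<gamma> \<in> n_configurations_in \<Lambda> n. card (\<gamma> \<inter> b (i p)) = 1}) ` (x ` {..<n})"
  have \<gamma>_eq: "\<gamma> = x ` {..<n}" using x(2) by (simp add: sym_map_def)
  have "\<gamma> \<inter> b (i p) = {p}" if p: "p \<in> x ` {..<n}" for p
  proof (intro equalityI subsetI)
    fix q assume "q \<in> \<gamma> \<inter> b (i p)"
    then have q: "q \<in> x ` {..<n}" "q \<in> b (i p)" "q \<in> b (i q)" using \<gamma>_eq i(1) by auto
    show "q \<in> {p}" using i(3)[OF p q(1)] q by auto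
  qed (use p i(1) \<gamma>_eq in auto)
  then have "\<gamma> \<in> n_configurations_in \<Lambda> n \<inter> \<Inter>F"
    unfolding F_def using \<gamma> G'(1) by auto
  moreover have "finite F" "F \<subseteq> base_count_sets (n_configurations_in \<Lambda> n)"
    unfolding F_def using base_count_sets(3) by auto
  moreover have "\<gamma>' \<in> G" if \<gamma>': "\<gamma>' \<in> n_configurations_in \<Lambda> n" "\<gamma>' \<in> \<Inter>F" for \<gamma>'
  proof -
    have "card (\<gamma>' \<inter> b (i (x k))) = 1" if "k < n" for k
    proof -
      have "{\<gamma> \<in> n_configurations_in \<Lambda> n. card (\<gamma> \<inter> b (i (x k))) = 1} \<in> F"
        unfolding F_def using that by (intro imageI) auto
      from InterD[OF \<gamma>'(2) this] show ?thesis by simp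
    qed
    then have "\<exists>y. \<gamma>' \<inter> b (i (x k)) = {y}" if "k < n" for k using that card_1_singletonE by metis
    then obtain y where y: "\<And>k. k < n \<Longrightarrow> \<gamma>' \<inter> b (i (x k)) = {y k}" by metis
    have y_inj: "inj_on y {..<n}"
    proof (rule inj_onI, rule ccontr)
      fix u v assume uv: "u \<in> {..<n}" "v \<in> {..<n}" "y u = y v" "u \<noteq> v"
      then have "x u \<noteq> x v" using x_inj by (auto simp: inj_on_def)
      then have "b (i (x u)) \<inter> b (i (x v)) = {}" using uv by (intro i(3)) auto
      then show False using y[of u] y[of v] uv by auto
    qed
    define z where "z = restrict y {..<n}"
    have \<gamma>'': "finite \<gamma>'" "card \<gamma>' = n" "\<gamma>' \<subseteq> \<Lambda>" using \<gamma>'(1) by (auto simp: n_configurations_in_iff)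
    have sub: "y ` {..<n} \<subseteq> \<gamma>'" using y by auto
    \<comment> \<open>The n distinct points found in the n disjoint neighbourhoods exhaust
      \<gamma>', so y lists it completely.\<close>
    have eq: "y ` {..<n} = \<gamma>'"
      by (rule card_subset_eq[OF \<gamma>''(1) sub]) (simp add: card_image[OF y_inj] \<gamma>''(2))
    have "z \<in> distinct_tuples \<Lambda> n"
      using y_inj eq \<gamma>''(3) unfolding z_def distinct_tuples_def by (auto simp: inj_on_def)
    moreover have "z \<in> Pi\<^sub>E {..<n} U"
    proof (rule PiE_I)
      fix k assume "k \<in> {..<n}"
      then have "y k \<in> b (i (x k))" "b (i (x k)) \<subseteq> U k" using y[of k] i(2)[of "x k"] W[of k] by auto
      then show "z k \<in> U k" using \<open>k \<in> {..<n}\<close> unfolding z_def by auto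
    qed (auto simp: z_def)
    ultimately have "sym_map n z \<in> G" using P(2) U(3) by blast
    moreover have "sym_map n z = \<gamma>'" using eq unfolding z_def sym_map_def by simp
    ultimately show ?thesis by simp
  qed
  ultimately show ?thesis by (intro exI[of _ F]) auto
qed

text \<open>One inclusion is the local criterion. For the other, the event that more than a points
  lie in an open U lifts to the union, over the index sets I with more than a elements, of the open
  boxes asking the coordinates in I to lie in U.\<close>

lemma sets_borel_n_configurations_in:
  "sets (borel_n_configurations_in \<Lambda> n :: 'a set measure) = sets (count_algebra (n_configurations_in \<Lambda> n))"
proof
  let ?M = "borel_n_configurations_in \<Lambda> n :: 'a set measure"
  have "G \<in> sets (count_algebra (n_configurations_in \<Lambda> n))" if G: "openin (n_configuration_topology \<Lambda> n) G" for G :: "'a set set"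
  proof (rule in_sets_if_locally_in_countable[OF base_count_sets(1)[of "n_configurations_in \<Lambda> n"] base_count_sets(2)])
    show "G \<subseteq> space (count_algebra (n_configurations_in \<Lambda> n))" using G by (simp add: openin_n_configuration_topology)
  qed (use n_configuration_open_locally_count[OF G] in simp)
  then show "sets ?M \<subseteq> sets (count_algebra (n_configurations_in \<Lambda> n))"
    unfolding borel_n_configurations_in_space_sets
    using sets.sigma_sets_subset[of "{U. openin (n_configuration_topology \<Lambda> n) U}" "count_algebra (n_configurations_in \<Lambda> n)"]
    by auto
  have card: "(\<lambda>\<gamma>. card (\<gamma> \<inter> B)) \<in> ?M \<rightarrow>\<^sub>M count_space UNIV"
    if B: "B \<in> relatively_compact_borel" for B :: "'a set"
  proof (rule measurable_card_if_open[OF _ _ B])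
    show "space ?M \<subseteq> configurations"
      by (auto simp: borel_n_configurations_in_space_sets n_configurations_in_iff)
    fix U :: "'a set" assume U: "open U"
    show "(\<lambda>\<gamma>. real (card (\<gamma> \<inter> U))) \<in> borel_measurable ?M"
    proof (rule borel_measurable_iff_greater[THEN iffD2], rule)
      fix a :: real
      let ?G = "{\<gamma> \<in> n_configurations_in \<Lambda> n. a < real (card (\<gamma> \<inter> U))}"
      let ?T = "product_topology (\<lambda>_. euclidean :: 'a topology) {..<n}"
      let ?I = "{I. I \<subseteq> {..<n} \<and> a < real (card I)}"
      have box: "openin ?T (Pi\<^sub>E {..<n} (\<lambda>k. if k \<in> I then U else UNIV))" for I
        using U by (subst openin_PiE) auto
      have "{x \<in> distinct_tuples \<Lambda> n. sym_map n x \<in> ?G} =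
        (\<Union>I\<in>?I. Pi\<^sub>E {..<n} (\<lambda>k. if k \<in> I then U else UNIV)) \<inter> distinct_tuples \<Lambda> n"
      proof (intro equalityI subsetI)
        fix x assume "x \<in> {x \<in> distinct_tuples \<Lambda> n. sym_map n x \<in> ?G}"
        then have x: "x \<in> distinct_tuples \<Lambda> n" "a < real (card (x ` {..<n} \<inter> U))" by (auto simp: sym_map_def)
        define I where "I = {k \<in> {..<n}. x k \<in> U}"
        have "x ` {..<n} \<inter> U = x ` I" by (auto simp: I_def)
        moreover have "card (x ` I) \<le> card I" by (rule card_image_le) (simp add: I_def)
        ultimately have "I \<in> ?I" using x(2) by (auto simp: I_def)
        moreover have "x \<in> Pi\<^sub>E {..<n} (\<lambda>k. if k \<in> I then U else UNIV)"
          using x(1) by (auto simp: I_def distinct_tuples_def PiE_iff)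
        ultimately show "x \<in> (\<Union>I\<in>?I. Pi\<^sub>E {..<n} (\<lambda>k. if k \<in> I then U else UNIV)) \<inter> distinct_tuples \<Lambda> n"
          using x(1) by blast
      next
        fix x assume "x \<in> (\<Union>I\<in>?I. Pi\<^sub>E {..<n} (\<lambda>k. if k \<in> I then U else UNIV)) \<inter> distinct_tuples \<Lambda> n"
        then obtain I where I: "I \<subseteq> {..<n}" "a < real (card I)" "x \<in> Pi\<^sub>E {..<n} (\<lambda>k. if k \<in> I then U else UNIV)"
          and x: "x \<in> distinct_tuples \<Lambda> n" by blast
        have "x k \<in> U" if "k \<in> I" for k
          using PiE_mem[OF I(3), of k] that I(1) by auto
        then have "x ` I \<subseteq> x ` {..<n} \<inter> U" using I(1) by auto
        then have "card (x ` I) \<le> card (sym_map n x \<inter> U)" unfolding sym_map_def by (intro card_mono) auto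
        moreover have "card (x ` I) = card I"
          using x I(1) by (intro card_image) (auto simp: distinct_tuples_def intro: inj_on_subset)
        ultimately have "a < real (card (sym_map n x \<inter> U))" using I(2) by linarith
        then show "x \<in> {x \<in> distinct_tuples \<Lambda> n. sym_map n x \<in> ?G}" using x sym_map_in_n_configurations by auto
      qed
      moreover have "openin ?T (\<Union>I\<in>?I. Pi\<^sub>E {..<n} (\<lambda>k. if k \<in> I then U else UNIV))"
        using box by (intro openin_Union) blast
      ultimately have "openin (n_configuration_topology \<Lambda> n) ?G"
        unfolding openin_n_configuration_topology openin_subtopology by blast
      then show "{\<gamma> \<in> space ?M. a < real (card (\<gamma> \<inter> U))} \<in> sets ?M"
        unfolding borel_n_configurations_in_space_sets by auto
    qed
  qed
  have "(\<lambda>\<gamma>. \<gamma>) \<in> ?M \<rightarrow>\<^sub>M count_algebra (n_configurations_in \<Lambda> n)"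
    by (rule measurable_into_count_algebra) (use card in \<open>auto simp: borel_n_configurations_in_space_sets\<close>)
  from measurable_ident_imp_sets_subset[OF this]
  show "sets (count_algebra (n_configurations_in \<Lambda> n)) \<subseteq> sets ?M"
    by (simp add: borel_n_configurations_in_space_sets(1))
qed

lemma configurations_in_finite:
  assumes "\<Lambda> \<in> relatively_compact_borel" "\<gamma> \<in> configurations_in \<Lambda>"
  shows "finite \<gamma>"
proof -
  have "\<gamma> \<in> configurations" "\<gamma> \<inter> \<Lambda> = \<gamma>" using assms(2) by (auto simp: configurations_in_def)
  then show ?thesis using finite_configuration_Int[OF _ assms(1), of \<gamma>] by simp
qed

lemma n_configurations_in_sets:
  assumes "\<Lambda> \<in> relatively_compact_borel"
  shows "n_configurations_in \<Lambda> n \<in> sets (count_algebra (configurations_in \<Lambda>))"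
proof -
  have "n_configurations_in \<Lambda> n = {\<gamma> \<in> configurations_in \<Lambda>. card (\<gamma> \<inter> \<Lambda>) = n}"
    using configurations_in_finite[OF assms]
    by (auto simp: n_configurations_in_def configurations_in_def Int_absorb2)
  then show ?thesis unfolding sets_count_algebra using assms by blast
qed

lemma sets_count_algebra_n_configurations:
  assumes "\<Lambda> \<in> relatively_compact_borel"
  shows "sets (count_algebra (n_configurations_in \<Lambda> n)) =
    sets (restrict_space (count_algebra (configurations_in \<Lambda>)) (n_configurations_in \<Lambda> n))"
proof
  have sub: "n_configurations_in \<Lambda> n \<subseteq> configurations_in \<Lambda>" by (auto simp: n_configurations_in_def)
  have [simp]: "space (restrict_space (count_algebra (configurations_in \<Lambda>)) (n_configurations_in \<Lambda> n)) = n_configurations_in \<Lambda> n"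
    using sub by (auto simp: space_restrict_space)
  have "(\<lambda>\<gamma>. \<gamma>) \<in> restrict_space (count_algebra (configurations_in \<Lambda>)) (n_configurations_in \<Lambda> n) \<rightarrow>\<^sub>M
      count_algebra (n_configurations_in \<Lambda> n)"
    by (intro measurable_into_count_algebra measurable_restrict_space1 measurable_card_count_algebra) auto
  from measurable_ident_imp_sets_subset[OF this]
  show "sets (count_algebra (n_configurations_in \<Lambda> n)) \<subseteq>
      sets (restrict_space (count_algebra (configurations_in \<Lambda>)) (n_configurations_in \<Lambda> n))"
    by simp
  have id: "(\<lambda>\<gamma>. \<gamma>) \<in> count_algebra (n_configurations_in \<Lambda> n) \<rightarrow>\<^sub>M count_algebra (configurations_in \<Lambda>)"
    using sub by (intro measurable_into_count_algebra measurable_card_count_algebra) auto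
  show "sets (restrict_space (count_algebra (configurations_in \<Lambda>)) (n_configurations_in \<Lambda> n)) \<subseteq>
      sets (count_algebra (n_configurations_in \<Lambda> n))"
    using measurable_sets[OF id] by (auto simp: sets_restrict_space Int_commute)
qed

text \<open>The generating family already contains the count algebra, whose traces on every layer
  are Borel. Each of its members is in turn a countable union of its traces on the layers, all of
  which are count measurable.\<close>

lemma sets_borel_configurations_in:
  assumes \<Lambda>: "(\<Lambda> :: 'a set) \<in> relatively_compact_borel"
  shows "sets (borel_configurations_in \<Lambda>) = sets (count_algebra (configurations_in \<Lambda>))"
proof -
  let ?C = "{B. B \<subseteq> configurations_in \<Lambda> \<and>
     (\<forall>n. B \<inter> n_configurations_in \<Lambda> n \<in> sets (borel_n_configurations_in \<Lambda> n))}"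
  have sets: "sets (borel_configurations_in \<Lambda>) = sigma_sets (configurations_in \<Lambda>) ?C"
    unfolding borel_configurations_in_def by (subst sets_measure_of) auto
  have *: "sets (borel_n_configurations_in \<Lambda> n) =
      sets (restrict_space (count_algebra (configurations_in \<Lambda>)) (n_configurations_in \<Lambda> n))" for n
    unfolding sets_borel_n_configurations_in sets_count_algebra_n_configurations[OF \<Lambda>] ..
  have "B \<in> sets (count_algebra (configurations_in \<Lambda>))" if B: "B \<in> ?C" for B
  proof -
    have "B = (\<Union>n. B \<inter> n_configurations_in \<Lambda> n)"
      using B configurations_in_finite[OF \<Lambda>] by (auto simp: n_configurations_in_def)
    also have "\<dots> \<in> sets (count_algebra (configurations_in \<Lambda>))"
    proof (intro sets.countable_UN image_subsetI)
      fix n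
      have "B \<inter> n_configurations_in \<Lambda> n \<in> sets (restrict_space (count_algebra (configurations_in \<Lambda>)) (n_configurations_in \<Lambda> n))"
        using B * by auto
      then show "B \<inter> n_configurations_in \<Lambda> n \<in> sets (count_algebra (configurations_in \<Lambda>))"
        using n_configurations_in_sets[OF \<Lambda>] by (auto simp: sets_restrict_space)
    qed
    finally show ?thesis .
  qed
  then have 1: "sigma_sets (configurations_in \<Lambda>) ?C \<subseteq> sets (count_algebra (configurations_in \<Lambda>))"
    using sets.sigma_sets_subset[of ?C "count_algebra (configurations_in \<Lambda>)"] by auto
  have 2: "sets (count_algebra (configurations_in \<Lambda>)) \<subseteq> ?C"
    using sets.sets_into_space[of _ "count_algebra (configurations_in \<Lambda>)"] unfolding * 
    by (auto simp: sets_restrict_space)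
  show ?thesis unfolding sets by (rule equalityI[OF 1 order_trans[OF 2 sigma_sets_superset_generator]])
qed

lemma space_borel_configurations_in:
  "(\<Lambda> :: 'a set) \<in> relatively_compact_borel \<Longrightarrow> space (borel_configurations_in \<Lambda>) = configurations_in \<Lambda>"
  using sets_eq_imp_space_eq[OF sets_borel_configurations_in] by simp

end

section \<open>Mixtures of the measures of n-point configurations\<close>

text \<open>The weights are left free so that Poisson and fractional Poisson measures are instances
  of one construction.\<close>

definition mixed_configuration_measure ::
  "(nat \<Rightarrow> real) \<Rightarrow> 'a::topological_space measure \<Rightarrow> 'a set \<Rightarrow> 'a set measure" where
  "mixed_configuration_measure w \<mu> \<Lambda> =
     measure_of (configurations_in \<Lambda>) (sets (borel_configurations_in \<Lambda>))
       (\<lambda>B. \<Sum>n. ennreal (w n) *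
         emeasure (n_configuration_measure \<mu> \<Lambda> n) (B \<inter> n_configurations_in \<Lambda> n))"

lemma fractional_poisson_in_eq_mixed:
  "fractional_poisson_in \<alpha> \<mu> \<Lambda> =
    mixed_configuration_measure (\<lambda>n. Re (fractional_poisson_weight \<alpha> (measure \<mu> \<Lambda>) n)) \<mu> \<Lambda>"
  by (simp add: fractional_poisson_in_def mixed_configuration_measure_def)

locale intensity_measure = locally_compact_base b for b :: "nat \<Rightarrow> 'a::{t2_space, second_countable_topology} set" +
  fixes \<mu> :: "'a measure"
  assumes sets_\<mu>: "sets \<mu> = sets borel"
    and \<mu>_compact: "\<And>K. compact K \<Longrightarrow> emeasure \<mu> K < \<infinity>"
    and \<mu>_point: "\<And>x. emeasure \<mu> {x} = 0"
begin

lemma space_\<mu>: "space \<mu> = UNIV"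
  using sets_eq_imp_space_eq[OF sets_\<mu>] by simp

lemma measurable_\<mu>: "f \<in> borel_measurable borel \<Longrightarrow> f \<in> borel_measurable \<mu>"
  by (simp add: measurable_cong_sets[OF sets_\<mu> refl])

lemma \<mu>_finite: "\<Lambda> \<in> relatively_compact_borel \<Longrightarrow> emeasure \<mu> \<Lambda> < \<infinity>"
  using emeasure_mono[of \<Lambda> "closure \<Lambda>" \<mu>] \<mu>_compact[of "closure \<Lambda>"] closure_subset[of \<Lambda>]
  by (auto simp: relatively_compact_borel_def sets_\<mu> intro: le_less_trans)

lemma rcb_borel: "\<Lambda> \<in> relatively_compact_borel \<Longrightarrow> \<Lambda> \<in> sets borel"
  by (simp add: relatively_compact_borel_def)

lemma rcb_sets: "\<Lambda> \<in> relatively_compact_borel \<Longrightarrow> \<Lambda> \<in> sets \<mu>"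
  by (simp add: relatively_compact_borel_def sets_\<mu>)

sublocale \<mu>: sigma_finite_measure \<mu>
proof
  show "\<exists>A. countable A \<and> A \<subseteq> sets \<mu> \<and> \<Union>A = space \<mu> \<and> (\<forall>a\<in>A. emeasure \<mu> a \<noteq> \<infinity>)"
  proof (intro exI conjI)
    show "\<Union>(range b) = space \<mu>" using b_base[OF open_UNIV] by (auto simp: space_\<mu>)
    show "\<forall>a\<in>range b. emeasure \<mu> a \<noteq> \<infinity>" using \<mu>_finite[OF b_rcb] by (auto simp: less_top)
  qed (use rcb_sets[OF b_rcb] in auto)
qed

sublocale product_sigma_finite "\<lambda>_. \<mu>" ..

abbreviation tuples_measure :: "nat \<Rightarrow> (nat \<Rightarrow> 'a) measure" where
  "tuples_measure n \<equiv> \<Pi>\<^sub>M i\<in>{..<n}. \<mu>"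

lemma component_measurable: "i < n \<Longrightarrow> (\<lambda>x. x i) \<in> borel_measurable (tuples_measure n)"
  by (subst measurable_cong_sets[OF refl sets_\<mu>[symmetric]]) auto

text \<open>By Fubini, fix all coordinates but the i-th: the section of the diagonal x i = x j is
  then a single point, which is a \<mu>-null set.\<close>

lemma AE_distinct: "AE x in tuples_measure n. inj_on x {..<n}"
proof -
  have "AE x in tuples_measure n. x i \<noteq> x j" if ij: "i < n" "j < n" "i \<noteq> j" for i j
  proof -
    let ?I = "{..<n} - {i}"
    let ?E = "{x \<in> space (tuples_measure n). x i = x j}"
    have E: "?E \<in> sets (tuples_measure n)"
      using ij by (intro measurable_equality_set component_measurable)
    have I: "insert i ?I = {..<n}" using ij by auto
    have "emeasure (tuples_measure n) ?E = (\<integral>\<^sup>+x. indicator ?E x \<partial>Pi\<^sub>M (insert i ?I) (\<lambda>_. \<mu>))"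
      using E unfolding I by simp
    also have "\<dots> = (\<integral>\<^sup>+x. (\<integral>\<^sup>+y. indicator ?E (x(i := y)) \<partial>\<mu>) \<partial>Pi\<^sub>M ?I (\<lambda>_. \<mu>))"
      by (rule product_nn_integral_insert[OF _ _ borel_measurable_indicator]) (use E in \<open>simp_all only: I, auto\<close>)
    also have "\<dots> = (\<integral>\<^sup>+x. (\<integral>\<^sup>+y. indicator {x j} y \<partial>\<mu>) \<partial>Pi\<^sub>M ?I (\<lambda>_. \<mu>))"
    proof (intro nn_integral_cong)
      fix x and y :: 'a assume x: "x \<in> space (Pi\<^sub>M ?I (\<lambda>_. \<mu>))"
      then have "x(i := y) \<in> space (tuples_measure n)"
        using ij by (auto simp: space_PiM PiE_iff space_\<mu> extensional_def)
      then show "indicator ?E (x(i := y)) = (indicator {x j} y :: ennreal)"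
        using ij by (auto simp: indicator_def)
    qed
    also have "\<dots> = 0" by (simp add: \<mu>_point sets_\<mu>)
    finally have "?E \<in> null_sets (tuples_measure n)" using E by auto
    then show ?thesis by (rule AE_I') auto
  qed
  then have "AE x in tuples_measure n. \<forall>i\<in>{..<n}. \<forall>j\<in>{..<n}. i \<noteq> j \<longrightarrow> x i \<noteq> x j"
    by (intro AE_finite_allI AE_impI) auto
  then show ?thesis by eventually_elim (auto simp: inj_on_def)
qed

lemma distinct_tuples_sets:
  assumes "\<Lambda> \<in> sets borel"
  shows "distinct_tuples \<Lambda> n \<in> sets (tuples_measure n)"
proof -
  have "distinct_tuples \<Lambda> n = {x \<in> space (tuples_measure n). (\<forall>i\<in>{..<n}. x i \<in> \<Lambda>) \<and>
      (\<forall>i\<in>{..<n}. \<forall>j\<in>{..<n}. x i = x j \<longrightarrow> i = j)}"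
    by (auto simp: distinct_tuples_def space_PiM PiE_iff space_\<mu> inj_on_def)
  also have "\<dots> \<in> sets (tuples_measure n)"
    by (intro sets.sets_Collect_conj sets.sets_Collect_finite_All sets.sets_Collect_imp
        measurable_equality_set component_measurable sets.sets_Collect_const)
      (use assms in \<open>auto simp: sets_\<mu> space_\<mu> intro!: sets_Collect_single'\<close>)
  finally show ?thesis .
qed

text \<open>Up to a null set the distinct tuples form a full product set, so integrals over them
  factorise. The value type is left open because masses need \<open>ennreal\<close> and
  characteristic functionals need \<open>real\<close>.\<close>

lemma AE_distinct_tuples:
  "AE x in tuples_measure n. indicator (distinct_tuples \<Lambda> n) x = (\<Prod>i<n. indicator \<Lambda> (x i) :: 'b::comm_semiring_1)"
proof -
  have "AE x in tuples_measure n. x \<in> space (tuples_measure n)" by simp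
  with AE_distinct[of n] show ?thesis
  proof eventually_elim
    case (elim x)
    show ?case
    proof (cases "\<forall>i<n. x i \<in> \<Lambda>")
      case True
      then show ?thesis using elim by (auto simp: distinct_tuples_def space_PiM PiE_iff)
    next
      case False
      then obtain i where "i < n" "x i \<notin> \<Lambda>" by blast
      then have "(\<Prod>i<n. indicator \<Lambda> (x i) :: 'b) = 0" by (intro prod_zero bexI[of _ i]) auto
      moreover have "x \<notin> distinct_tuples \<Lambda> n"
        using \<open>i < n\<close> \<open>x i \<notin> \<Lambda>\<close> by (auto simp: distinct_tuples_def PiE_iff)
      ultimately show ?thesis by simp
    qed
  qed
qed

text \<open>On distinct tuples no two coordinates coincide, so the count of B in the image is the
  number of coordinates lying in B.\<close>

lemma sym_map_measurable:
  assumes \<Lambda>: "\<Lambda> \<in> relatively_compact_borel"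
  shows "sym_map n \<in> restrict_space (tuples_measure n) (distinct_tuples \<Lambda> n) \<rightarrow>\<^sub>M borel_n_configurations_in \<Lambda> n"
proof (subst measurable_cong_sets[OF refl sets_borel_n_configurations_in], rule measurable_into_count_algebra)
  let ?R = "restrict_space (tuples_measure n) (distinct_tuples \<Lambda> n)"
  have sp: "space ?R \<subseteq> distinct_tuples \<Lambda> n" by (auto simp: space_restrict_space)
  show "sym_map n \<in> space ?R \<rightarrow> n_configurations_in \<Lambda> n" using sp sym_map_in_n_configurations by auto
  fix B :: "'a set" assume B: "B \<in> relatively_compact_borel"
  have "(\<lambda>x. \<Sum>i<n. if x i \<in> B then 1 else 0 :: nat) \<in> ?R \<rightarrow>\<^sub>M count_space UNIV"
  proof (intro measurable_restrict_space1 measurable_sum_nat measurable_If measurable_const)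
    fix i assume "i \<in> {..<n}"
    then show "{x \<in> space (tuples_measure n). x i \<in> B} \<in> sets (tuples_measure n)"
      using rcb_sets[OF B] sets.sets_into_space[OF rcb_sets[OF B]] by (intro sets_Collect_single') (auto simp: space_\<mu>)
  qed auto
  also have "?this \<longleftrightarrow> (\<lambda>x. card (sym_map n x \<inter> B)) \<in> ?R \<rightarrow>\<^sub>M count_space UNIV"
  proof (rule measurable_cong)
    fix x assume "x \<in> space ?R"
    then have inj: "inj_on x {..<n}" using sp by (auto simp: distinct_tuples_def)
    have "sym_map n x \<inter> B = x ` {i \<in> {..<n}. x i \<in> B}" by (auto simp: sym_map_def)
    also have "card \<dots> = card {i \<in> {..<n}. x i \<in> B}"
      by (rule card_image) (rule inj_on_subset[OF inj], auto)
    also have "\<dots> = (\<Sum>i<n. if x i \<in> B then 1 else 0)"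
      by (simp add: sum.If_cases Int_def)
    finally show "(\<Sum>i<n. if x i \<in> B then 1 else 0) = card (sym_map n x \<inter> B)" by simp
  qed
  finally show "(\<lambda>x. card (sym_map n x \<inter> B)) \<in> ?R \<rightarrow>\<^sub>M count_space UNIV" .
qed

lemma sets_n_configuration_measure:
  "sets (n_configuration_measure \<mu> \<Lambda> n) = sets (borel_n_configurations_in \<Lambda> n)"
  by (simp add: n_configuration_measure_def)

text \<open>Tuples are almost everywhere distinct, so the restriction to distinct tuples loses no
  mass; the factor 1/n! belongs to the weights.\<close>

lemma emeasure_n_configuration_measure_space:
  assumes \<Lambda>: "\<Lambda> \<in> relatively_compact_borel"
  shows "emeasure (n_configuration_measure \<mu> \<Lambda> n) (n_configurations_in \<Lambda> n) = emeasure \<mu> \<Lambda> ^ n"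
proof -
  let ?R = "restrict_space (tuples_measure n) (distinct_tuples \<Lambda> n)"
  have D: "distinct_tuples \<Lambda> n \<in> sets (tuples_measure n)" by (rule distinct_tuples_sets[OF rcb_borel[OF \<Lambda>]])
  have "emeasure (n_configuration_measure \<mu> \<Lambda> n) (space (borel_n_configurations_in \<Lambda> n)) = emeasure ?R (space ?R)"
    unfolding n_configuration_measure_def using sym_map_measurable[OF \<Lambda>]
    by (subst emeasure_distr) (auto intro!: arg_cong[where f="emeasure ?R"] dest: measurable_space)
  also have "\<dots> = emeasure (tuples_measure n) (distinct_tuples \<Lambda> n)"
    using D sets.sets_into_space[OF D]
    by (subst emeasure_restrict_space) (auto simp: space_restrict_space Int_absorb2)
  also have "\<dots> = (\<integral>\<^sup>+x. indicator (distinct_tuples \<Lambda> n) x \<partial>tuples_measure n)"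
    using D by simp
  also have "\<dots> = (\<integral>\<^sup>+x. (\<Prod>i<n. indicator \<Lambda> (x i)) \<partial>tuples_measure n)"
    by (intro nn_integral_cong_AE AE_distinct_tuples)
  also have "\<dots> = (\<Prod>i<n. \<integral>\<^sup>+x. indicator \<Lambda> x \<partial>\<mu>)"
    using rcb_sets[OF \<Lambda>] by (intro product_nn_integral_prod) auto
  also have "\<dots> = emeasure \<mu> \<Lambda> ^ n" using rcb_sets[OF \<Lambda>] by simp
  finally show ?thesis by (simp add: borel_n_configurations_in_space_sets)
qed

text \<open>For almost every tuple the sum over the set of its entries is the sum over its
  coordinates, and the exponential then splits into a product.\<close>

lemma n_configuration_measure_charfun:
  fixes f :: "'a \<Rightarrow> real"
  assumes \<Lambda>: "\<Lambda> \<in> relatively_compact_borel" and f: "f \<in> borel_measurable borel"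
  shows "(\<integral>\<gamma>. iexp (\<Sum>x\<in>\<gamma>. f x) \<partial>n_configuration_measure \<mu> \<Lambda> n) =
    (\<integral>x. indicator \<Lambda> x *\<^sub>R iexp (f x) \<partial>\<mu>) ^ n"
proof -
  let ?R = "restrict_space (tuples_measure n) (distinct_tuples \<Lambda> n)"
  let ?e = "\<lambda>\<gamma>. iexp (\<Sum>x\<in>\<gamma>. f x)"
  have D: "distinct_tuples \<Lambda> n \<in> sets (tuples_measure n)" by (rule distinct_tuples_sets[OF rcb_borel[OF \<Lambda>]])
  have sub: "n_configurations_in \<Lambda> n \<subseteq> configurations" by (auto simp: n_configurations_in_iff)
  have "(\<lambda>\<gamma>. \<Sum>x\<in>\<gamma> \<inter> \<Lambda>. f x) \<in> borel_measurable (count_algebra (n_configurations_in \<Lambda> n))"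
    by (rule measurable_sum_count_algebra[OF sub \<Lambda> f])
  also have "?this \<longleftrightarrow> (\<lambda>\<gamma>. \<Sum>x\<in>\<gamma>. f x) \<in> borel_measurable (count_algebra (n_configurations_in \<Lambda> n))"
    by (intro measurable_cong) (auto simp: n_configurations_in_iff Int_absorb2)
  finally have "(\<lambda>\<gamma>. \<Sum>x\<in>\<gamma>. f x) \<in> borel_measurable (borel_n_configurations_in \<Lambda> n)"
    by (simp add: measurable_cong_sets[OF sets_borel_n_configurations_in refl])
  then have e_meas: "?e \<in> borel_measurable (borel_n_configurations_in \<Lambda> n)"
    by measurable
  have fm: "f \<in> borel_measurable \<mu>" by (rule measurable_\<mu>[OF f])
  have int: "integrable \<mu> (\<lambda>x. indicator \<Lambda> x *\<^sub>R iexp (f x))"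
  proof (rule integrableI_bounded_set_indicator[where B=1])
    show "AE x in \<mu>. x \<in> \<Lambda> \<longrightarrow> norm (iexp (f x)) \<le> 1" by simp
  qed (use rcb_sets[OF \<Lambda>] \<mu>_finite[OF \<Lambda>] fm in auto)
  have "(\<integral>\<gamma>. ?e \<gamma> \<partial>n_configuration_measure \<mu> \<Lambda> n) = (\<integral>x. ?e (sym_map n x) \<partial>?R)"
    unfolding n_configuration_measure_def by (rule integral_distr[OF sym_map_measurable[OF \<Lambda>] e_meas])
  also have "\<dots> = (\<integral>x. indicator (distinct_tuples \<Lambda> n) x *\<^sub>R ?e (sym_map n x) \<partial>tuples_measure n)"
    using D by (intro integral_restrict_space) auto
  also have "\<dots> = (\<integral>x. (\<Prod>i<n. indicator \<Lambda> (x i) *\<^sub>R iexp (f (x i))) \<partial>tuples_measure n)"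
  proof (rule integral_cong_AE)
    show "(\<lambda>x. indicator (distinct_tuples \<Lambda> n) x *\<^sub>R ?e (sym_map n x)) \<in> borel_measurable (tuples_measure n)"
      using measurable_compose[OF sym_map_measurable[OF \<Lambda>] e_meas] D
      by (subst (asm) borel_measurable_restrict_space_iff) auto
    show "(\<lambda>x. \<Prod>i<n. indicator \<Lambda> (x i) *\<^sub>R iexp (f (x i))) \<in> borel_measurable (tuples_measure n)"
    proof (rule borel_measurable_prod)
      fix i assume i: "i \<in> {..<n}"
      show "(\<lambda>x. indicator \<Lambda> (x i) *\<^sub>R iexp (f (x i))) \<in> borel_measurable (tuples_measure n)"
        by (rule measurable_compose[OF measurable_component_singleton[OF i]])
          (rule borel_measurable_integrable[OF int])
    qed
    show "AE x in tuples_measure n. indicator (distinct_tuples \<Lambda> n) x *\<^sub>R ?e (sym_map n x) =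
        (\<Prod>i<n. indicator \<Lambda> (x i) *\<^sub>R iexp (f (x i)))"
      using AE_distinct_tuples[where n=n and \<Lambda>=\<Lambda> and 'b=real] AE_distinct[of n]
    proof eventually_elim
      case (elim x)
      have "?e (sym_map n x) = (\<Prod>i<n. iexp (f (x i)))"
        using elim(2) by (simp add: sym_map_def sum.reindex exp_sum sum_distrib_left)
      then show ?case unfolding elim(1) by (simp add: scaleR_conv_of_real prod.distrib)
    qed
  qed
  also have "\<dots> = (\<Prod>i<n. \<integral>x. indicator \<Lambda> x *\<^sub>R iexp (f x) \<partial>\<mu>)"
    using int by (intro product_integral_prod) auto
  finally show ?thesis by simp
qed

section \<open>Weighted sums of the n-point measures\<close>

lemma sets_mixed: "sets (mixed_configuration_measure w \<mu> \<Lambda>) = sets (borel_configurations_in \<Lambda>)"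
proof -
  have "space (borel_configurations_in \<Lambda>) = configurations_in \<Lambda>"
    unfolding borel_configurations_in_def by (subst space_measure_of) auto
  then show ?thesis
    unfolding mixed_configuration_measure_def using sets.sigma_sets_eq[of "borel_configurations_in \<Lambda>"]
      sets.space_closed[of "borel_configurations_in \<Lambda>"]
    by (subst sets_measure_of) auto
qed

lemma space_mixed: "\<Lambda> \<in> relatively_compact_borel \<Longrightarrow> space (mixed_configuration_measure w \<mu> \<Lambda>) = configurations_in \<Lambda>"
  using sets_eq_imp_space_eq[OF sets_mixed] space_borel_configurations_in by metis

lemma Int_n_configurations_sets:
  fixes \<Lambda> :: "'a set"
  assumes \<Lambda>: "\<Lambda> \<in> relatively_compact_borel" and B: "B \<in> sets (borel_configurations_in \<Lambda>)"
  shows "B \<inter> n_configurations_in \<Lambda> n \<in> sets (borel_n_configurations_in \<Lambda> n)"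
  using B unfolding sets_borel_configurations_in[OF \<Lambda>] sets_borel_n_configurations_in
    sets_count_algebra_n_configurations[OF \<Lambda>] by (auto simp: sets_restrict_space)

text \<open>Countable additivity is Tonelli's theorem for a nonnegative double series, obtained by
  reading one of the sums as an integral over counting measure.\<close>

lemma emeasure_mixed:
  assumes \<Lambda>: "\<Lambda> \<in> relatively_compact_borel" and B: "B \<in> sets (borel_configurations_in \<Lambda>)"
  shows "emeasure (mixed_configuration_measure w \<mu> \<Lambda>) B =
    (\<Sum>n. ennreal (w n) * emeasure (n_configuration_measure \<mu> \<Lambda> n) (B \<inter> n_configurations_in \<Lambda> n))"
  unfolding mixed_configuration_measure_def
proof (rule emeasure_measure_of_sigma[OF _ _ _ B])
  show "sigma_algebra (configurations_in \<Lambda>) (sets (borel_configurations_in \<Lambda>))"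
    using sets.sigma_algebra_axioms[of "borel_configurations_in \<Lambda>"] space_borel_configurations_in[OF \<Lambda>] by simp
  show "positive (sets (borel_configurations_in \<Lambda>))
     (\<lambda>B. \<Sum>n. ennreal (w n) * emeasure (n_configuration_measure \<mu> \<Lambda> n) (B \<inter> n_configurations_in \<Lambda> n))"
    by (simp add: positive_def)
  show "countably_additive (sets (borel_configurations_in \<Lambda>))
     (\<lambda>B. \<Sum>n. ennreal (w n) * emeasure (n_configuration_measure \<mu> \<Lambda> n) (B \<inter> n_configurations_in \<Lambda> n))"
  proof (rule countably_additiveI)
    fix A :: "nat \<Rightarrow> 'a set set" assume A: "range A \<subseteq> sets (borel_configurations_in \<Lambda>)" "disjoint_family A"
    have "(\<Sum>i. \<Sum>n. ennreal (w n) * emeasure (n_configuration_measure \<mu> \<Lambda> n) (A i \<inter> n_configurations_in \<Lambda> n)) =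
      (\<Sum>n. \<Sum>i. ennreal (w n) * emeasure (n_configuration_measure \<mu> \<Lambda> n) (A i \<inter> n_configurations_in \<Lambda> n))"
      using nn_integral_suminf[where M="count_space (UNIV :: nat set)"
          and f="\<lambda>n i. ennreal (w n) * emeasure (n_configuration_measure \<mu> \<Lambda> n) (A i \<inter> n_configurations_in \<Lambda> n)"]
      by (simp add: nn_integral_count_space_nat)
    also have "\<dots> = (\<Sum>n. ennreal (w n) * (\<Sum>i. emeasure (n_configuration_measure \<mu> \<Lambda> n) (A i \<inter> n_configurations_in \<Lambda> n)))"
      by simp
    also have "\<dots> = (\<Sum>n. ennreal (w n) * emeasure (n_configuration_measure \<mu> \<Lambda> n) ((\<Union>(range A)) \<inter> n_configurations_in \<Lambda> n))"
    proof (intro suminf_cong arg_cong2[where f="(*)"] refl)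
      fix n
      have "(\<Sum>i. emeasure (n_configuration_measure \<mu> \<Lambda> n) (A i \<inter> n_configurations_in \<Lambda> n)) =
        emeasure (n_configuration_measure \<mu> \<Lambda> n) (\<Union>i. A i \<inter> n_configurations_in \<Lambda> n)"
        using A Int_n_configurations_sets[OF \<Lambda>]
        by (intro suminf_emeasure) (auto simp: sets_n_configuration_measure disjoint_family_on_def)
      then show "(\<Sum>i. emeasure (n_configuration_measure \<mu> \<Lambda> n) (A i \<inter> n_configurations_in \<Lambda> n)) =
        emeasure (n_configuration_measure \<mu> \<Lambda> n) ((\<Union>(range A)) \<inter> n_configurations_in \<Lambda> n)" by simp
    qed
    finally show "(\<Sum>i. \<Sum>n. ennreal (w n) * emeasure (n_configuration_measure \<mu> \<Lambda> n) (A i \<inter> n_configurations_in \<Lambda> n)) =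
      (\<Sum>n. ennreal (w n) * emeasure (n_configuration_measure \<mu> \<Lambda> n) ((\<Union>(range A)) \<inter> n_configurations_in \<Lambda> n))" .
  qed
qed

lemma prob_space_mixed:
  assumes \<Lambda>: "\<Lambda> \<in> relatively_compact_borel" and w: "\<And>n. w n \<ge> 0" "(\<lambda>n. w n * measure \<mu> \<Lambda> ^ n) sums 1"
  shows "prob_space (mixed_configuration_measure w \<mu> \<Lambda>)"
proof
  have "emeasure \<mu> \<Lambda> = ennreal (measure \<mu> \<Lambda>)"
    using \<mu>_finite[OF \<Lambda>] by (intro emeasure_eq_ennreal_measure) (auto simp: less_top)
  then have pow: "emeasure \<mu> \<Lambda> ^ n = ennreal (measure \<mu> \<Lambda> ^ n)" for n by (simp add: ennreal_power)
  have top: "configurations_in \<Lambda> \<in> sets (borel_configurations_in \<Lambda>)"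
    using sets.top[of "borel_configurations_in \<Lambda>"] by (simp add: space_borel_configurations_in[OF \<Lambda>])
  have "emeasure (mixed_configuration_measure w \<mu> \<Lambda>) (configurations_in \<Lambda>) =
    (\<Sum>n. ennreal (w n) * emeasure (n_configuration_measure \<mu> \<Lambda> n) (configurations_in \<Lambda> \<inter> n_configurations_in \<Lambda> n))"
    by (rule emeasure_mixed[OF \<Lambda> top])
  also have "\<dots> = (\<Sum>n. ennreal (w n) * emeasure (n_configuration_measure \<mu> \<Lambda> n) (n_configurations_in \<Lambda> n))"
    by (intro suminf_cong arg_cong2[where f="(*)"] refl arg_cong2[where f=emeasure]) (auto simp: n_configurations_in_def)
  also have "\<dots> = (\<Sum>n. ennreal (w n * measure \<mu> \<Lambda> ^ n))"
    using w(1) by (simp add: emeasure_n_configuration_measure_space[OF \<Lambda>] pow ennreal_mult)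
  also have "\<dots> = ennreal 1"
    using w by (intro suminf_ennreal_eq) auto
  finally show "emeasure (mixed_configuration_measure w \<mu> \<Lambda>) (space (mixed_configuration_measure w \<mu> \<Lambda>)) = 1"
    by (simp add: space_mixed[OF \<Lambda>])
qed

lemma measurable_sum_configurations_in:
  fixes \<Lambda> :: "'a set"
  assumes \<Lambda>: "\<Lambda> \<in> relatively_compact_borel" and f: "f \<in> borel_measurable borel"
  shows "(\<lambda>\<gamma>. \<Sum>x\<in>\<gamma>. f x :: real) \<in> borel_measurable (borel_configurations_in \<Lambda>)"
proof -
  have "(\<lambda>\<gamma>. \<Sum>x\<in>\<gamma> \<inter> \<Lambda>. f x) \<in> borel_measurable (count_algebra (configurations_in \<Lambda>))"
    by (rule measurable_sum_count_algebra[OF _ \<Lambda> f]) (auto simp: configurations_in_def)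
  also have "?this \<longleftrightarrow> (\<lambda>\<gamma>. \<Sum>x\<in>\<gamma>. f x) \<in> borel_measurable (count_algebra (configurations_in \<Lambda>))"
    by (intro measurable_cong) (auto simp: configurations_in_def Int_absorb2)
  finally show ?thesis by (simp add: measurable_cong_sets[OF sets_borel_configurations_in[OF \<Lambda>] refl])
qed

text \<open>Layers with different numbers of points are disjoint, so a single term of the series
  survives. Integrals against the mixture are computed layer by layer through this identity.\<close>

lemma restrict_mixed:
  assumes \<Lambda>: "\<Lambda> \<in> relatively_compact_borel"
  shows "restrict_space (mixed_configuration_measure w \<mu> \<Lambda>) (n_configurations_in \<Lambda> n) =
    density (n_configuration_measure \<mu> \<Lambda> n) (\<lambda>_. ennreal (w n))" (is "?R = ?S")
proof (rule measure_eqI)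
  have N: "n_configurations_in \<Lambda> n \<in> sets (borel_configurations_in \<Lambda>)"
    unfolding sets_borel_configurations_in[OF \<Lambda>] by (rule n_configurations_in_sets[OF \<Lambda>])
  show sets: "sets ?R = sets ?S"
    by (simp add: sets_restrict_space_cong[OF sets_mixed] sets_restrict_space_cong[OF sets_borel_configurations_in[OF \<Lambda>]]
        sets_n_configuration_measure sets_borel_n_configurations_in sets_count_algebra_n_configurations[OF \<Lambda>])
  fix A assume A: "A \<in> sets ?R"
  then have A': "A \<subseteq> n_configurations_in \<Lambda> n" "A \<in> sets (borel_configurations_in \<Lambda>)"
    using N by (auto simp: sets_restrict_space sets_mixed)
  have "emeasure ?R A = emeasure (mixed_configuration_measure w \<mu> \<Lambda>) A"
    using N A' by (intro emeasure_restrict_space) (auto simp: sets_mixed)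
  also have "\<dots> = (\<Sum>k. ennreal (w k) * emeasure (n_configuration_measure \<mu> \<Lambda> k) (A \<inter> n_configurations_in \<Lambda> k))"
    by (rule emeasure_mixed[OF \<Lambda> A'(2)])
  also have "\<dots> = (\<Sum>k\<in>{n}. ennreal (w k) * emeasure (n_configuration_measure \<mu> \<Lambda> k) (A \<inter> n_configurations_in \<Lambda> k))"
  proof (rule suminf_finite)
    fix k assume "k \<notin> {n}"
    then have "A \<inter> n_configurations_in \<Lambda> k = {}" using A'(1) by (auto simp: n_configurations_in_def)
    then show "ennreal (w k) * emeasure (n_configuration_measure \<mu> \<Lambda> k) (A \<inter> n_configurations_in \<Lambda> k) = 0" by simp
  qed simp
  also have "\<dots> = emeasure ?S A" using A'(1) A unfolding sets by (simp add: Int_absorb2 emeasure_density_const)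
  finally show "emeasure ?R A = emeasure ?S A" .
qed

lemma mixed_charfun:
  fixes f :: "'a \<Rightarrow> real"
  assumes \<Lambda>: "\<Lambda> \<in> relatively_compact_borel" and w: "\<And>n. w n \<ge> 0" "(\<lambda>n. w n * measure \<mu> \<Lambda> ^ n) sums 1"
    and f: "f \<in> borel_measurable borel"
  shows "(\<integral>\<gamma>. iexp (\<Sum>x\<in>\<gamma>. f x) \<partial>mixed_configuration_measure w \<mu> \<Lambda>) =
    (\<Sum>n. of_real (w n) * (\<integral>x. indicator \<Lambda> x *\<^sub>R iexp (f x) \<partial>\<mu>) ^ n)"
proof -
  let ?M = "mixed_configuration_measure w \<mu> \<Lambda>"
  let ?e = "\<lambda>\<gamma>. iexp (\<Sum>x\<in>\<gamma>. f x)"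
  interpret M: prob_space ?M by (rule prob_space_mixed[OF \<Lambda> w])
  have N: "n_configurations_in \<Lambda> n \<in> sets ?M" for n
    unfolding sets_mixed sets_borel_configurations_in[OF \<Lambda>] by (rule n_configurations_in_sets[OF \<Lambda>])
  have "(\<lambda>\<gamma>. \<Sum>x\<in>\<gamma>. f x) \<in> borel_measurable ?M"
    using measurable_sum_configurations_in[OF \<Lambda> f] by (simp add: measurable_cong_sets[OF sets_mixed refl])
  then have e_meas: "?e \<in> borel_measurable ?M" by measurable
  have int: "integrable ?M ?e" by (rule M.integrable_const_bound[where B=1]) (use e_meas in auto)
  have Un: "(\<Union>n. n_configurations_in \<Lambda> n) = space ?M"
    using configurations_in_finite[OF \<Lambda>] unfolding space_mixed[OF \<Lambda>] by (auto simp: n_configurations_in_def)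
  have "(\<integral>\<gamma>. ?e \<gamma> \<partial>?M) = (LINT \<gamma>:(\<Union>n. n_configurations_in \<Lambda> n)|?M. ?e \<gamma>)"
    unfolding Un by (rule set_integral_space[OF int, symmetric])
  also have "\<dots> = (\<Sum>n. LINT \<gamma>:n_configurations_in \<Lambda> n|?M. ?e \<gamma>)"
  proof (rule lebesgue_integral_countable_add)
    show "set_integrable ?M (\<Union>n. n_configurations_in \<Lambda> n) ?e"
      unfolding set_integrable_def using int N by (intro integrable_mult_indicator) auto
  qed (use N in \<open>auto simp: n_configurations_in_def\<close>)
  also have "\<dots> = (\<Sum>n. of_real (w n) * (\<integral>x. indicator \<Lambda> x *\<^sub>R iexp (f x) \<partial>\<mu>) ^ n)"
  proof (rule suminf_cong)
    fix n
    have "(LINT \<gamma>:n_configurations_in \<Lambda> n|?M. ?e \<gamma>) = (\<integral>\<gamma>. ?e \<gamma> \<partial>restrict_space ?M (n_configurations_in \<Lambda> n))"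
      unfolding set_lebesgue_integral_def using N by (intro integral_restrict_space[symmetric]) auto
    also have "\<dots> = w n *\<^sub>R (\<integral>\<gamma>. ?e \<gamma> \<partial>n_configuration_measure \<mu> \<Lambda> n)"
      unfolding restrict_mixed[OF \<Lambda>] 
    proof (subst integral_density)
      have "(\<lambda>\<gamma>. \<gamma>) \<in> borel_n_configurations_in \<Lambda> n \<rightarrow>\<^sub>M borel_configurations_in \<Lambda>"
        unfolding measurable_cong_sets[OF sets_borel_n_configurations_in sets_borel_configurations_in[OF \<Lambda>]]
        by (intro measurable_into_count_algebra measurable_card_count_algebra) (auto simp: n_configurations_in_def)
      from measurable_compose[OF this] e_meas
      show "?e \<in> borel_measurable (n_configuration_measure \<mu> \<Lambda> n)"
        by (simp add: measurable_cong_sets[OF sets_mixed refl] measurable_cong_sets[OF sets_n_configuration_measure refl])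
    qed (use w(1) in auto)
    finally show "(LINT \<gamma>:n_configurations_in \<Lambda> n|?M. ?e \<gamma>) =
        of_real (w n) * (\<integral>x. indicator \<Lambda> x *\<^sub>R iexp (f x) \<partial>\<mu>) ^ n"
      by (simp only: n_configuration_measure_charfun[OF \<Lambda> f] scaleR_conv_of_real)
  qed
  finally show ?thesis .
qed

end

section \<open>Poisson measures\<close>

text \<open>The formula for bounded real integrands is applied to real and imaginary parts, each of
  which commutes with the integrals.\<close>

lemma integral_bind_complex:
  fixes f :: "'b \<Rightarrow> complex"
  assumes M: "prob_space M" and K: "K \<in> M \<rightarrow>\<^sub>M prob_algebra N"
    and f: "f \<in> borel_measurable N" "\<And>x. norm (f x) \<le> 1"
  shows "(\<integral>x. f x \<partial>(M \<bind> K)) = (\<integral>y. (\<integral>x. f x \<partial>K y) \<partial>M)"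
proof -
  interpret M: prob_space M by (rule M)
  have K': "K \<in> M \<rightarrow>\<^sub>M subprob_algebra N" by (rule measurable_prob_algebraD[OF K])
  have setsK: "sets (K y) = sets N" if "y \<in> space M" for y using sets_kernel[OF K' that] .
  have probK: "prob_space (K y)" if "y \<in> space M" for y
    using measurable_space[OF K that] by (simp add: space_prob_algebra)
  have sets_bind: "sets (M \<bind> K) = sets N" by (rule sets_bind[OF setsK M.not_empty])
  have prob_bind: "prob_space (M \<bind> K)" by (rule M.prob_space_bind[OF AE_I2[OF probK] K'])
  have fK: "f \<in> borel_measurable (K y)" if "y \<in> space M" for y
    using f(1) by (simp add: measurable_cong_sets[OF setsK[OF that] refl])
  have intK: "integrable (K y) f" if "y \<in> space M" for y
  proof -
    interpret prob_space "K y" by (rule probK[OF that])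
    show ?thesis by (rule integrable_const_bound[where B=1]) (use f fK[OF that] in auto)
  qed
  have normK: "norm (\<integral>x. f x \<partial>K y) \<le> 1" if "y \<in> space M" for y
  proof -
    interpret prob_space "K y" by (rule probK[OF that])
    have "norm (\<integral>x. f x \<partial>K y) \<le> (\<integral>x. norm (f x) \<partial>K y)" by (rule integral_norm_bound)
    also have "\<dots> \<le> (\<integral>x. 1 \<partial>K y)" using f(2) intK[OF that] by (intro integral_mono) auto
    finally show ?thesis by (simp add: prob_space)
  qed
  have measK: "(\<lambda>y. \<integral>x. f x \<partial>K y) \<in> borel_measurable M"
    by (rule measurable_compose[OF K' integral_measurable_subprob_algebra[OF f(1)]])
  have intM: "integrable M (\<lambda>y. \<integral>x. f x \<partial>K y)"
    by (rule M.integrable_const_bound[where B=1]) (use measK normK in auto)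
  have int_bind: "integrable (M \<bind> K) f"
  proof -
    interpret prob_space "M \<bind> K" by (rule prob_bind)
    show ?thesis
      by (rule integrable_const_bound[where B=1]) (use f in \<open>auto simp: measurable_cong_sets[OF sets_bind refl]\<close>)
  qed
  have real: "(\<integral>x. g x \<partial>(M \<bind> K)) = (\<integral>y. (\<integral>x. g x \<partial>K y) \<partial>M)"
    if g: "g \<in> borel_measurable N" "\<And>x. \<bar>g x\<bar> \<le> 1" for g :: "'b \<Rightarrow> real"
  proof -
    let ?D = "distr M (subprob_algebra N) K"
    have "(\<integral>x. g x \<partial>(M \<bind> K)) = (\<integral>x. g x \<partial>join ?D)"
      unfolding bind_nonempty''[OF K' M.not_empty] ..
    also have "\<dots> = (\<integral>M'. integral\<^sup>L M' g \<partial>?D)"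
    proof (rule integral_join[where N=N and B=1 and B'=1])
      show "finite_measure ?D" by (rule M.finite_measure_distr[OF K'])
      show "AE M' in ?D. emeasure M' (space M') \<le> ennreal 1"
        by (rule AE_I2) (auto simp: space_subprob_algebra subprob_space.emeasure_space_le_1)
    qed (use g in auto)
    also have "\<dots> = (\<integral>y. (\<integral>x. g x \<partial>K y) \<partial>M)"
      by (rule integral_distr[OF K' integral_measurable_subprob_algebra[OF g(1)]])
    finally show ?thesis .
  qed
  have "h (\<integral>x. f x \<partial>(M \<bind> K)) = h (\<integral>y. (\<integral>x. f x \<partial>K y) \<partial>M)"
    if h: "bounded_linear h" "\<And>z. \<bar>h z\<bar> \<le> norm z" for h :: "complex \<Rightarrow> real"
  proof -
    have h_meas: "h \<in> borel_measurable borel"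
      by (intro borel_measurable_continuous_onI linear_continuous_on h)
    have "h (\<integral>x. f x \<partial>(M \<bind> K)) = (\<integral>y. (\<integral>x. h (f x) \<partial>K y) \<partial>M)"
      unfolding integral_bounded_linear[OF h(1) int_bind, symmetric]
      by (intro real measurable_compose[OF f(1) h_meas] order_trans[OF h(2) f(2)])
    also have "\<dots> = (\<integral>y. h (\<integral>x. f x \<partial>K y) \<partial>M)"
      by (intro Bochner_Integration.integral_cong refl integral_bounded_linear[OF h(1) intK])
    also have "\<dots> = h (\<integral>y. (\<integral>x. f x \<partial>K y) \<partial>M)"
      by (rule integral_bounded_linear[OF h(1) intM])
    finally show ?thesis .
  qed
  from this[OF bounded_linear_Re abs_Re_le_cmod] this[OF bounded_linear_Im abs_Im_le_cmod]
  show ?thesis by (rule complex_eqI)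
qed

context intensity_measure
begin

lemma charfun_integrand_integrable:
  assumes \<Lambda>: "\<Lambda> \<in> relatively_compact_borel" and f: "f \<in> borel_measurable borel"
  shows "integrable \<mu> (\<lambda>x. indicator \<Lambda> x *\<^sub>R (iexp (f x) - 1))"
    "integrable \<mu> (\<lambda>x. indicator \<Lambda> x *\<^sub>R iexp (f x))"
proof -
  have fm: "f \<in> borel_measurable \<mu>" by (rule measurable_\<mu>[OF f])
  have "norm (iexp (f x) - 1) \<le> 2" for x
    using norm_triangle_ineq4[of "iexp (f x)" 1] by simp
  then show "integrable \<mu> (\<lambda>x. indicator \<Lambda> x *\<^sub>R (iexp (f x) - 1))"
    by (intro integrableI_bounded_set_indicator[where B=2])
      (use rcb_sets[OF \<Lambda>] \<mu>_finite[OF \<Lambda>] fm in auto)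
  show "integrable \<mu> (\<lambda>x. indicator \<Lambda> x *\<^sub>R iexp (f x))"
    by (intro integrableI_bounded_set_indicator[where B=1])
      (use rcb_sets[OF \<Lambda>] \<mu>_finite[OF \<Lambda>] fm in auto)
qed

lemma charfun_integral_diff:
  assumes \<Lambda>: "\<Lambda> \<in> relatively_compact_borel" and f: "f \<in> borel_measurable borel"
  shows "(\<integral>x. indicator \<Lambda> x *\<^sub>R (iexp (f x) - 1) \<partial>\<mu>) =
    (\<integral>x. indicator \<Lambda> x *\<^sub>R iexp (f x) \<partial>\<mu>) - of_real (measure \<mu> \<Lambda>)"
proof -
  have int: "integrable \<mu> (\<lambda>x. complex_of_real (indicator \<Lambda> x))"
    using rcb_sets[OF \<Lambda>] \<mu>_finite[OF \<Lambda>] by (intro integrable_of_real) simp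
  have "(\<integral>x. indicator \<Lambda> x *\<^sub>R (iexp (f x) - 1) \<partial>\<mu>) =
    (\<integral>x. indicator \<Lambda> x *\<^sub>R iexp (f x) - complex_of_real (indicator \<Lambda> x) \<partial>\<mu>)"
    by (simp add: scaleR_conv_of_real algebra_simps)
  also have "\<dots> = (\<integral>x. indicator \<Lambda> x *\<^sub>R iexp (f x) \<partial>\<mu>) - (\<integral>x. complex_of_real (indicator \<Lambda> x) \<partial>\<mu>)"
    by (rule Bochner_Integration.integral_diff[OF charfun_integrand_integrable(2)[OF \<Lambda> f] int])
  also have "(\<integral>x. complex_of_real (indicator \<Lambda> x) \<partial>\<mu>) = of_real (measure \<mu> \<Lambda>)"
    using rcb_sets[OF \<Lambda>] by (simp add: integral_complex_of_real space_\<mu>)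
  finally show ?thesis .
qed

text \<open>The absolute value makes this a probability measure for every real \<open>t\<close>.\<close>

definition poisson_in :: "real \<Rightarrow> 'a set \<Rightarrow> 'a set measure" where
  "poisson_in t \<Lambda> = mixed_configuration_measure
     (\<lambda>n. exp (- \<bar>t\<bar> * measure \<mu> \<Lambda>) * \<bar>t\<bar> ^ n / fact n) \<mu> \<Lambda>"

lemma poisson_weights_sums:
  fixes c :: complex
  shows "(\<lambda>n. of_real (exp (- s * m) * s ^ n / fact n) * c ^ n) sums exp (of_real s * (c - of_real m))"
proof -
  have "(\<lambda>n. of_real (exp (- s * m)) * ((of_real s * c) ^ n /\<^sub>R fact n)) sums
      (of_real (exp (- s * m)) * exp (of_real s * c))"
    by (intro sums_mult exp_converges)
  also have "(\<lambda>n. of_real (exp (- s * m)) * ((of_real s * c) ^ n /\<^sub>R fact n)) =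
      (\<lambda>n. of_real (exp (- s * m) * s ^ n / fact n) * c ^ n)"
    by (auto simp: scaleR_conv_of_real power_mult_distrib field_simps)
  also have "of_real (exp (- s * m)) * exp (of_real s * c) = exp (of_real s * (c - of_real m))"
    by (simp add: exp_of_real[symmetric] exp_add[symmetric] algebra_simps)
  finally show ?thesis .
qed

lemma poisson_weights_sums_1:
  "(\<lambda>n. exp (- s * m) * s ^ n / fact n * m ^ n) sums (1 :: real)"
proof -
  have "(\<lambda>n. complex_of_real (exp (- s * m) * s ^ n / fact n * m ^ n)) sums of_real 1"
    using poisson_weights_sums[of s m "of_real m"] by simp
  then show ?thesis by (simp only: sums_of_real_iff)
qed

lemma prob_space_poisson_in: "\<Lambda> \<in> relatively_compact_borel \<Longrightarrow> prob_space (poisson_in t \<Lambda>)"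
  unfolding poisson_in_def by (rule prob_space_mixed[OF _ _ poisson_weights_sums_1]) auto

lemma sets_poisson_in: "sets (poisson_in t \<Lambda>) = sets (borel_configurations_in \<Lambda>)"
  unfolding poisson_in_def by (rule sets_mixed)

lemma poisson_in_charfun:
  assumes \<Lambda>: "\<Lambda> \<in> relatively_compact_borel" and f: "f \<in> borel_measurable borel"
  shows "(\<integral>\<gamma>. iexp (\<Sum>x\<in>\<gamma>. f x) \<partial>poisson_in t \<Lambda>) =
    exp (of_real \<bar>t\<bar> * (\<integral>x. indicator \<Lambda> x *\<^sub>R (iexp (f x) - 1) \<partial>\<mu>))"
proof -
  have "(\<integral>\<gamma>. iexp (\<Sum>x\<in>\<gamma>. f x) \<partial>poisson_in t \<Lambda>) =
    (\<Sum>n. of_real (exp (- \<bar>t\<bar> * measure \<mu> \<Lambda>) * \<bar>t\<bar> ^ n / fact n) *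
      (\<integral>x. indicator \<Lambda> x *\<^sub>R iexp (f x) \<partial>\<mu>) ^ n)"
    unfolding poisson_in_def by (rule mixed_charfun[OF \<Lambda> _ poisson_weights_sums_1 f]) auto
  also have "\<dots> = exp (of_real \<bar>t\<bar> * ((\<integral>x. indicator \<Lambda> x *\<^sub>R iexp (f x) \<partial>\<mu>) - of_real (measure \<mu> \<Lambda>)))"
    by (rule sums_unique[symmetric, OF poisson_weights_sums])
  finally show ?thesis unfolding charfun_integral_diff[OF \<Lambda> f] .
qed

text \<open>Measurability in the intensity parameter is what will make the Poisson laws a kernel
  that can be mixed.\<close>

lemma poisson_in_emeasure_measurable:
  assumes \<Lambda>: "\<Lambda> \<in> relatively_compact_borel" and B: "B \<in> sets (borel_configurations_in \<Lambda>)"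
  shows "(\<lambda>t. emeasure (poisson_in t \<Lambda>) B) \<in> borel_measurable borel"
  unfolding poisson_in_def emeasure_mixed[OF \<Lambda> B] by measurable

text \<open>A partition of the space into relatively compact Borel sets such that every relatively
  compact set is covered by finitely many of them.\<close>

definition piece :: "nat \<Rightarrow> 'a set" where
  "piece = disjointed b"

lemma piece_rcb: "piece k \<in> relatively_compact_borel"
proof -
  have "piece k = b k \<inter> piece k" using disjointed_subset[of b k] by (auto simp: piece_def)
  moreover have "piece k \<in> sets borel"
    unfolding piece_def disjointed_def using b_open by (intro sets.Diff sets.finite_UN) auto
  ultimately show ?thesis using relatively_compact_borel_Int[OF b_rcb] by metis
qed

lemma piece_disjoint: "i \<noteq> j \<Longrightarrow> piece i \<inter> piece j = {}"
  using disjoint_family_disjointed[of b] by (auto simp: piece_def disjoint_family_on_def)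

lemma rcb_subset_pieces:
  assumes "\<Lambda> \<in> relatively_compact_borel"
  obtains N where "\<Lambda> \<subseteq> (\<Union>k<N. piece k)"
proof -
  obtain N where "closure \<Lambda> \<subseteq> (\<Union>k<N. b k)"
    using compact_subset_union assms by (auto simp: relatively_compact_borel_def)
  moreover have "(\<Union>k<N. piece k) = (\<Union>k<N. b k)"
    using finite_UN_disjointed_eq[of b N] by (simp add: piece_def atLeast0LessThan)
  ultimately show thesis using closure_subset[of \<Lambda>] by (intro that[of N]) auto
qed

abbreviation pieces_algebra :: "(nat \<Rightarrow> 'a set) measure" where
  "pieces_algebra \<equiv> \<Pi>\<^sub>M k\<in>UNIV. borel_configurations_in (piece k)"

definition superpose :: "(nat \<Rightarrow> 'a set) \<Rightarrow> 'a set" where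
  "superpose \<omega> = (\<Union>k. \<omega> k)"

lemma space_pieces_algebra: "space pieces_algebra = {\<omega>. \<forall>k. \<omega> k \<in> configurations_in (piece k)}"
  by (auto simp: space_PiM PiE_iff space_borel_configurations_in[OF piece_rcb])

text \<open>Component k lives in piece k, and the pieces are disjoint, so a set covered by the first
  N pieces sees only the first N components. Local finiteness, measurability and the characteristic
  functional of the superposition all reduce to finite unions in this way.\<close>

lemma superpose_Int:
  assumes \<omega>: "\<omega> \<in> space pieces_algebra" and B: "B \<subseteq> (\<Union>k<N. piece k)"
  shows "superpose \<omega> \<inter> B = (\<Union>k<N. \<omega> k \<inter> B)"
proof (intro equalityI subsetI)
  fix x assume x: "x \<in> superpose \<omega> \<inter> B"
  then obtain k where k: "x \<in> \<omega> k" by (auto simp: superpose_def)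
  obtain j where j: "j < N" "x \<in> piece j" using x B by blast
  have "x \<in> piece k" using k \<omega> by (auto simp: space_pieces_algebra configurations_in_def)
  then have "k = j" using piece_disjoint[of k j] j(2) by blast
  then show "x \<in> (\<Union>k<N. \<omega> k \<inter> B)" using k x j(1) by auto
qed (auto simp: superpose_def)

lemma pieces_finite_disjoint:
  assumes \<omega>: "\<omega> \<in> space pieces_algebra"
  shows "finite (\<omega> k)" "i \<noteq> j \<Longrightarrow> \<omega> i \<inter> \<omega> j = {}"
proof -
  have \<omega>k: "\<omega> k \<in> configurations_in (piece k)" for k using \<omega> by (simp add: space_pieces_algebra)
  then show "finite (\<omega> k)" by (rule configurations_in_finite[OF piece_rcb])
  show "\<omega> i \<inter> \<omega> j = {}" if "i \<noteq> j"
    using \<omega>k[of i] \<omega>k[of j] piece_disjoint[OF that] by (auto simp: configurations_in_def)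
qed

lemma superpose_measurable: "superpose \<in> pieces_algebra \<rightarrow>\<^sub>M borel_configurations"
proof (subst measurable_cong_sets[OF refl sets_borel_configurations], rule measurable_into_count_algebra)
  show "superpose \<in> space pieces_algebra \<rightarrow> configurations"
  proof
    fix \<omega> assume \<omega>: "\<omega> \<in> space pieces_algebra"
    show "superpose \<omega> \<in> configurations"
      unfolding configurations_def
    proof (intro CollectI allI impI)
      fix K :: "'a set" assume "compact K"
      then obtain N where "K \<subseteq> (\<Union>k<N. piece k)" using rcb_subset_pieces compact_relatively_compact_borel by metis
      from superpose_Int[OF \<omega> this] show "finite (superpose \<omega> \<inter> K)"
        using pieces_finite_disjoint(1)[OF \<omega>] by auto
    qed
  qed
  fix B :: "'a set" assume B: "B \<in> relatively_compact_borel"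
  then obtain N where N: "B \<subseteq> (\<Union>k<N. piece k)" by (rule rcb_subset_pieces)
  have "(\<lambda>\<omega>. \<Sum>k<N. card (\<omega> k \<inter> B)) \<in> pieces_algebra \<rightarrow>\<^sub>M count_space UNIV"
  proof (rule measurable_sum_nat)
    fix k
    have "(\<lambda>\<gamma>. card (\<gamma> \<inter> B)) \<in> borel_configurations_in (piece k) \<rightarrow>\<^sub>M count_space UNIV"
      using measurable_card_count_algebra[OF B]
      by (simp add: measurable_cong_sets[OF sets_borel_configurations_in[OF piece_rcb] refl])
    then show "(\<lambda>\<omega>. card (\<omega> k \<inter> B)) \<in> pieces_algebra \<rightarrow>\<^sub>M count_space UNIV"
      by (rule measurable_compose[OF measurable_component_singleton[OF UNIV_I]])
  qed
  also have "?this \<longleftrightarrow> (\<lambda>\<omega>. card (superpose \<omega> \<inter> B)) \<in> pieces_algebra \<rightarrow>\<^sub>M count_space UNIV"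
  proof (rule measurable_cong)
    fix \<omega> assume \<omega>: "\<omega> \<in> space pieces_algebra"
    show "(\<Sum>k<N. card (\<omega> k \<inter> B)) = card (superpose \<omega> \<inter> B)"
      unfolding superpose_Int[OF \<omega> N]
      using pieces_finite_disjoint[OF \<omega>] by (subst card_UN_disjoint) (simp_all, blast)
  qed
  finally show "(\<lambda>\<omega>. card (superpose \<omega> \<inter> B)) \<in> pieces_algebra \<rightarrow>\<^sub>M count_space UNIV" .
qed

definition poisson_pieces :: "real \<Rightarrow> (nat \<Rightarrow> 'a set) measure" where
  "poisson_pieces t = (\<Pi>\<^sub>M k\<in>UNIV. poisson_in t (piece k))"

definition poisson :: "real \<Rightarrow> 'a set measure" where
  "poisson t = distr (poisson_pieces t) borel_configurations superpose"

lemma sets_poisson_pieces: "sets (poisson_pieces t) = sets pieces_algebra"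
  unfolding poisson_pieces_def by (rule sets_PiM_cong) (auto simp: sets_poisson_in)

text \<open>It suffices to check cylinder sets, an intersection-stable generator, where the measure
  is a finite product of functions measurable in t.\<close>

lemma poisson_pieces_measurable: "poisson_pieces \<in> borel \<rightarrow>\<^sub>M prob_algebra pieces_algebra"
proof (rule measurable_prob_algebra_generated[OF sets_PiM Int_stable_prod_algebra prod_algebra_sets_into_space])
  fix t :: real
  show "prob_space (poisson_pieces t)"
    unfolding poisson_pieces_def by (rule prob_space_PiM) (rule prob_space_poisson_in[OF piece_rcb])
  show "sets (poisson_pieces t) = sets pieces_algebra" by (rule sets_poisson_pieces)
next
  fix A assume "A \<in> prod_algebra UNIV (\<lambda>k. borel_configurations_in (piece k))"
  then obtain J E where A: "A = prod_emb UNIV (\<lambda>k. borel_configurations_in (piece k)) J (\<Pi>\<^sub>E j\<in>J. E j)"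
    and J: "finite J" "\<And>i. i \<in> J \<Longrightarrow> E i \<in> sets (borel_configurations_in (piece i))"
    by (elim prod_algebraE) auto
  have "emeasure (poisson_pieces t) A = (\<Prod>j\<in>J. emeasure (poisson_in t (piece j)) (E j))" for t
  proof -
    have "space (poisson_in t (piece k)) = space (borel_configurations_in (piece k))" for k
      by (rule sets_eq_imp_space_eq[OF sets_poisson_in])
    then have "A = prod_emb UNIV (\<lambda>k. poisson_in t (piece k)) J (\<Pi>\<^sub>E j\<in>J. E j)"
      unfolding A prod_emb_def by simp
    then show ?thesis
      unfolding poisson_pieces_def
      using J by (simp add: emeasure_PiM_emb prob_space_poisson_in[OF piece_rcb] sets_poisson_in)
  qed
  then show "(\<lambda>t. emeasure (poisson_pieces t) A) \<in> borel_measurable borel"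
    using J(2) by (simp only:) (intro borel_measurable_prod_ennreal poisson_in_emeasure_measurable[OF piece_rcb])
qed

lemma poisson_measurable: "poisson \<in> borel \<rightarrow>\<^sub>M prob_algebra borel_configurations"
  unfolding poisson_def[abs_def]
  by (rule measurable_compose[OF poisson_pieces_measurable measurable_distr_prob_space[OF superpose_measurable]])

lemma measurable_exp_sum_Int:
  assumes \<Lambda>: "\<Lambda> \<in> relatively_compact_borel" and f: "f \<in> borel_measurable borel"
  shows "(\<lambda>\<gamma>. iexp (\<Sum>x\<in>\<gamma> \<inter> \<Lambda>. f x)) \<in> borel_measurable (borel_configurations :: 'a set measure)"
proof -
  have "(\<lambda>\<gamma>. \<Sum>x\<in>\<gamma> \<inter> \<Lambda>. f x) \<in> borel_measurable borel_configurations"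
    using measurable_sum_count_algebra[OF subset_refl \<Lambda> f]
    by (simp add: measurable_cong_sets[OF sets_borel_configurations refl])
  then show ?thesis by measurable
qed

text \<open>The components are independent, so the functional is a product over the pieces of
  exponentials, and their exponents add up to one integral over \<Lambda>.\<close>

lemma poisson_charfun:
  assumes \<Lambda>: "\<Lambda> \<in> relatively_compact_borel" and f: "f \<in> borel_measurable borel"
  shows "(\<integral>\<gamma>. iexp (\<Sum>x\<in>\<gamma> \<inter> \<Lambda>. f x) \<partial>poisson t) =
    exp (of_real \<bar>t\<bar> * (\<integral>x. indicator \<Lambda> x *\<^sub>R (iexp (f x) - 1) \<partial>\<mu>))"
proof -
  \<comment> \<open>With f cut off outside \<Lambda>, the sum over all points of a piece equals the
    sum over those in \<Lambda>.\<close>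
  define h where "h x = indicator \<Lambda> x * f x" for x
  have h: "h \<in> borel_measurable borel" unfolding h_def using f rcb_borel[OF \<Lambda>] by measurable
  define e where "e \<gamma> = iexp (\<Sum>x\<in>\<gamma>. h x)" for \<gamma>
  obtain N where N: "\<Lambda> \<subseteq> (\<Union>k<N. piece k)" using rcb_subset_pieces[OF \<Lambda>] .
  let ?P = "\<lambda>k. poisson_in t (piece k)"
  interpret P: product_prob_space ?P UNIV
    by (rule product_prob_spaceI) (rule prob_space_poisson_in[OF piece_rcb])
  have prob: "prob_space (?P k)" for k by (rule prob_space_poisson_in[OF piece_rcb])
  have e_meas: "e \<in> borel_measurable (?P k)" for k
  proof -
    have "(\<lambda>\<gamma>. \<Sum>x\<in>\<gamma>. h x) \<in> borel_measurable (?P k)"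
      using measurable_sum_configurations_in[OF piece_rcb h] by (simp add: measurable_cong_sets[OF sets_poisson_in refl])
    then show ?thesis unfolding e_def by measurable
  qed
  have e_int: "integrable (?P k) e" for k
    by (rule finite_measure.integrable_const_bound[OF prob_space.finite_measure[OF prob], where B=1])
      (use e_meas in \<open>auto simp: e_def\<close>)
  have sp: "space (poisson_pieces t) = space pieces_algebra" by (rule sets_eq_imp_space_eq[OF sets_poisson_pieces])
  have sup: "superpose \<in> poisson_pieces t \<rightarrow>\<^sub>M borel_configurations"
    using superpose_measurable by (simp add: measurable_cong_sets[OF sets_poisson_pieces refl])
  have "(\<integral>\<gamma>. iexp (\<Sum>x\<in>\<gamma> \<inter> \<Lambda>. f x) \<partial>poisson t) =
    (\<integral>\<omega>. iexp (\<Sum>x\<in>superpose \<omega> \<inter> \<Lambda>. f x) \<partial>poisson_pieces t)"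
    unfolding poisson_def by (rule integral_distr[OF sup measurable_exp_sum_Int[OF \<Lambda> f]])
  also have "\<dots> = (\<integral>\<omega>. (\<Prod>k<N. e (\<omega> k)) \<partial>poisson_pieces t)"
  proof (rule Bochner_Integration.integral_cong[OF refl])
    fix \<omega> assume "\<omega> \<in> space (poisson_pieces t)"
    then have \<omega>: "\<omega> \<in> space pieces_algebra" using sp by simp
    have fin: "finite (\<omega> k)" for k by (rule pieces_finite_disjoint(1)[OF \<omega>])
    have "(\<Sum>x\<in>superpose \<omega> \<inter> \<Lambda>. f x) = (\<Sum>k<N. \<Sum>x\<in>\<omega> k \<inter> \<Lambda>. f x)"
      unfolding superpose_Int[OF \<omega> N] using fin pieces_finite_disjoint(2)[OF \<omega>]
      by (intro sum.UNION_disjoint) auto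
    also have "\<dots> = (\<Sum>k<N. \<Sum>x\<in>\<omega> k. h x)"
      by (intro sum.cong refl sum.mono_neutral_cong_left fin) (auto simp: h_def)
    finally show "iexp (\<Sum>x\<in>superpose \<omega> \<inter> \<Lambda>. f x) = (\<Prod>k<N. e (\<omega> k))"
      unfolding e_def by (simp only: of_real_sum sum_distrib_left exp_sum finite_lessThan)
  qed
  \<comment> \<open>Only the first N coordinates enter, so the infinite product can be projected to
    a finite one, where integrals of products factorise.\<close>
  also have "\<dots> = (\<integral>\<omega>. (\<Prod>k<N. e (restrict \<omega> {..<N} k)) \<partial>poisson_pieces t)" by simp
  also have "\<dots> = (\<integral>\<omega>. (\<Prod>k<N. e (\<omega> k)) \<partial>distr (poisson_pieces t) (PiM {..<N} ?P) (\<lambda>\<omega>. restrict \<omega> {..<N}))"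
    unfolding poisson_pieces_def
  proof (rule integral_distr[symmetric])
    show "(\<lambda>\<omega>. restrict \<omega> {..<N}) \<in> PiM UNIV ?P \<rightarrow>\<^sub>M PiM {..<N} ?P"
      by (rule measurable_restrict_subset) simp
    show "(\<lambda>\<omega>. \<Prod>k<N. e (\<omega> k)) \<in> borel_measurable (PiM {..<N} ?P)"
    proof (rule borel_measurable_prod)
      fix k assume k: "k \<in> {..<N}"
      show "(\<lambda>\<omega>. e (\<omega> k)) \<in> borel_measurable (PiM {..<N} ?P)"
        using measurable_component_singleton[OF k, of ?P] e_meas[of k] by (rule measurable_compose)
    qed
  qed
  also have "\<dots> = (\<integral>\<omega>. (\<Prod>k<N. e (\<omega> k)) \<partial>PiM {..<N} ?P)"
    unfolding poisson_pieces_def by (subst P.distr_PiM_restrict_finite) auto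
  also have "\<dots> = (\<Prod>k<N. \<integral>\<gamma>. e \<gamma> \<partial>?P k)"
    by (rule P.product_integral_prod) (auto intro: e_int)
  also have "\<dots> = (\<Prod>k<N. exp (of_real \<bar>t\<bar> * (\<integral>x. indicator (piece k) x *\<^sub>R (iexp (h x) - 1) \<partial>\<mu>)))"
    unfolding e_def by (intro prod.cong refl poisson_in_charfun[OF piece_rcb h])
  also have "\<dots> = exp (of_real \<bar>t\<bar> * (\<Sum>k<N. \<integral>x. indicator (piece k) x *\<^sub>R (iexp (h x) - 1) \<partial>\<mu>))"
    by (simp only: sum_distrib_left exp_sum finite_lessThan)
  also have "(\<Sum>k<N. \<integral>x. indicator (piece k) x *\<^sub>R (iexp (h x) - 1) \<partial>\<mu>) =
    (\<integral>x. (\<Sum>k<N. indicator (piece k) x *\<^sub>R (iexp (h x) - 1)) \<partial>\<mu>)"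
    by (rule Bochner_Integration.integral_sum[symmetric]) (rule charfun_integrand_integrable(1)[OF piece_rcb h])
  also have "\<dots> = (\<integral>x. indicator \<Lambda> x *\<^sub>R (iexp (f x) - 1) \<partial>\<mu>)"
  proof (rule Bochner_Integration.integral_cong[OF refl])
    fix x
    show "(\<Sum>k<N. indicator (piece k) x *\<^sub>R (iexp (h x) - 1)) =
        indicator \<Lambda> x *\<^sub>R (iexp (f x) - 1)"
    proof (cases "x \<in> \<Lambda>")
      case True
      then obtain j where j: "j < N" "x \<in> piece j" using N by blast
      then have "indicator (piece k) x = (if k = j then 1 else 0 :: real)" for k
        using piece_disjoint[of k j] by (auto simp: indicator_def)
      then have "(\<Sum>k<N. indicator (piece k) x :: real) = 1" using j(1) by simp
      then show ?thesis using True by (simp add: scaleR_sum_left[symmetric] h_def)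
    next
      case False
      then show ?thesis by (simp add: h_def)
    qed
  qed
  finally show ?thesis .
qed

end

section \<open>The fractional Poisson measure\<close>

text \<open>The random variables are sums of f over \<gamma> \<inter> \<Lambda>, indexed by pairs of
  a set and a function. Admitting all Borel f makes them include the counts, which generate the
  sigma-algebra.\<close>

lemma measure_eqI_count_charfun:
  fixes M N :: "'a::t2_space set measure"
  assumes \<Omega>: "\<Omega> \<subseteq> configurations"
    and M: "prob_space M" "sets M = sets (count_algebra \<Omega>)"
    and N: "prob_space N" "sets N = sets (count_algebra \<Omega>)"
    and eq: "\<And>\<Lambda> f. \<Lambda> \<in> relatively_compact_borel \<Longrightarrow> f \<in> borel_measurable borel \<Longrightarrow>
      (\<integral>\<gamma>. iexp (\<Sum>x\<in>\<gamma> \<inter> \<Lambda>. f x) \<partial>M) = (\<integral>\<gamma>. iexp (\<Sum>x\<in>\<gamma> \<inter> \<Lambda>. f x) \<partial>N)"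
  shows "M = N"
proof -
  have space: "space M = \<Omega>"
    using sets_eq_imp_space_eq[OF M(2)] by simp
  let ?I = "relatively_compact_borel \<times> borel_measurable borel :: ('a set \<times> ('a \<Rightarrow> real)) set"
  let ?X = "\<lambda>(\<Lambda>, f) \<gamma>. \<Sum>x\<in>\<gamma> \<inter> \<Lambda>. f x :: real"
  show ?thesis
  proof (rule measure_eqI_charfun[where I="?I" and Z="?X"])
    show "prob_space M" "prob_space N" "sets M = sets N" using M N by simp_all
    let ?G = "{{\<gamma> \<in> space M. ?X i \<gamma> \<in> B} | i B. i \<in> ?I \<and> B \<in> sets borel}"
    \<comment> \<open>The count of B is the sum of the constant function 1 over B.\<close>
    have "{\<gamma> \<in> \<Omega>. card (\<gamma> \<inter> B) = k} \<in> ?G" if B: "B \<in> relatively_compact_borel" for B k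
      using B by (intro CollectI exI[of _ "(B, \<lambda>_. 1)"] exI[of _ "{real k}"]) (simp add: space)
    then have "{{\<gamma> \<in> \<Omega>. card (\<gamma> \<inter> B) = k} | B k. B \<in> relatively_compact_borel} \<subseteq> ?G"
      by (intro subsetI) (elim CollectE exE conjE, simp only:)
    then have "{{\<gamma> \<in> \<Omega>. card (\<gamma> \<inter> B) = k} | B k. B \<in> relatively_compact_borel} \<subseteq> sigma_sets \<Omega> ?G"
      using sigma_sets_superset_generator by (rule subset_trans)
    then show "sets M \<subseteq> sigma_sets (space M) ?G"
      unfolding M(2) sets_count_algebra space by (rule sigma_sets_mono)
    show "?X i \<in> borel_measurable M" if "i \<in> ?I" for i
      using that measurable_sum_count_algebra[OF \<Omega>]
      by (cases i) (simp add: measurable_cong_sets[OF M(2) refl])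
    have "({}, \<lambda>_. 0) \<in> ?I" by (simp add: relatively_compact_borel_def)
    then show "?I \<noteq> {}" by blast
    show "\<exists>k\<in>?I. \<forall>\<gamma>\<in>space M. ?X k \<gamma> = ?X i \<gamma> + ?X j \<gamma>" if ij: "i \<in> ?I" "j \<in> ?I" for i j
    proof -
      obtain \<Lambda> f \<Lambda>' g where i: "i = (\<Lambda>, f)" and j: "j = (\<Lambda>', g)" by (cases i, cases j) auto
      have \<Lambda>: "\<Lambda> \<in> relatively_compact_borel" "\<Lambda>' \<in> relatively_compact_borel"
        and [measurable]: "f \<in> borel_measurable borel" "g \<in> borel_measurable borel" using ij by (auto simp: i j)
      have [measurable]: "\<Lambda> \<in> sets borel" "\<Lambda>' \<in> sets borel" using \<Lambda> by (auto simp: relatively_compact_borel_def)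
      have un: "\<Lambda> \<union> \<Lambda>' \<in> relatively_compact_borel"
        using \<Lambda> by (auto simp: relatively_compact_borel_def intro: compact_Un)
      \<comment> \<open>On the union of the two sets each function must be cut off outside its own
        set, since f and g need not vanish there.\<close>
      let ?h = "\<lambda>x. indicator \<Lambda> x * f x + indicator \<Lambda>' x * g x"
      have "?X (\<Lambda> \<union> \<Lambda>', ?h) \<gamma> = ?X i \<gamma> + ?X j \<gamma>" if "\<gamma> \<in> space M" for \<gamma>
      proof -
        have fin: "finite (\<gamma> \<inter> (\<Lambda> \<union> \<Lambda>'))" using finite_configuration_Int[OF _ un] \<Omega> that space by auto
        have "(\<Sum>x\<in>\<gamma> \<inter> \<Lambda>. f x) = (\<Sum>x\<in>\<gamma> \<inter> (\<Lambda> \<union> \<Lambda>'). indicator \<Lambda> x * f x)"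
          by (rule sum.mono_neutral_cong_left[OF fin]) auto
        moreover have "(\<Sum>x\<in>\<gamma> \<inter> \<Lambda>'. g x) = (\<Sum>x\<in>\<gamma> \<inter> (\<Lambda> \<union> \<Lambda>'). indicator \<Lambda>' x * g x)"
          by (rule sum.mono_neutral_cong_left[OF fin]) auto
        ultimately show ?thesis by (simp add: i j sum.distrib)
      qed
      moreover have "?h \<in> borel_measurable borel" by measurable
      ultimately show ?thesis using un by (intro bexI[of _ "(\<Lambda> \<union> \<Lambda>', ?h)"]) auto
    qed
    show "\<exists>k\<in>?I. \<forall>\<gamma>\<in>space M. ?X k \<gamma> = c * ?X i \<gamma>" if "i \<in> ?I" for c i
      using that by (cases i) (intro bexI[of _ "(fst i, \<lambda>x. c * snd i x)"], auto simp: sum_distrib_left)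
    show "(\<integral>\<gamma>. iexp (?X i \<gamma>) \<partial>M) = (\<integral>\<gamma>. iexp (?X i \<gamma>) \<partial>N)" if "i \<in> ?I" for i
      using that eq by (cases i) simp
  qed
qed

locale fractional_poisson = intensity_measure b \<mu> + mix: mittag_leffler_mixing \<alpha> \<nu>
  for b :: "nat \<Rightarrow> 'a::{t2_space, second_countable_topology} set" and \<mu> :: "'a measure"
    and \<alpha> :: real and \<nu> :: "real measure"
begin

lemma mittag_leffler_0: "mittag_leffler \<alpha> 0 = 1"
  using mix.exp_integral_eq_mittag_leffler[of 0] mix.prob_space by simp

lemma fractional_poisson_in_eq:
  "fractional_poisson_in \<alpha> \<mu> \<Lambda> = mixed_configuration_measure (mix.weight (measure \<mu> \<Lambda>)) \<mu> \<Lambda>"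
  unfolding fractional_poisson_in_eq_mixed
  by (simp add: mix.fractional_poisson_weight_eq)

text \<open>The generating series of the weights, evaluated at z = m, is E_alpha(0) = 1.\<close>

lemma weights_sums_1: "(\<lambda>n. mix.weight (measure \<mu> \<Lambda>) n * measure \<mu> \<Lambda> ^ n) sums 1"
proof -
  have "(\<lambda>n. complex_of_real (mix.weight (measure \<mu> \<Lambda>) n * measure \<mu> \<Lambda> ^ n)) sums of_real 1"
    using mix.weight_sums[of "measure \<mu> \<Lambda>" "of_real (measure \<mu> \<Lambda>)"] by (simp add: mittag_leffler_0)
  then show ?thesis by (simp only: sums_of_real_iff)
qed

lemma prob_space_fractional_poisson_in:
  "\<Lambda> \<in> relatively_compact_borel \<Longrightarrow> prob_space (fractional_poisson_in \<alpha> \<mu> \<Lambda>)"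
  unfolding fractional_poisson_in_eq
  by (rule prob_space_mixed[OF _ mix.weight_nonneg weights_sums_1])

lemma sets_fractional_poisson_in: "sets (fractional_poisson_in \<alpha> \<mu> \<Lambda>) = sets (borel_configurations_in \<Lambda>)"
  unfolding fractional_poisson_in_eq by (rule sets_mixed)

lemma fractional_poisson_in_charfun:
  assumes \<Lambda>: "\<Lambda> \<in> relatively_compact_borel" and f: "f \<in> borel_measurable borel"
  shows "(\<integral>\<gamma>. iexp (\<Sum>x\<in>\<gamma>. f x) \<partial>fractional_poisson_in \<alpha> \<mu> \<Lambda>) =
    mittag_leffler \<alpha> (\<integral>x. indicator \<Lambda> x *\<^sub>R (iexp (f x) - 1) \<partial>\<mu>)"
proof -
  have "(\<integral>\<gamma>. iexp (\<Sum>x\<in>\<gamma>. f x) \<partial>fractional_poisson_in \<alpha> \<mu> \<Lambda>) =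
    (\<Sum>n. of_real (mix.weight (measure \<mu> \<Lambda>) n) *
      (\<integral>x. indicator \<Lambda> x *\<^sub>R iexp (f x) \<partial>\<mu>) ^ n)"
    unfolding fractional_poisson_in_eq by (rule mixed_charfun[OF \<Lambda> mix.weight_nonneg weights_sums_1 f])
  also have "\<dots> = mittag_leffler \<alpha> ((\<integral>x. indicator \<Lambda> x *\<^sub>R iexp (f x) \<partial>\<mu>) - of_real (measure \<mu> \<Lambda>))"
    by (rule sums_unique[symmetric, OF mix.weight_sums]) simp
  finally show ?thesis unfolding charfun_integral_diff[OF \<Lambda> f] .
qed

definition fractional_poisson_measure :: "'a set measure" where
  "fractional_poisson_measure = \<nu> \<bind> poisson"

lemma poisson_kernel: "poisson \<in> \<nu> \<rightarrow>\<^sub>M prob_algebra borel_configurations"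
  using poisson_measurable by (simp add: measurable_cong_sets[OF mix.events_eq_borel refl])

lemma prob_space_fractional_poisson_measure: "prob_space fractional_poisson_measure"
  unfolding fractional_poisson_measure_def
  using measurable_space[OF poisson_kernel]
  by (intro mix.prob_space_bind[OF AE_I2 measurable_prob_algebraD[OF poisson_kernel]])
    (auto simp: space_prob_algebra)

lemma sets_fractional_poisson_measure: "sets fractional_poisson_measure = sets borel_configurations"
  unfolding fractional_poisson_measure_def
  by (rule sets_bind[OF sets_kernel[OF measurable_prob_algebraD[OF poisson_kernel]] mix.not_empty])

lemma fractional_poisson_measure_charfun:
  assumes \<Lambda>: "\<Lambda> \<in> relatively_compact_borel" and f: "f \<in> borel_measurable borel"
  shows "(\<integral>\<gamma>. iexp (\<Sum>x\<in>\<gamma> \<inter> \<Lambda>. f x) \<partial>fractional_poisson_measure) =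
    mittag_leffler \<alpha> (\<integral>x. indicator \<Lambda> x *\<^sub>R (iexp (f x) - 1) \<partial>\<mu>)"
proof -
  let ?z = "\<integral>x. indicator \<Lambda> x *\<^sub>R (iexp (f x) - 1) \<partial>\<mu>"
  have "(\<integral>\<gamma>. iexp (\<Sum>x\<in>\<gamma> \<inter> \<Lambda>. f x) \<partial>fractional_poisson_measure) =
    (\<integral>\<tau>. (\<integral>\<gamma>. iexp (\<Sum>x\<in>\<gamma> \<inter> \<Lambda>. f x) \<partial>poisson \<tau>) \<partial>\<nu>)"
    unfolding fractional_poisson_measure_def
    by (rule integral_bind_complex[OF mix.prob_space_axioms poisson_kernel measurable_exp_sum_Int[OF \<Lambda> f]]) simp
  also have "\<dots> = (\<integral>\<tau>. exp (of_real \<bar>\<tau>\<bar> * ?z) \<partial>\<nu>)"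
    unfolding poisson_charfun[OF \<Lambda> f] ..
  \<comment> \<open>The absolute value built into the Poisson laws disappears because \<nu> is
    carried by the half-line.\<close>
  also have "\<dots> = (\<integral>\<tau>. exp (of_real \<tau> * ?z) \<partial>\<nu>)"
    by (rule integral_cong_AE) (use mix.\<nu>_nonneg in auto)
  finally show ?thesis unfolding mix.exp_integral_eq_mittag_leffler .
qed

lemma restrict_configuration_measurable:
  "\<Lambda> \<in> relatively_compact_borel \<Longrightarrow>
    restrict_configuration \<Lambda> \<in> (borel_configurations :: 'a set measure) \<rightarrow>\<^sub>M borel_configurations_in \<Lambda>"
  unfolding measurable_cong_sets[OF sets_borel_configurations sets_borel_configurations_in]
  by (rule measurable_restrict_count_algebra) (auto simp: configurations_in_def configurations_def Int_assoc intro: finite_subset[rotated])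

lemma restrict_configuration_measurable_in:
  assumes "\<Lambda>\<^sub>1 \<in> relatively_compact_borel" "\<Lambda>\<^sub>2 \<in> relatively_compact_borel"
  shows "restrict_configuration \<Lambda>\<^sub>1 \<in> (borel_configurations_in \<Lambda>\<^sub>2 :: 'a set measure) \<rightarrow>\<^sub>M borel_configurations_in \<Lambda>\<^sub>1"
  unfolding measurable_cong_sets[OF sets_borel_configurations_in[OF assms(2)] sets_borel_configurations_in[OF assms(1)]]
  by (rule measurable_restrict_count_algebra[OF assms(1)])
    (auto simp: configurations_in_def intro!: finite_imp_configuration finite_configuration_Int assms)

lemma projection_charfun:
  fixes \<Lambda> :: "'a set"
  assumes \<pi>: "sets \<pi> = sets borel_configurations" and \<Lambda>: "\<Lambda> \<in> relatively_compact_borel"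
    and f: "f \<in> borel_measurable borel"
  shows "(\<integral>\<gamma>. iexp (\<Sum>x\<in>\<gamma>. f x) \<partial>distr \<pi> (borel_configurations_in \<Lambda>) (restrict_configuration \<Lambda>)) =
    (\<integral>\<gamma>. iexp (\<Sum>x\<in>\<gamma> \<inter> \<Lambda>. f x) \<partial>\<pi>)"
proof -
  have "restrict_configuration \<Lambda> \<in> \<pi> \<rightarrow>\<^sub>M borel_configurations_in \<Lambda>"
    using restrict_configuration_measurable[OF \<Lambda>] by (simp add: measurable_cong_sets[OF \<pi> refl])
  moreover have "(\<lambda>\<gamma>. iexp (\<Sum>x\<in>\<gamma>. f x)) \<in> borel_measurable (borel_configurations_in \<Lambda>)"
    using measurable_sum_configurations_in[OF \<Lambda> f] by measurable
  ultimately show ?thesis by (subst integral_distr) (simp_all add: restrict_configuration_def)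
qed

text \<open>The series of n-point measures and the projected mixture have the same characteristic
  functional, the one computed from the expansion of E_alpha about -\<mu>(\<Lambda>), the other by
  integrating over \<tau>.\<close>

lemma fractional_poisson_projection:
  assumes \<Lambda>: "\<Lambda> \<in> relatively_compact_borel"
  shows "fractional_poisson_in \<alpha> \<mu> \<Lambda> =
    distr fractional_poisson_measure (borel_configurations_in \<Lambda>) (restrict_configuration \<Lambda>)" (is "?F = ?D")
proof (rule measure_eqI_count_charfun[where \<Omega>="configurations_in \<Lambda>"])
  interpret \<pi>: prob_space fractional_poisson_measure by (rule prob_space_fractional_poisson_measure)
  show "configurations_in \<Lambda> \<subseteq> configurations" by (auto simp: configurations_in_def)
  show "prob_space ?F" by (rule prob_space_fractional_poisson_in[OF \<Lambda>])
  have "restrict_configuration \<Lambda> \<in> fractional_poisson_measure \<rightarrow>\<^sub>M borel_configurations_in \<Lambda>"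
    using restrict_configuration_measurable[OF \<Lambda>] by (simp add: measurable_cong_sets[OF sets_fractional_poisson_measure refl])
  then show "prob_space ?D" by (rule \<pi>.prob_space_distr)
  show sets: "sets ?F = sets (count_algebra (configurations_in \<Lambda>))" "sets ?D = sets (count_algebra (configurations_in \<Lambda>))"
    by (simp_all add: sets_fractional_poisson_in sets_borel_configurations_in[OF \<Lambda>])
  have space: "space ?F = configurations_in \<Lambda>" "space ?D = configurations_in \<Lambda>"
    using sets_eq_imp_space_eq[OF sets(1)] sets_eq_imp_space_eq[OF sets(2)] by simp_all
  fix \<Lambda>' :: "'a set" and f :: "'a \<Rightarrow> real"
  assume \<Lambda>': "\<Lambda>' \<in> relatively_compact_borel" and f: "f \<in> borel_measurable borel"
  \<comment> \<open>Both functionals are known for sums over all of \<gamma>, so the second set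
    \<Lambda>' is absorbed into the function.\<close>
  define h where "h x = indicator \<Lambda>' x * f x" for x
  have h: "h \<in> borel_measurable borel" unfolding h_def using f rcb_borel[OF \<Lambda>'] by measurable
  have eq: "(\<Sum>x\<in>\<gamma> \<inter> \<Lambda>'. f x) = (\<Sum>x\<in>\<gamma>. h x)" if "\<gamma> \<in> configurations_in \<Lambda>" for \<gamma>
    by (rule sum.mono_neutral_cong_left[OF configurations_in_finite[OF \<Lambda> that]]) (auto simp: h_def)
  have "(\<integral>\<gamma>. iexp (\<Sum>x\<in>\<gamma> \<inter> \<Lambda>'. f x) \<partial>?F) = (\<integral>\<gamma>. iexp (\<Sum>x\<in>\<gamma>. h x) \<partial>?F)"
    by (rule Bochner_Integration.integral_cong[OF refl]) (simp only: space eq)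
  also have "\<dots> = (\<integral>\<gamma>. iexp (\<Sum>x\<in>\<gamma>. h x) \<partial>?D)"
    unfolding fractional_poisson_in_charfun[OF \<Lambda> h] projection_charfun[OF sets_fractional_poisson_measure \<Lambda> h]
      fractional_poisson_measure_charfun[OF \<Lambda> h] ..
  also have "\<dots> = (\<integral>\<gamma>. iexp (\<Sum>x\<in>\<gamma> \<inter> \<Lambda>'. f x) \<partial>?D)"
    by (rule Bochner_Integration.integral_cong[OF refl]) (simp only: space eq)
  finally show "(\<integral>\<gamma>. iexp (\<Sum>x\<in>\<gamma> \<inter> \<Lambda>'. f x) \<partial>?F) = (\<integral>\<gamma>. iexp (\<Sum>x\<in>\<gamma> \<inter> \<Lambda>'. f x) \<partial>?D)" .
qed

lemma has_projections_fractional_poisson_measure: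
  "has_projections (fractional_poisson_in \<alpha> \<mu>) fractional_poisson_measure"
  unfolding has_projections_def
  using sets_fractional_poisson_measure restrict_configuration_measurable fractional_poisson_projection by blast

lemma has_projections_unique:
  assumes "has_projections (fractional_poisson_in \<alpha> \<mu>) \<pi>"
  shows "\<pi> = fractional_poisson_measure"
proof -
  have sets: "sets \<pi> = sets borel_configurations"
    and proj: "\<And>\<Lambda>. \<Lambda> \<in> relatively_compact_borel \<Longrightarrow>
      fractional_poisson_in \<alpha> \<mu> \<Lambda> = distr \<pi> (borel_configurations_in \<Lambda>) (restrict_configuration \<Lambda>)"
    using assms unfolding has_projections_def by auto
  show ?thesis
  proof (rule measure_eqI_count_charfun[OF subset_refl])
    \<comment> \<open>\<open>has_projections\<close> does not assert that the measure has mass 1.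
      The projection to the empty set preserves total mass and has a probability measure as its
      image.\<close>
    have e: "({} :: 'a set) \<in> relatively_compact_borel" by (simp add: relatively_compact_borel_def)
    have "restrict_configuration {} \<in> \<pi> \<rightarrow>\<^sub>M borel_configurations_in {}"
      using restrict_configuration_measurable[OF e] by (simp add: measurable_cong_sets[OF sets refl])
    then show "prob_space \<pi>"
      using prob_space_distrD prob_space_fractional_poisson_in[OF e] unfolding proj[OF e] by blast
    show "prob_space fractional_poisson_measure" by (rule prob_space_fractional_poisson_measure)
    show "sets \<pi> = sets (count_algebra configurations)"
      "sets fractional_poisson_measure = sets (count_algebra configurations)"
      by (simp_all add: sets sets_fractional_poisson_measure sets_borel_configurations)
    fix \<Lambda> :: "'a set" and f :: "'a \<Rightarrow> real"
    assume \<Lambda>: "\<Lambda> \<in> relatively_compact_borel" and f: "f \<in> borel_measurable borel"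
    have "(\<integral>\<gamma>. iexp (\<Sum>x\<in>\<gamma> \<inter> \<Lambda>. f x) \<partial>\<pi>) =
      (\<integral>\<gamma>. iexp (\<Sum>x\<in>\<gamma>. f x) \<partial>fractional_poisson_in \<alpha> \<mu> \<Lambda>)"
      unfolding proj[OF \<Lambda>] by (rule projection_charfun[OF sets \<Lambda> f, symmetric])
    then show "(\<integral>\<gamma>. iexp (\<Sum>x\<in>\<gamma> \<inter> \<Lambda>. f x) \<partial>\<pi>) =
        (\<integral>\<gamma>. iexp (\<Sum>x\<in>\<gamma> \<inter> \<Lambda>. f x) \<partial>fractional_poisson_measure)"
      unfolding fractional_poisson_in_charfun[OF \<Lambda> f] fractional_poisson_measure_charfun[OF \<Lambda> f] .
  qed
qed

text \<open>Both sides are projections of the measure on all configurations, and restricting to the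
  larger set first changes nothing.\<close>

lemma fractional_poisson_consistent:
  assumes \<Lambda>1: "\<Lambda>\<^sub>1 \<in> relatively_compact_borel" and \<Lambda>2: "\<Lambda>\<^sub>2 \<in> relatively_compact_borel" and sub: "\<Lambda>\<^sub>1 \<subseteq> \<Lambda>\<^sub>2"
  shows "fractional_poisson_in \<alpha> \<mu> \<Lambda>\<^sub>1 = distr (fractional_poisson_in \<alpha> \<mu> \<Lambda>\<^sub>2)
     (borel_configurations_in \<Lambda>\<^sub>1) (restrict_configuration \<Lambda>\<^sub>1)"
proof -
  have "restrict_configuration \<Lambda>\<^sub>2 \<in> fractional_poisson_measure \<rightarrow>\<^sub>M borel_configurations_in \<Lambda>\<^sub>2"
    using restrict_configuration_measurable[OF \<Lambda>2] by (simp add: measurable_cong_sets[OF sets_fractional_poisson_measure refl])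
  moreover have "restrict_configuration \<Lambda>\<^sub>1 \<circ> restrict_configuration \<Lambda>\<^sub>2 = restrict_configuration \<Lambda>\<^sub>1"
    using sub by (auto simp: restrict_configuration_def fun_eq_iff)
  ultimately show ?thesis
    unfolding fractional_poisson_projection[OF \<Lambda>1] fractional_poisson_projection[OF \<Lambda>2]
    by (subst distr_distr[OF restrict_configuration_measurable_in[OF \<Lambda>1 \<Lambda>2]]) simp_all
qed

lemma fractional_poisson_measure_pairing_charfun:
  assumes \<phi>: "continuous_on UNIV \<phi>" "compact (closure {x. \<phi> x \<noteq> 0})"
  shows "(\<integral>\<gamma>. iexp (pairing \<gamma> \<phi>) \<partial>fractional_poisson_measure) =
    mittag_leffler \<alpha> (\<integral>x. (iexp (\<phi> x) - 1) \<partial>\<mu>)"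
proof -
  define K where "K = closure {x. \<phi> x \<noteq> 0}"
  have K: "K \<in> relatively_compact_borel" "\<And>x. x \<notin> K \<Longrightarrow> \<phi> x = 0"
    using \<phi>(2) closure_subset[of "{x. \<phi> x \<noteq> 0}"] unfolding K_def by auto
  have m: "\<phi> \<in> borel_measurable borel" by (rule borel_measurable_continuous_onI[OF \<phi>(1)])
  have space: "space fractional_poisson_measure = configurations"
    using sets_eq_imp_space_eq[OF sets_fractional_poisson_measure] space_borel_configurations by simp
  have "(\<integral>\<gamma>. iexp (pairing \<gamma> \<phi>) \<partial>fractional_poisson_measure) =
    (\<integral>\<gamma>. iexp (\<Sum>x\<in>\<gamma> \<inter> K. \<phi> x) \<partial>fractional_poisson_measure)"
  proof (rule Bochner_Integration.integral_cong[OF refl])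
    fix \<gamma> assume "\<gamma> \<in> space fractional_poisson_measure"
    then have "pairing \<gamma> \<phi> = (\<Sum>x\<in>\<gamma> \<inter> K. \<phi> x)" unfolding space by (rule pairing_eq_sum_Int[OF _ K])
    then show "iexp (pairing \<gamma> \<phi>) = iexp (\<Sum>x\<in>\<gamma> \<inter> K. \<phi> x)"
      by (rule arg_cong)
  qed
  also have "\<dots> = mittag_leffler \<alpha> (\<integral>x. indicator K x *\<^sub>R (iexp (\<phi> x) - 1) \<partial>\<mu>)"
    by (rule fractional_poisson_measure_charfun[OF K(1) m])
  also have "(\<lambda>x. indicator K x *\<^sub>R (iexp (\<phi> x) - 1)) = (\<lambda>x. iexp (\<phi> x) - 1)"
    using K(2) by (auto simp: fun_eq_iff indicator_def)
  finally show ?thesis .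
qed

end

section \<open>Generalized functions\<close>

lemma is_chartD:
  assumes "is_chart c"
  shows "open (fst c)" "open (snd c ` fst c)" "continuous_on (fst c) (snd c)"
    "continuous_on (snd c ` fst c) (chart_inv c)" "\<And>x. x \<in> fst c \<Longrightarrow> chart_inv c (snd c x) = x"
    "chart_inv c ` snd c ` fst c = fst c"
  using assms by (auto simp: is_chart_def homeomorphism_def)

text \<open>A closed ball inside a chart image pulls back to a compact neighbourhood.\<close>

lemma smooth_atlas_locally_compact:
  fixes A :: "('a::{t2_space, second_countable_topology}, 'n::finite) chart set"
  assumes A: "smooth_atlas A"
  shows "locally_compact_space (euclidean :: 'a topology)"
  unfolding locally_compact_space_def
proof
  fix x :: 'a
  have "x \<in> (\<Union>c\<in>A. fst c)" using A by (simp add: smooth_atlas_def)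
  then obtain c where c: "c \<in> A" "x \<in> fst c" by blast
  then have ch: "is_chart c" using A by (auto simp: smooth_atlas_def)
  note c' = is_chartD[OF ch]
  have "snd c x \<in> snd c ` fst c" using c(2) by blast
  then obtain e where e: "e > 0" "cball (snd c x) e \<subseteq> snd c ` fst c"
    using c'(2) open_contains_cball by metis
  let ?K = "chart_inv c ` cball (snd c x) e"
  let ?U = "fst c \<inter> snd c -` ball (snd c x) e"
  have "compact ?K"
    by (intro compact_continuous_image continuous_on_subset[OF c'(4)] e) simp
  moreover have "open ?U" by (rule continuous_open_preimage[OF c'(3,1)]) simp
  moreover have "?U \<subseteq> ?K"
  proof
    fix y assume y: "y \<in> ?U"
    then have "y = chart_inv c (snd c y)" "snd c y \<in> cball (snd c x) e" using c'(5) by auto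
    then show "y \<in> ?K" by (rule image_eqI)
  qed
  moreover have "x \<in> ?U" using c(2) e(1) by simp
  ultimately show "\<exists>U K. openin euclidean U \<and> compactin euclidean K \<and> x \<in> U \<and> U \<subseteq> K"
    by (intro exI[of _ ?U] exI[of _ ?K]) simp
qed

text \<open>On an open set the derivative at a point depends only on values in the set, so agreement
  on S passes to all iterated derivatives.\<close>

lemma Ck_on_cong:
  assumes S: "open S" and eq: "\<And>x. x \<in> S \<Longrightarrow> f x = g x"
  shows "Ck_on k S f \<Longrightarrow> Ck_on k S g"
  using eq
proof (induction k arbitrary: f g)
  case 0
  then show ?case by (auto simp: continuous_on_cong[OF refl, of S f g])
next
  case (Suc k)
  have deriv: "(g has_derivative frechet_derivative f (at x)) (at x)" if x: "x \<in> S" for x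
  proof (rule has_derivative_transform_within_open[OF _ S x])
    show "(f has_derivative frechet_derivative f (at x)) (at x)"
      using Suc.prems(1) x by (simp add: frechet_derivative_works[symmetric])
  qed (use Suc.prems(2) in auto)
  have "g differentiable at x" if "x \<in> S" for x using deriv[OF that] by (rule differentiableI)
  moreover have "Ck_on k S (\<lambda>x. frechet_derivative g (at x) v)" for v
  proof (rule Suc.IH)
    show "Ck_on k S (\<lambda>x. frechet_derivative f (at x) v)" using Suc.prems(1) by simp
    show "frechet_derivative f (at x) v = frechet_derivative g (at x) v" if "x \<in> S" for x
      using frechet_derivative_at[OF deriv[OF that]] by simp
  qed
  ultimately show ?case by simp
qed

text \<open>Additivity of \<open>frechet_derivative\<close> is available where both functions are
  differentiable, that is on S; \<open>Ck_on_cong\<close> makes agreement there sufficient for the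
  induction.\<close>

lemma Ck_on_add:
  assumes S: "open S"
  shows "Ck_on k S f \<Longrightarrow> Ck_on k S g \<Longrightarrow> Ck_on k S (\<lambda>x. f x + g x)"
proof (induction k arbitrary: f g)
  case 0
  then show ?case by (simp add: continuous_on_add)
next
  case (Suc k)
  have "Ck_on k S (\<lambda>x. frechet_derivative (\<lambda>x. f x + g x) (at x) v)" for v
  proof (rule Ck_on_cong[OF S])
    show "Ck_on k S (\<lambda>x. frechet_derivative f (at x) v + frechet_derivative g (at x) v)"
      using Suc by simp
    show "frechet_derivative f (at x) v + frechet_derivative g (at x) v = frechet_derivative (\<lambda>x. f x + g x) (at x) v"
      if "x \<in> S" for x
    proof -
      have "(f has_derivative frechet_derivative f (at x)) (at x)" "(g has_derivative frechet_derivative g (at x)) (at x)"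
        using Suc.prems that by (simp_all add: frechet_derivative_works[symmetric])
      from frechet_derivative_at[OF has_derivative_add[OF this]] show ?thesis by metis
    qed
  qed
  then show ?case using Suc.prems by (simp add: differentiable_add)
qed

lemma Ck_on_scale:
  fixes f :: "'e::real_normed_vector \<Rightarrow> real"
  assumes S: "open S"
  shows "Ck_on k S f \<Longrightarrow> Ck_on k S (\<lambda>x. c * f x)"
proof (induction k arbitrary: f)
  case 0
  then show ?case by (simp add: continuous_on_mult_left)
next
  case (Suc k)
  have deriv: "((\<lambda>x. c * f x) has_derivative (\<lambda>v. c * frechet_derivative f (at x) v)) (at x)" if x: "x \<in> S" for x
  proof -
    have "(f has_derivative frechet_derivative f (at x)) (at x)"
      using Suc.prems x by (simp add: frechet_derivative_works[symmetric])
    then show ?thesis by (rule has_derivative_mult_right)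
  qed
  have "Ck_on k S (\<lambda>x. frechet_derivative (\<lambda>x. c * f x) (at x) v)" for v
  proof (rule Ck_on_cong[OF S])
    show "Ck_on k S (\<lambda>x. c * frechet_derivative f (at x) v)" using Suc by simp
    show "c * frechet_derivative f (at x) v = frechet_derivative (\<lambda>x. c * f x) (at x) v" if "x \<in> S" for x
      using frechet_derivative_at[OF deriv[OF that]] by metis
  qed
  moreover have "(\<lambda>x. c * f x) differentiable at x" if "x \<in> S" for x
    using deriv[OF that] by (rule differentiableI)
  ultimately show ?case by simp
qed

lemma Ck_on_zero: "Ck_on k S (\<lambda>x. 0)"
  by (induction k) simp_all

locale test_function_space =
  fixes A :: "('a::{t2_space, second_countable_topology}, 'n::finite) chart set"
  assumes A: "smooth_atlas A"
begin

lemma chart: "c \<in> A \<Longrightarrow> is_chart c"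
  using A by (simp add: smooth_atlas_def)

lemma compact_support_subset:
  fixes f :: "'a \<Rightarrow> real"
  assumes "compact K" "{x. f x \<noteq> 0} \<subseteq> K"
  shows "compact (closure {x. f x \<noteq> 0})"
proof -
  have "closure {x. f x \<noteq> 0} \<subseteq> K"
    using assms by (intro closure_minimal compact_imp_closed)
  then show ?thesis using assms(1) by (metis closed_closure compact_Int_closed inf.absorb_iff2)
qed

lemma test_functionD:
  assumes "\<phi> \<in> test_functions A"
  shows "continuous_on UNIV \<phi>" "compact (closure {x. \<phi> x \<noteq> 0})"
proof -
  have "continuous_on (fst c) \<phi>" if c: "c \<in> A" for c
  proof -
    note c' = is_chartD[OF chart[OF c]]
    have "smooth_on (snd c ` fst c) (\<phi> \<circ> chart_inv c)" using assms c by (simp add: test_functions_def)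
    then have "Ck_on 0 (snd c ` fst c) (\<phi> \<circ> chart_inv c)" unfolding smooth_on_def by blast
    then have "continuous_on (snd c ` fst c) (\<phi> \<circ> chart_inv c)" by simp
    then have "continuous_on (fst c) ((\<phi> \<circ> chart_inv c) \<circ> snd c)" by (rule continuous_on_compose[OF c'(3)])
    then show ?thesis by (rule continuous_on_eq) (simp add: c'(5))
  qed
  then have "continuous_on (\<Union>c\<in>A. fst c) \<phi>"
    using is_chartD(1)[OF chart] by (intro continuous_on_open_UN) auto
  then show "continuous_on UNIV \<phi>" using A by (simp add: smooth_atlas_def)
  show "compact (closure {x. \<phi> x \<noteq> 0})" using assms by (simp add: test_functions_def)
qed

lemma test_functions_add:
  assumes "\<phi> \<in> test_functions A" "\<psi> \<in> test_functions A"
  shows "(\<lambda>x. \<phi> x + \<psi> x) \<in> test_functions A"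
proof -
  have "compact (closure {x. \<phi> x + \<psi> x \<noteq> 0})"
  proof (rule compact_support_subset)
    show "compact (closure {x. \<phi> x \<noteq> 0} \<union> closure {x. \<psi> x \<noteq> 0})"
      using test_functionD(2) assms by (intro compact_Un)
    show "{x. \<phi> x + \<psi> x \<noteq> 0} \<subseteq> closure {x. \<phi> x \<noteq> 0} \<union> closure {x. \<psi> x \<noteq> 0}"
      by (rule order_trans[OF _ Un_mono[OF closure_subset closure_subset]]) auto
  qed
  moreover have "smooth_on (snd c ` fst c) ((\<lambda>x. \<phi> x + \<psi> x) \<circ> chart_inv c)" if c: "c \<in> A" for c
    unfolding smooth_on_def comp_def
    using assms c is_chartD(2)[OF chart[OF c]]
    by (intro allI Ck_on_add) (auto simp: test_functions_def smooth_on_def comp_def)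
  ultimately show ?thesis by (simp add: test_functions_def)
qed

lemma test_functions_scale:
  assumes "\<phi> \<in> test_functions A"
  shows "(\<lambda>x. a * \<phi> x) \<in> test_functions A"
proof -
  have "compact (closure {x. a * \<phi> x \<noteq> 0})"
    by (rule compact_support_subset[OF test_functionD(2)[OF assms]])
      (use closure_subset[of "{x. \<phi> x \<noteq> 0}"] in auto)
  moreover have "smooth_on (snd c ` fst c) ((\<lambda>x. a * \<phi> x) \<circ> chart_inv c)" if c: "c \<in> A" for c
    unfolding smooth_on_def comp_def
    using assms c is_chartD(2)[OF chart[OF c]]
    by (intro allI Ck_on_scale) (auto simp: test_functions_def smooth_on_def comp_def)
  ultimately show ?thesis by (simp add: test_functions_def)
qed

lemma test_functions_zero: "(\<lambda>x. 0) \<in> test_functions A"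
  by (simp add: test_functions_def smooth_on_def comp_def Ck_on_zero)

lemma cylinder_sets_subset: "cylinder_sets A \<subseteq> Pow (generalized_functions A)"
  by (auto simp: cylinder_sets_def)

lemma space_cylinder_algebra: "space (cylinder_algebra A) = generalized_functions A"
  unfolding cylinder_algebra_def using cylinder_sets_subset by (rule space_measure_of)

lemma sets_cylinder_algebra: "sets (cylinder_algebra A) = sigma_sets (generalized_functions A) (cylinder_sets A)"
  unfolding cylinder_algebra_def using cylinder_sets_subset by (rule sets_measure_of)

lemma measurable_evaluation:
  assumes "\<phi> \<in> test_functions A"
  shows "(\<lambda>u. u \<phi>) \<in> borel_measurable (cylinder_algebra A)"
proof (rule measurableI)
  fix B :: "real set" assume B: "B \<in> sets borel"
  let ?B = "{x \<in> space (\<Pi>\<^sub>M i\<in>{..<1::nat}. (borel :: real measure)). x 0 \<in> B}"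
  have "?B \<in> sets (\<Pi>\<^sub>M i\<in>{..<1::nat}. (borel :: real measure))"
    using B by (intro sets_Collect_single) auto
  moreover have "{u \<in> generalized_functions A. u \<phi> \<in> B} =
    {u \<in> generalized_functions A. (\<lambda>i\<in>{..<1::nat}. u \<phi>) \<in> ?B}"
    by (auto simp: space_PiM)
  ultimately have "{u \<in> generalized_functions A. u \<phi> \<in> B} \<in> cylinder_sets A"
    unfolding cylinder_sets_def using assms
    by (intro CollectI exI[of _ "1::nat"] exI[of _ "\<lambda>_. \<phi>"] exI[of _ ?B]) auto
  then have "{u \<in> generalized_functions A. u \<phi> \<in> B} \<in> sets (cylinder_algebra A)"
    unfolding sets_cylinder_algebra by (rule sigma_sets.Basic)
  moreover have "(\<lambda>u. u \<phi>) -` B \<inter> space (cylinder_algebra A) = {u \<in> generalized_functions A. u \<phi> \<in> B}"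
    unfolding space_cylinder_algebra by auto
  ultimately show "(\<lambda>u. u \<phi>) -` B \<inter> space (cylinder_algebra A) \<in> sets (cylinder_algebra A)" by simp
qed auto

text \<open>The evaluations at test functions form a vector space of random variables, because
  generalized functions are linear, and they generate the cylinder sets.\<close>

lemma characteristic_functional_unique:
  assumes P: "has_characteristic_functional A P C" and Q: "has_characteristic_functional A Q C"
  shows "P = Q"
proof -
  have P': "prob_space P" "sets P = sets (cylinder_algebra A)"
      "\<And>\<phi>. \<phi> \<in> test_functions A \<Longrightarrow> (\<integral>u. iexp (u \<phi>) \<partial>P) = C \<phi>"
    and Q': "prob_space Q" "sets Q = sets (cylinder_algebra A)"
      "\<And>\<phi>. \<phi> \<in> test_functions A \<Longrightarrow> (\<integral>u. iexp (u \<phi>) \<partial>Q) = C \<phi>"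
    using P Q by (auto simp: has_characteristic_functional_def)
  have space: "space P = generalized_functions A" "space Q = generalized_functions A"
    using sets_eq_imp_space_eq[OF P'(2)] sets_eq_imp_space_eq[OF Q'(2)] by (simp_all add: space_cylinder_algebra)
  have lin: "u (\<lambda>x. \<phi> x + \<psi> x) = u \<phi> + u \<psi>" "u (\<lambda>x. a * \<phi> x) = a * u \<phi>"
    if "u \<in> generalized_functions A" "\<phi> \<in> test_functions A" "\<psi> \<in> test_functions A" for u \<phi> \<psi> a
    using that by (auto simp: generalized_functions_def)
  show ?thesis
  proof (rule measure_eqI_charfun[where I="test_functions A" and Z="\<lambda>\<phi> u. u \<phi>"])
    show "prob_space P" "prob_space Q" "sets P = sets Q" using P' Q' by simp_all
    let ?G = "{{u \<in> space P. u \<phi> \<in> B} | \<phi> B. \<phi> \<in> test_functions A \<and> B \<in> sets borel}"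
    have G_pow: "?G \<subseteq> Pow (generalized_functions A)" by (auto simp: space)
    define S where "S = sigma (generalized_functions A) ?G"
    have S: "space S = generalized_functions A" "sets S = sigma_sets (generalized_functions A) ?G"
      unfolding S_def using G_pow by (rule space_measure_of, rule sets_measure_of)
    have eval: "(\<lambda>u. u \<phi>) \<in> borel_measurable S" if \<phi>: "\<phi> \<in> test_functions A" for \<phi>
    proof (rule measurableI)
      fix B :: "real set" assume B: "B \<in> sets borel"
      have "{u \<in> space P. u \<phi> \<in> B} \<in> ?G" using B \<phi> by (intro CollectI exI[of _ \<phi>] exI[of _ B]) simp
      moreover have "(\<lambda>u. u \<phi>) -` B \<inter> space S = {u \<in> space P. u \<phi> \<in> B}" using S space by auto
      ultimately show "(\<lambda>u. u \<phi>) -` B \<inter> space S \<in> sets S" unfolding S(2) by (simp only: sigma_sets.Basic)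
    qed auto
    have "C \<in> sets S" if "C \<in> cylinder_sets A" for C
    proof -
      obtain k \<phi> B where C: "C = {u \<in> generalized_functions A. (\<lambda>i\<in>{..<k}. u (\<phi> i)) \<in> B}"
        "\<And>i. i < k \<Longrightarrow> \<phi> i \<in> test_functions A" "B \<in> sets (\<Pi>\<^sub>M i\<in>{..<k::nat}. (borel :: real measure))"
        using \<open>C \<in> cylinder_sets A\<close> unfolding cylinder_sets_def by blast
      have "(\<lambda>u. \<lambda>i\<in>{..<k}. u (\<phi> i)) \<in> S \<rightarrow>\<^sub>M (\<Pi>\<^sub>M i\<in>{..<k}. borel)"
        by (rule measurable_restrict) (use C(2) eval in auto)
      from measurable_sets[OF this C(3)] show ?thesis unfolding C(1) S(1)[symmetric]
        by (simp only: vimage_def Int_def conj_commute mem_Collect_eq)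
    qed
    then have "cylinder_sets A \<subseteq> sigma_sets (generalized_functions A) ?G" using S(2) by auto
    then show "sets P \<subseteq> sigma_sets (space P) ?G"
      unfolding P'(2) sets_cylinder_algebra space by (rule sigma_sets_mono)
    show "(\<lambda>u. u \<phi>) \<in> borel_measurable P" if "\<phi> \<in> test_functions A" for \<phi>
      using measurable_evaluation[OF that] by (simp add: measurable_cong_sets[OF P'(2) refl])
    show "test_functions A \<noteq> {}" using test_functions_zero by blast
    show "\<exists>\<eta>\<in>test_functions A. \<forall>u\<in>space P. u \<eta> = u \<phi> + u \<psi>"
      if "\<phi> \<in> test_functions A" "\<psi> \<in> test_functions A" for \<phi> \<psi>
      using test_functions_add[OF that] lin(1)[OF _ that] by (auto simp: space)
    show "\<exists>\<eta>\<in>test_functions A. \<forall>u\<in>space P. u \<eta> = c * u \<phi>" if "\<phi> \<in> test_functions A" for c \<phi>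
      using test_functions_scale[OF that] lin(2)[OF _ that that] by (auto simp: space)
    show "(\<integral>u. iexp (u \<phi>) \<partial>P) = (\<integral>u. iexp (u \<phi>) \<partial>Q)" if "\<phi> \<in> test_functions A" for \<phi>
      unfolding P'(3)[OF that] Q'(3)[OF that] ..
  qed
qed

text \<open>The seminorm balls form a subbasis, so local openness is tested with finite
  intersections. The family is required to be non-empty because the empty intersection is the whole
  type rather than \<open>W\<close>.\<close>

lemma openin_seminorm_topologyI:
  assumes "G \<subseteq> W" and loc: "\<And>\<phi>. \<phi> \<in> G \<Longrightarrow> \<exists>F. finite F \<and> F \<noteq> {} \<and>
      F \<subseteq> {{\<psi> \<in> W. p (\<lambda>x. \<psi> x - \<phi> x) < e} | p \<phi> e. p \<in> Q \<and> \<phi> \<in> W \<and> e > 0} \<and> \<phi> \<in> \<Inter>F \<and> \<Inter>F \<subseteq> G"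
  shows "openin (seminorm_topology W Q) G"
proof (subst openin_subopen, intro ballI)
  fix \<phi> assume "\<phi> \<in> G"
  from loc[OF this] show "\<exists>T. openin (seminorm_topology W Q) T \<and> \<phi> \<in> T \<and> T \<subseteq> G"
  proof (elim exE conjE)
    fix F
    assume F: "finite F" "F \<noteq> {}" "\<phi> \<in> \<Inter>F" "\<Inter>F \<subseteq> G"
      and sub: "F \<subseteq> {{\<psi> \<in> W. p (\<lambda>x. \<psi> x - \<phi> x) < e} | p \<phi> e. p \<in> Q \<and> \<phi> \<in> W \<and> e > 0}"
    have "openin (seminorm_topology W Q) (\<Inter>F)"
    proof (rule openin_Inter[OF F(1,2)])
      fix X assume "X \<in> F"
      then show "openin (seminorm_topology W Q) X"
        unfolding seminorm_topology_def by (intro topology_generated_by_Basis subsetD[OF sub])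
    qed
    then show ?thesis using F(3,4) by (intro exI[of _ "\<Inter>F"] conjI)
  qed
qed

lemma topspace_seminorm_topology: "topspace (seminorm_topology W Q) \<subseteq> W"
  unfolding seminorm_topology_def topology_generated_by_topspace by blast

text \<open>Point evaluation is the seminorm of order zero over a one-point compact set; these are
  the seminorms against which pairings are estimated.\<close>

lemma derivative_seminorm_point:
  assumes "c \<in> A" "x \<in> fst c"
  shows "derivative_seminorm c {snd c x} [] \<phi> = \<bar>\<phi> x\<bar>"
  using is_chartD(5)[OF chart[OF assms(1)] assms(2)] by (simp add: derivative_seminorm_def)

lemma pairing_test_function:
  assumes "\<gamma> \<in> configurations" "\<phi> \<in> test_functions_in A K" "compact K"
  shows "pairing \<gamma> \<phi> = (\<Sum>x\<in>\<gamma> \<inter> K. \<phi> x)"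
proof (rule pairing_eq_sum_Int[OF assms(1)])
  show "K \<in> relatively_compact_borel" using assms(3) by auto
  show "\<phi> x = 0" if "x \<notin> K" for x
    using that assms(2) closure_subset[of "{x. \<phi> x \<noteq> 0}"] by (auto simp: test_functions_in_def)
qed

text \<open>On functions supported in K the pairing is a finite sum of point evaluations, at the
  points of \<gamma> in K.\<close>

lemma abs_pairing_continuous_in:
  assumes \<gamma>: "\<gamma> \<in> configurations" and K: "compact K"
  shows "continuous_map (test_topology_in A K) euclideanreal (\<lambda>\<phi>. \<bar>pairing \<gamma> \<phi>\<bar>)"
proof -
  let ?W = "test_functions_in A K"
  let ?Q = "{derivative_seminorm c L vs | c L vs. c \<in> A \<and> compact L \<and> L \<noteq> {} \<and> L \<subseteq> snd c ` fst c}"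
  define S where "S = \<gamma> \<inter> K"
  have S: "finite S" using \<gamma> K by (auto simp: S_def configurations_def)
  have ev: "\<exists>p\<in>?Q. \<forall>\<phi>. p \<phi> = \<bar>\<phi> x\<bar>" for x
  proof -
    have "x \<in> (\<Union>c\<in>A. fst c)" using A by (simp add: smooth_atlas_def)
    then obtain c where c: "c \<in> A" "x \<in> fst c" by blast
    then have "derivative_seminorm c {snd c x} [] \<in> ?Q"
      by (intro CollectI exI[of _ c] exI[of _ "{snd c x}"] exI[of _ "[]"]) auto
    then show ?thesis by (rule bexI[rotated]) (simp add: derivative_seminorm_point[OF c])
  qed
  have ball: "{\<psi> \<in> ?W. \<bar>\<psi> x - \<phi> x\<bar> < e} \<in> {{\<psi> \<in> ?W. p (\<lambda>x. \<psi> x - \<phi> x) < e} | p \<phi> e. p \<in> ?Q \<and> \<phi> \<in> ?W \<and> e > 0}"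
    if "\<phi> \<in> ?W" "e > 0" for x \<phi> e
  proof -
    from ev[of x] show ?thesis
    proof (rule bexE)
      fix p assume p: "p \<in> ?Q" "\<forall>\<phi>. p \<phi> = \<bar>\<phi> x\<bar>"
      have "{\<psi> \<in> ?W. \<bar>\<psi> x - \<phi> x\<bar> < e} = {\<psi> \<in> ?W. p (\<lambda>x. \<psi> x - \<phi> x) < e}" using p(2) by simp
      then show ?thesis
        by (intro CollectI exI[of _ p] exI[of _ \<phi>] exI[of _ e] conjI p(1)[unfolded mem_Collect_eq] that)
    qed
  qed
  show ?thesis
    unfolding continuous_map_def
  proof (intro conjI allI impI)
    fix U :: "real set" assume U: "openin euclideanreal U"
    let ?G = "{\<phi> \<in> topspace (test_topology_in A K). \<bar>pairing \<gamma> \<phi>\<bar> \<in> U}"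
    have top: "topspace (test_topology_in A K) = ?W"
    proof
      show "topspace (test_topology_in A K) \<subseteq> ?W"
        unfolding test_topology_in_def by (rule topspace_seminorm_topology)
      show "?W \<subseteq> topspace (test_topology_in A K)"
      proof
        fix \<phi> assume \<phi>: "\<phi> \<in> ?W"
        \<comment> \<open>Any point serves here: some subbasic set has to contain \<phi> for it to
          belong to the topological space at all.\<close>
        have self: "\<phi> \<in> {\<psi> \<in> ?W. \<bar>\<psi> undefined - \<phi> undefined\<bar> < 1}" using \<phi> by simp
        show "\<phi> \<in> topspace (test_topology_in A K)"
          unfolding test_topology_in_def seminorm_topology_def topology_generated_by_topspace
          by (rule UnionI[OF ball[OF \<phi> zero_less_one] self])
      qed
    qed
    show "openin (test_topology_in A K) ?G"
      unfolding test_topology_in_def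
    proof (rule openin_seminorm_topologyI)
      show "{\<phi> \<in> topspace (seminorm_topology ?W ?Q). \<bar>pairing \<gamma> \<phi>\<bar> \<in> U} \<subseteq> ?W"
        using topspace_seminorm_topology by blast
      fix \<phi> assume "\<phi> \<in> {\<phi> \<in> topspace (seminorm_topology ?W ?Q). \<bar>pairing \<gamma> \<phi>\<bar> \<in> U}"
      then have \<phi>: "\<phi> \<in> ?W" "\<bar>pairing \<gamma> \<phi>\<bar> \<in> U" using topspace_seminorm_topology[of ?W ?Q] by auto
      obtain e where e: "e > 0" "ball \<bar>pairing \<gamma> \<phi>\<bar> e \<subseteq> U" using U \<phi>(2) by (auto elim: openE)
      define d where "d = e / (real (card S) + 1)"
      have d: "d > 0" unfolding d_def using e by (intro divide_pos_pos) auto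
      \<comment> \<open>The extra point keeps the family non-empty when \<gamma> does not meet
        K.\<close>
      define F where "F = (\<lambda>x. {\<psi> \<in> ?W. \<bar>\<psi> x - \<phi> x\<bar> < d}) ` insert undefined S"
      have "\<Inter>F \<subseteq> {\<phi> \<in> topspace (seminorm_topology ?W ?Q). \<bar>pairing \<gamma> \<phi>\<bar> \<in> U}"
      proof
        fix \<psi> assume "\<psi> \<in> \<Inter>F"
        then have \<psi>: "\<psi> \<in> ?W" "\<And>x. x \<in> S \<Longrightarrow> \<bar>\<psi> x - \<phi> x\<bar> < d" by (auto simp: F_def)
        have "\<bar>pairing \<gamma> \<psi> - pairing \<gamma> \<phi>\<bar> = \<bar>\<Sum>x\<in>S. \<psi> x - \<phi> x\<bar>"
          unfolding pairing_test_function[OF \<gamma> \<phi>(1) K] pairing_test_function[OF \<gamma> \<psi>(1) K] S_def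
          by (simp add: sum_subtractf)
        also have "\<dots> \<le> (\<Sum>x\<in>S. \<bar>\<psi> x - \<phi> x\<bar>)" by (rule sum_abs)
        also have "\<dots> \<le> (\<Sum>x\<in>S. d)" using \<psi>(2) by (intro sum_mono less_imp_le)
        also have "\<dots> < e" using e by (simp add: d_def field_simps)
        finally have "\<bar>pairing \<gamma> \<psi>\<bar> \<in> ball \<bar>pairing \<gamma> \<phi>\<bar> e" by (simp add: dist_real_def)
        then show "\<psi> \<in> {\<phi> \<in> topspace (seminorm_topology ?W ?Q). \<bar>pairing \<gamma> \<phi>\<bar> \<in> U}"
          using e(2) \<psi>(1) top unfolding test_topology_in_def by auto
      qed
      moreover have "\<phi> \<in> \<Inter>F" using \<phi>(1) d by (auto simp: F_def)
      moreover have "finite F" "F \<noteq> {}" using S by (auto simp: F_def)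
      moreover have "F \<subseteq> {{\<psi> \<in> ?W. p (\<lambda>x. \<psi> x - \<phi> x) < e} | p \<phi> e. p \<in> ?Q \<and> \<phi> \<in> ?W \<and> e > 0}"
        unfolding F_def by (rule image_subsetI) (rule ball[OF \<phi>(1) d])
      ultimately show "\<exists>F. finite F \<and> F \<noteq> {} \<and>
          F \<subseteq> {{\<psi> \<in> ?W. p (\<lambda>x. \<psi> x - \<phi> x) < e} | p \<phi> e. p \<in> ?Q \<and> \<phi> \<in> ?W \<and> e > 0} \<and> \<phi> \<in> \<Inter>F \<and>
          \<Inter>F \<subseteq> {\<phi> \<in> topspace (seminorm_topology ?W ?Q). \<bar>pairing \<gamma> \<phi>\<bar> \<in> U}"
        by (intro exI[of _ F] conjI)
    qed
  qed simp
qed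

lemma pairing_linear:
  assumes \<gamma>: "\<gamma> \<in> configurations" and \<phi>: "\<phi> \<in> test_functions A" and \<psi>: "\<psi> \<in> test_functions A"
  shows "pairing \<gamma> (\<lambda>x. \<phi> x + \<psi> x) = pairing \<gamma> \<phi> + pairing \<gamma> \<psi>"
    "pairing \<gamma> (\<lambda>x. a * \<phi> x) = a * pairing \<gamma> \<phi>"
    "pairing \<gamma> (\<lambda>x. \<phi> x - \<psi> x) = pairing \<gamma> \<phi> - pairing \<gamma> \<psi>"
proof -
  define K where "K = closure {x. \<phi> x \<noteq> 0} \<union> closure {x. \<psi> x \<noteq> 0}"
  have "compact K" unfolding K_def using test_functionD(2) \<phi> \<psi> by (intro compact_Un)
  then have K: "K \<in> relatively_compact_borel" by auto
  have zero: "\<phi> x = 0" "\<psi> x = 0" if "x \<notin> K" for x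
    using that closure_subset[of "{x. \<phi> x \<noteq> 0}"] closure_subset[of "{x. \<psi> x \<noteq> 0}"] unfolding K_def by auto
  note eq = pairing_eq_sum_Int[OF \<gamma> K]
  show "pairing \<gamma> (\<lambda>x. \<phi> x + \<psi> x) = pairing \<gamma> \<phi> + pairing \<gamma> \<psi>"
    using zero by (simp add: eq sum.distrib)
  show "pairing \<gamma> (\<lambda>x. a * \<phi> x) = a * pairing \<gamma> \<phi>"
    using zero by (simp add: eq sum_distrib_left)
  show "pairing \<gamma> (\<lambda>x. \<phi> x - \<psi> x) = pairing \<gamma> \<phi> - pairing \<gamma> \<psi>"
    using zero by (simp add: eq sum_subtractf)
qed

text \<open>The absolute pairing with \<gamma> is itself one of the seminorms defining the inductive
  limit topology. Its balls are therefore open, and linearity turns such a ball around \<phi> into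
  an estimate for the difference of the pairings.\<close>

lemma delta_embedding_generalized_function:
  assumes \<gamma>: "\<gamma> \<in> configurations"
  shows "delta_embedding A \<gamma> \<in> generalized_functions A"
proof -
  let ?W = "test_functions A"
  let ?p = "\<lambda>\<phi>. \<bar>pairing \<gamma> \<phi>\<bar>"
  let ?Q = "{p. is_seminorm ?W p \<and> (\<forall>K. compact K \<longrightarrow> continuous_map (test_topology_in A K) euclideanreal p)}"
  have "is_seminorm ?W ?p"
    unfolding is_seminorm_def by (simp add: pairing_linear[OF \<gamma>] abs_mult abs_triangle_ineq)
  then have p: "?p \<in> ?Q" using abs_pairing_continuous_in[OF \<gamma>] by simp
  have ball: "{\<psi> \<in> ?W. ?p (\<lambda>x. \<psi> x - \<phi> x) < e} \<in> {{\<psi> \<in> ?W. p (\<lambda>x. \<psi> x - \<phi> x) < e} | p \<phi> e. p \<in> ?Q \<and> \<phi> \<in> ?W \<and> e > 0}"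
    if "\<phi> \<in> ?W" "e > 0" for \<phi> e
    using p that by (intro CollectI exI[of _ ?p] exI[of _ \<phi>] exI[of _ e]) simp
  have self: "\<phi> \<in> {\<psi> \<in> ?W. ?p (\<lambda>x. \<psi> x - \<phi> x) < e}" if "\<phi> \<in> ?W" "e > 0" for \<phi> e
    using that pairing_linear(3)[OF \<gamma> that(1) that(1)] by simp
  have top: "topspace (seminorm_topology ?W ?Q) = ?W"
  proof
    show "?W \<subseteq> topspace (seminorm_topology ?W ?Q)"
    proof
      fix \<phi> assume \<phi>: "\<phi> \<in> ?W"
      show "\<phi> \<in> topspace (seminorm_topology ?W ?Q)"
        unfolding seminorm_topology_def topology_generated_by_topspace
        by (rule UnionI[OF ball[OF \<phi> zero_less_one] self[OF \<phi> zero_less_one]])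
    qed
  qed (rule topspace_seminorm_topology)
  have "continuous_map (test_topology A) euclideanreal (delta_embedding A \<gamma>)"
    unfolding test_topology_def
  proof (subst continuous_map_def, intro conjI allI impI)
    fix U :: "real set" assume U: "openin euclideanreal U"
    show "openin (seminorm_topology ?W ?Q) {\<phi> \<in> topspace (seminorm_topology ?W ?Q). delta_embedding A \<gamma> \<phi> \<in> U}"
      unfolding top
    proof (rule openin_seminorm_topologyI[rotated])
      fix \<phi> assume "\<phi> \<in> {\<phi> \<in> ?W. delta_embedding A \<gamma> \<phi> \<in> U}"
      then have \<phi>: "\<phi> \<in> ?W" "pairing \<gamma> \<phi> \<in> U" by (auto simp: delta_embedding_def)
      obtain e where e: "e > 0" "ball (pairing \<gamma> \<phi>) e \<subseteq> U" using U \<phi>(2) by (auto elim: openE)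
      have "{\<psi> \<in> ?W. ?p (\<lambda>x. \<psi> x - \<phi> x) < e} \<subseteq> {\<phi> \<in> ?W. delta_embedding A \<gamma> \<phi> \<in> U}"
      proof
        fix \<psi> assume \<psi>: "\<psi> \<in> {\<psi> \<in> ?W. ?p (\<lambda>x. \<psi> x - \<phi> x) < e}"
        then have "\<bar>pairing \<gamma> \<psi> - pairing \<gamma> \<phi>\<bar> < e"
          using pairing_linear(3)[OF \<gamma> _ \<phi>(1), of \<psi>] by auto
        then have "pairing \<gamma> \<psi> \<in> ball (pairing \<gamma> \<phi>) e"
          by (simp add: dist_real_def abs_minus_commute)
        then show "\<psi> \<in> {\<phi> \<in> ?W. delta_embedding A \<gamma> \<phi> \<in> U}" using \<psi> e(2) by (auto simp: delta_embedding_def)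
      qed
      then show "\<exists>F. finite F \<and> F \<noteq> {} \<and>
          F \<subseteq> {{\<psi> \<in> ?W. p (\<lambda>x. \<psi> x - \<phi> x) < e} | p \<phi> e. p \<in> ?Q \<and> \<phi> \<in> ?W \<and> e > 0} \<and> \<phi> \<in> \<Inter>F \<and>
          \<Inter>F \<subseteq> {\<phi> \<in> ?W. delta_embedding A \<gamma> \<phi> \<in> U}"
        using ball[OF \<phi>(1) e(1)] self[OF \<phi>(1) e(1)]
        by (intro exI[of _ "{{\<psi> \<in> ?W. ?p (\<lambda>x. \<psi> x - \<phi> x) < e}}"] conjI) simp_all
    qed (rule Collect_restrict)
  qed (simp add: Pi_def)
  then show ?thesis
    unfolding generalized_functions_def
    using pairing_linear[OF \<gamma>] test_functions_add test_functions_scale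
    by (simp add: delta_embedding_def)
qed

end

locale fractional_poisson_manifold = fractional_poisson b \<mu> \<alpha> \<nu> + test_function_space A
  for b :: "nat \<Rightarrow> 'a::{t2_space, second_countable_topology} set" and \<mu> :: "'a measure"
    and \<alpha> :: real and \<nu> :: "real measure" and A :: "('a, 'n::finite) chart set"
begin

lemma measurable_pairing:
  assumes "\<phi> \<in> test_functions A"
  shows "(\<lambda>\<gamma>. pairing \<gamma> \<phi>) \<in> borel_measurable (borel_configurations :: 'a set measure)"
proof -
  define K where "K = closure {x. \<phi> x \<noteq> 0}"
  have K: "K \<in> relatively_compact_borel" "\<And>x. x \<notin> K \<Longrightarrow> \<phi> x = 0"
    using test_functionD(2)[OF assms] closure_subset[of "{x. \<phi> x \<noteq> 0}"] unfolding K_def by auto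
  have "(\<lambda>\<gamma>. pairing \<gamma> \<phi>) \<in> borel_measurable borel_configurations \<longleftrightarrow>
      (\<lambda>\<gamma>. \<Sum>x\<in>\<gamma> \<inter> K. \<phi> x) \<in> borel_measurable borel_configurations"
  proof (rule measurable_cong)
    fix \<gamma> :: "'a set" assume "\<gamma> \<in> space borel_configurations"
    then show "pairing \<gamma> \<phi> = (\<Sum>x\<in>\<gamma> \<inter> K. \<phi> x)"
      unfolding space_borel_configurations by (rule pairing_eq_sum_Int[OF _ K])
  qed
  then show ?thesis
    using measurable_sum_count_algebra[OF subset_refl K(1) borel_measurable_continuous_onI[OF test_functionD(1)[OF assms]]]
    by (simp add: measurable_cong_sets[OF sets_borel_configurations refl])
qed

lemma delta_embedding_measurable: "delta_embedding A \<in> borel_configurations \<rightarrow>\<^sub>M cylinder_algebra A"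
proof (rule measurable_sigma_sets[OF sets_cylinder_algebra cylinder_sets_subset])
  show "delta_embedding A \<in> space borel_configurations \<rightarrow> generalized_functions A"
    unfolding space_borel_configurations using delta_embedding_generalized_function by blast
  fix C assume "C \<in> cylinder_sets A"
  then obtain k \<phi> B where C: "C = {u \<in> generalized_functions A. (\<lambda>i\<in>{..<k}. u (\<phi> i)) \<in> B}"
    "\<And>i. i < k \<Longrightarrow> \<phi> i \<in> test_functions A" "B \<in> sets (\<Pi>\<^sub>M i\<in>{..<k::nat}. (borel :: real measure))"
    unfolding cylinder_sets_def by blast
  have "(\<lambda>\<gamma>. \<lambda>i\<in>{..<k}. pairing \<gamma> (\<phi> i)) \<in> (borel_configurations :: 'a set measure) \<rightarrow>\<^sub>M (\<Pi>\<^sub>M i\<in>{..<k}. borel)"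
    by (rule measurable_restrict) (use C(2) measurable_pairing in auto)
  note measurable_sets[OF this C(3)]
  moreover have "delta_embedding A -` C \<inter> space borel_configurations =
      (\<lambda>\<gamma>. \<lambda>i\<in>{..<k}. pairing \<gamma> (\<phi> i)) -` B \<inter> space borel_configurations"
  proof -
    have "(\<lambda>i\<in>{..<k}. delta_embedding A \<gamma> (\<phi> i)) = (\<lambda>i\<in>{..<k}. pairing \<gamma> (\<phi> i))" for \<gamma>
      using C(2) by (auto simp: delta_embedding_def restrict_def)
    then show ?thesis
      unfolding C(1) space_borel_configurations using delta_embedding_generalized_function by auto
  qed
  ultimately show "delta_embedding A -` C \<inter> space borel_configurations \<in> sets borel_configurations" by simp
qed

lemma fractional_poisson_measure_test_charfun:
  assumes "\<phi> \<in> test_functions A"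
  shows "(\<integral>\<gamma>. iexp (pairing \<gamma> \<phi>) \<partial>fractional_poisson_measure) =
    mittag_leffler \<alpha> (\<integral>x. (iexp (\<phi> x) - 1) \<partial>\<mu>)"
  by (rule fractional_poisson_measure_pairing_charfun[OF test_functionD[OF assms]])

text \<open>Existence is obtained by exhibiting the image of the measure on configurations; with
  uniqueness this is already the support statement.\<close>

lemma has_characteristic_functional_distr:
  "has_characteristic_functional A (distr fractional_poisson_measure (cylinder_algebra A) (delta_embedding A))
    (fractional_poisson_functional \<alpha> \<mu>)"
proof -
  interpret \<pi>: prob_space fractional_poisson_measure by (rule prob_space_fractional_poisson_measure)
  have m: "delta_embedding A \<in> fractional_poisson_measure \<rightarrow>\<^sub>M cylinder_algebra A"
    using delta_embedding_measurable by (simp add: measurable_cong_sets[OF sets_fractional_poisson_measure refl])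
  have "(\<integral>u. iexp (u \<phi>) \<partial>distr fractional_poisson_measure (cylinder_algebra A) (delta_embedding A)) =
    fractional_poisson_functional \<alpha> \<mu> \<phi>" if \<phi>: "\<phi> \<in> test_functions A" for \<phi>
  proof -
    have "(\<lambda>u. iexp (u \<phi>)) \<in> borel_measurable (cylinder_algebra A)"
      using measurable_evaluation[OF \<phi>] by measurable
    then show ?thesis
      using fractional_poisson_measure_test_charfun[OF \<phi>] \<phi>
      by (subst integral_distr[OF m]) (simp_all add: delta_embedding_def fractional_poisson_functional_def)
  qed
  then show ?thesis
    unfolding has_characteristic_functional_def using \<pi>.prob_space_distr[OF m] by simp
qed

lemma characteristic_functional_eq_distr:
  "has_characteristic_functional A P (fractional_poisson_functional \<alpha> \<mu>) \<Longrightarrow>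
    P = distr fractional_poisson_measure (cylinder_algebra A) (delta_embedding A)"
  by (rule characteristic_functional_unique[OF _ has_characteristic_functional_distr])

end

text \<open>The only subsets of a singleton are the empty set and itself, so none has a measure
  strictly in between.\<close>

lemma non_atomic_singleton:
  fixes \<mu> :: "'a::t2_space measure"
  assumes "non_atomic \<mu>" "sets \<mu> = sets borel"
  shows "emeasure \<mu> {x} = 0"
proof (rule ccontr)
  assume "emeasure \<mu> {x} \<noteq> 0"
  then obtain B where "B \<subseteq> {x}" "0 < emeasure \<mu> B" "emeasure \<mu> B < emeasure \<mu> {x}"
    using assms unfolding non_atomic_def by (auto simp: zero_less_iff_neq_zero)
  then show False by (metis emeasure_empty less_irrefl subset_singletonD)
qed

theorem mainTheorem2:
  fixes A :: "('a::{t2_space, second_countable_topology}, 'n::finite) chart set"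
    and g :: "('a, 'n) chart \<Rightarrow> 'a \<Rightarrow> real ^ 'n ^ 'n"
    and \<mu> :: "'a measure"
    and \<alpha> :: real
  assumes "oriented_atlas A"
    and "riemannian_metric A g"
    and "geodesically_complete A g"
    and "connected (UNIV :: 'a set)"
    and "\<not> compact (UNIV :: 'a set)"
    and "radon_measure \<mu>"
    and "non_atomic \<mu>"
    and "\<And>U. open U \<Longrightarrow> U \<noteq> {} \<Longrightarrow> emeasure \<mu> U > 0"
    and "emeasure \<mu> UNIV = \<infinity>"
    and "0 < \<alpha>" and "\<alpha> < 1"
  shows
    "(\<forall>\<Lambda>\<in>relatively_compact_borel.
        (\<forall>n. fractional_poisson_weight \<alpha> (measure \<mu> \<Lambda>) n \<in> \<real>\<^sub>\<ge>\<^sub>0) \<and>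
        prob_space (fractional_poisson_in \<alpha> \<mu> \<Lambda>)) \<and>
     (\<forall>\<Lambda>\<^sub>1\<in>relatively_compact_borel. \<forall>\<Lambda>\<^sub>2\<in>relatively_compact_borel. \<Lambda>\<^sub>1 \<subseteq> \<Lambda>\<^sub>2 \<longrightarrow>
        restrict_configuration \<Lambda>\<^sub>1 \<in> borel_configurations_in \<Lambda>\<^sub>2 \<rightarrow>\<^sub>M borel_configurations_in \<Lambda>\<^sub>1 \<and>
        fractional_poisson_in \<alpha> \<mu> \<Lambda>\<^sub>1 =
          distr (fractional_poisson_in \<alpha> \<mu> \<Lambda>\<^sub>2) (borel_configurations_in \<Lambda>\<^sub>1)
            (restrict_configuration \<Lambda>\<^sub>1)) \<and>
     (\<exists>\<pi>. has_projections (fractional_poisson_in \<alpha> \<mu>) \<pi> \<and>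
        (\<forall>\<pi>'. has_projections (fractional_poisson_in \<alpha> \<mu>) \<pi>' \<longrightarrow> \<pi>' = \<pi>) \<and>
        (\<forall>\<phi>\<in>test_functions A.
           (\<integral>\<gamma>. exp (\<i> * of_real (pairing \<gamma> \<phi>)) \<partial>\<pi>) =
             mittag_leffler \<alpha> (\<integral>x. (exp (\<i> * of_real (\<phi> x)) - 1) \<partial>\<mu>)) \<and>
        delta_embedding A \<in> borel_configurations \<rightarrow>\<^sub>M cylinder_algebra A \<and>
        (\<exists>!P. has_characteristic_functional A P (fractional_poisson_functional \<alpha> \<mu>)) \<and>
        (\<forall>P. has_characteristic_functional A P (fractional_poisson_functional \<alpha> \<mu>) \<longrightarrow>
           P = distr \<pi> (cylinder_algebra A) (delta_embedding A)))"
proof -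
  have atlas: "smooth_atlas A" using assms(1) by (simp add: oriented_atlas_def)
  obtain b :: "nat \<Rightarrow> 'a set" where b: "locally_compact_base b"
    using ex_locally_compact_base[OF smooth_atlas_locally_compact[OF atlas]] by blast
  obtain \<nu> where \<nu>: "real_distribution \<nu>" "AE \<tau> in \<nu>. 0 \<le> \<tau>" "\<And>j. integrable \<nu> (\<lambda>\<tau>. \<tau> ^ j)"
    "\<And>j. (\<integral>\<tau>. \<tau> ^ j \<partial>\<nu>) = fact j / Gamma (\<alpha> * real j + 1)"
    using mittag_leffler_distribution[OF assms(10,11)] by blast
  have sets: "sets \<mu> = sets borel" and cpt: "\<And>K. compact K \<Longrightarrow> emeasure \<mu> K < \<infinity>"
    using assms(6) by (auto simp: radon_measure_def)
  interpret fractional_poisson_manifold b \<mu> \<alpha> \<nu> A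
    by (intro fractional_poisson_manifold.intro fractional_poisson.intro intensity_measure.intro b
        intensity_measure_axioms.intro mittag_leffler_mixing.intro test_function_space.intro
        atlas \<nu> assms(10) sets cpt non_atomic_singleton[OF assms(7) sets])
  have weights: "fractional_poisson_weight \<alpha> (measure \<mu> \<Lambda>) n \<in> \<real>\<^sub>\<ge>\<^sub>0" for \<Lambda> n
    by (simp add: mix.fractional_poisson_weight_eq mix.weight_nonneg)
  have unique: "\<exists>!P. has_characteristic_functional A P (fractional_poisson_functional \<alpha> \<mu>)"
    using has_characteristic_functional_distr characteristic_functional_eq_distr by (rule ex1I)
  show ?thesis
    by (intro conjI ballI allI impI exI[of _ fractional_poisson_measure])
      (rule weights prob_space_fractional_poisson_in restrict_configuration_measurable_in
        fractional_poisson_consistent has_projections_fractional_poisson_measure has_projections_unique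
        fractional_poisson_measure_test_charfun delta_embedding_measurable unique
        characteristic_functional_eq_distr; assumption?)+
qed

end
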